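(* Let $A=E_1\times E_2$ be a decomposable Abelian surface with $\rho(A)=3$. Assume that $E_1\not\simeq E_2$. Let $W$ be the group $(\mathbb{Z}/2\mathbb{Z})^{\tau(N)}$ of Atkin–Lehner involutions acting on $\Gamma_0(N)\backslash\mathbb{H}$. Then $$W\cdot\omega(E_1,E_2)=\{\,\omega(E_{\sigma,1},E_{\sigma,2}),\ \omega(E_{\sigma,2},E_{\sigma,1})\,\}_{\sigma\in\Sigma}.$$
   Context: An Abelian surface means a complex Abelian surface; $\rho(A)$ is the Picard number. A decomposition of $A$ is an ordered pair $(F_1,F_2)$ of elliptic curves in $A$ such that the natural homomorphism $F_1\times F_2\to A$ is an isomorphism. Let $N$ be the positive integer with $NS_A\simeq U\oplus\langle -2N\rangle$ ($U$ the hyperbolic plane), i.e. $N=\frac12\det(NS_A)$; for every decomposition $(E,F)$ of $A$, $N$ is the minimal degree of an isogeny $E\to F$, and the kernel of an isogeny of degree $N$ is cyclic of order $N$ and determined by $(E,F)$. One has $N>1$ when $E_1\not\simeq E_2$. $\tau(N)$ is the number of distinct primes dividing $N$ (for $N>1$). $\Gamma_0(N)\backslash\mathbb{H}$, with $\Gamma_0(N)=\{\begin{pmatrix}a&b\\c&d\end{pmatrix}\in SL_2(\mathbb{Z}): c\equiv0 \bmod N\}$, is the moduli space of pairs $(E,C)$ of an elliptic curve and a cyclic subgroup $C\subset E$ of order $N$. For a decomposition $(E,F)$ of $A$, $\omega(E,F)\in\Gamma_0(N)\backslash\mathbb{H}$ is the point of the pair $(E,\mathrm{Ker}(\phi))$,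 where $\phi:E\to F$ is an isogeny of the minimal degree $N$. The Atkin–Lehner involutions on $\Gamma_0(N)\backslash\mathbb{H}$ are, for each positive divisor $r$ of $N$ with $\gcd(r,N/r)=1$, the maps $(E,C)\mapsto(E/C_r,\,(C+E[r])/C_r)$ with $C_r\subset C$ the subgroup of order $r$; they form the action of a group $\simeq(\mathbb{Z}/2\mathbb{Z})^{\tau(N)}$. Construction of $E_{\sigma,i}$: let $\Sigma:=\{(r_\sigma,s_\sigma)\mid r_\sigma,s_\sigma\in\mathbb{Z}_{>0},\ \gcd(r_\sigma,s_\sigma)=1,\ r_\sigma s_\sigma=N,\ r_\sigma\le s_\sigma\}$. Let $\phi:E_1\to E_2$ be an isogeny of degree $N$ with cyclic kernel $G\subset E_1$. For $\sigma\in\Sigma$ let $G_{\sigma,1}$ (resp. $G_{\sigma,2}$) be the sum of the $p$-primary components of $G$ over primes $p\mid r_\sigma$ (resp. $p\mid s_\sigma$), and set $E_{\sigma,i}:=E_1/G_{\sigma,i}$. To regard $(E_{\sigma,1},E_{\sigma,2})$ as a decomposition of $A$: fix integers $a_\sigma,b_\sigma$ with $a_\sigma r_\sigma+b_\sigma s_\sigma=1$, factor $\phi$ as $E_1\xrightarrow{\phi_{\sigma,i}^+}E_{\sigma,i}\xrightarrow{\phi_{\sigma,i}^-}E_2$ with $\phi_{\sigma,i}^+$ the quotient map, and use the isomorphism $\begin{pmatrix}\widehat{\phi_{\sigma,1}^+}& b_\sigma\widehat{\phi_{\sigma,2}^+}\\ -\phi_{\sigma,1}^-& a_\sigma\phi_{\sigma,2}^-\end{pmatrix}:E_{\sigma,1}\times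 E_{\sigma,2}\to E_1\times E_2=A$ (hats denote dual isogenies). *)

theory Defs
  imports
    "HOL-Analysis.Analysis"
    "HOL-Computational_Algebra.Computational_Algebra"
    "HOL-Algebra.Group_Action"
    "HOL-Algebra.Generated_Groups"
begin

section \<open>Complex elliptic curves\<close>

text \<open>
  A complex elliptic curve is a one-dimensional complex torus.  It is represented by its period
  lattice; its group of points is the quotient group, so that a point is a coset of the lattice.
\<close>

definition period_lattice :: "complex set \<Rightarrow> bool" where
  "period_lattice L \<longleftrightarrow> (\<exists>w1 w2. Im (w2 / w1) \<noteq> 0 \<and>
     L = {of_int m * w1 + of_int n * w2 | m n :: int. True})"

definition complex_add :: "complex monoid" where
  "complex_add = \<lparr>carrier = UNIV, mult = (+), one = 0\<rparr>"

definition ell :: "complex set \<Rightarrow> complex set monoid" where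
  "ell L = complex_add Mod L"

definition pt :: "complex set \<Rightarrow> complex \<Rightarrow> complex set" where
  "pt L z = L #>\<^bsub>complex_add\<^esub> z"

text \<open>
  The projections from the complex plane are local biholomorphisms, so a map of elliptic curves is
  holomorphic iff locally it lifts to a holomorphic function.
\<close>

definition holomorphic_map :: "complex set \<Rightarrow> complex set \<Rightarrow> (complex set \<Rightarrow> complex set) \<Rightarrow> bool" where
  "holomorphic_map L L' f \<longleftrightarrow>
     (\<forall>z. \<exists>e>0. \<exists>g. g holomorphic_on ball z e \<and> (\<forall>w\<in>ball z e. f (pt L w) = pt L' (g w)))"

definition ell_hom :: "complex set \<Rightarrow> complex set \<Rightarrow> (complex set \<Rightarrow> complex set) set" where
  "ell_hom L L' = {f \<in> hom (ell L) (ell L'). holomorphic_map L L' f}"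

definition ell_isomorphic :: "complex set \<Rightarrow> complex set \<Rightarrow> bool" where
  "ell_isomorphic L L' \<longleftrightarrow> (\<exists>f\<in>ell_hom L L'. \<exists>g\<in>ell_hom L' L.
     (\<forall>P\<in>carrier (ell L). g (f P) = P) \<and> (\<forall>Q\<in>carrier (ell L'). f (g Q) = Q))"

definition isogeny :: "complex set \<Rightarrow> complex set \<Rightarrow> (complex set \<Rightarrow> complex set) \<Rightarrow> bool" where
  "isogeny L L' f \<longleftrightarrow> f \<in> ell_hom L L' \<and> f ` carrier (ell L) = carrier (ell L')
     \<and> finite (kernel (ell L) (ell L') f)"

definition isog_degree :: "complex set \<Rightarrow> complex set \<Rightarrow> (complex set \<Rightarrow> complex set) \<Rightarrow> nat" where
  "isog_degree L L' f = card (kernel (ell L) (ell L') f)"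

text \<open>Homomorphisms of HOL-Algebra are unspecified off the carrier; \<open>extensional\<close> makes the
  descriptions below unique.\<close>

definition dual_isogeny ::
  "complex set \<Rightarrow> complex set \<Rightarrow> (complex set \<Rightarrow> complex set) \<Rightarrow> complex set \<Rightarrow> complex set" where
  "dual_isogeny L L' f = (THE g. g \<in> ell_hom L' L \<inter> extensional (carrier (ell L')) \<and>
     (\<forall>P\<in>carrier (ell L). g (f P) = P [^]\<^bsub>ell L\<^esub> isog_degree L L' f))"

definition cyclic_subgroup :: "complex set \<Rightarrow> nat \<Rightarrow> complex set set \<Rightarrow> bool" where
  "cyclic_subgroup L n C \<longleftrightarrow> (\<exists>P\<in>carrier (ell L). C = generate (ell L) {P}) \<and> finite C \<and> card C = n"

definition torsion :: "complex set \<Rightarrow> nat \<Rightarrow> complex set set" where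
  "torsion L n = {P \<in> carrier (ell L). P [^]\<^bsub>ell L\<^esub> n = \<one>\<^bsub>ell L\<^esub>}"

text \<open>
  For a finite subgroup \<open>G\<close> of \<open>E\<close>, the quotient \<open>E/G\<close> is the elliptic curve whose period lattice is
  the preimage of \<open>G\<close> in the complex plane, i.e. the union of the cosets belonging to \<open>G\<close>.
\<close>

definition quot_curve :: "complex set set \<Rightarrow> complex set" where
  "quot_curve G = \<Union>G"

definition quot_map :: "complex set set \<Rightarrow> complex set \<Rightarrow> complex set" where
  "quot_map G P = P <#>\<^bsub>complex_add\<^esub> quot_curve G"

text \<open>The map \<open>E/G \<rightarrow> E'\<close> through which \<open>f : E \<rightarrow> E'\<close> factors.\<close>

definition induced_map :: "complex set \<Rightarrow> complex set \<Rightarrow> (complex set \<Rightarrow> complex set)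
    \<Rightarrow> complex set set \<Rightarrow> complex set \<Rightarrow> complex set" where
  "induced_map L L' f G = (THE g. g \<in> ell_hom (quot_curve G) L' \<inter> extensional (carrier (ell (quot_curve G)))
     \<and> (\<forall>P\<in>carrier (ell L). g (quot_map G P) = f P))"

definition primary_component :: "complex set \<Rightarrow> nat \<Rightarrow> complex set set \<Rightarrow> complex set set" where
  "primary_component L p G = {P \<in> G. \<exists>k::nat. P [^]\<^bsub>ell L\<^esub> (p ^ k) = \<one>\<^bsub>ell L\<^esub>}"

definition sum_primary :: "complex set \<Rightarrow> nat \<Rightarrow> complex set set \<Rightarrow> complex set set" where
  "sum_primary L r G = generate (ell L) (\<Union>p\<in>{p. prime p \<and> p dvd r}. primary_component L p G)"


section \<open>The modular curve and its Atkin--Lehner involutions\<close>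

definition upper_half :: "complex set" where
  "upper_half = {t. Im t > 0}"

definition Gamma0 :: "nat \<Rightarrow> (int^2^2) set" where
  "Gamma0 N = {M. det M = 1 \<and> int N dvd M $ 2 $ 1}"

definition mobius :: "int^2^2 \<Rightarrow> complex \<Rightarrow> complex" where
  "mobius M t = (of_int (M $ 1 $ 1) * t + of_int (M $ 1 $ 2)) / (of_int (M $ 2 $ 1) * t + of_int (M $ 2 $ 2))"

definition Y0 :: "nat \<Rightarrow> complex set set" where
  "Y0 N = (\<lambda>t. (\<lambda>M. mobius M t) ` Gamma0 N) ` upper_half"

definition std_lattice :: "complex \<Rightarrow> complex set" where
  "std_lattice t = {of_int m + of_int n * t | m n :: int. True}"

definition pair_isomorphic :: "complex set \<Rightarrow> complex set set \<Rightarrow> complex set \<Rightarrow> complex set set \<Rightarrow> bool" where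
  "pair_isomorphic L C L' C' \<longleftrightarrow> (\<exists>f\<in>ell_hom L L'. \<exists>g\<in>ell_hom L' L.
     (\<forall>P\<in>carrier (ell L). g (f P) = P) \<and> (\<forall>Q\<in>carrier (ell L'). f (g Q) = Q) \<and> f ` C = C')"

text \<open>
  The moduli interpretation: the orbit of \<open>t\<close> under \<open>Gamma0 N\<close> is the class of the elliptic curve
  with periods \<open>1, t\<close> together with the cyclic subgroup generated by \<open>1/N\<close>.  (With lower left entry
  divisible by \<open>N\<close>, it is \<open>1/N\<close>, and not \<open>t/N\<close>, that generates an invariant subgroup.)
\<close>

definition moduli_point :: "nat \<Rightarrow> complex set \<Rightarrow> complex set set \<Rightarrow> complex set" where
  "moduli_point N L C = (THE X. X \<in> Y0 N \<and>
     (\<exists>t\<in>X. pair_isomorphic (std_lattice t) (generate (ell (std_lattice t)) {pt (std_lattice t) (1 / of_nat N)}) L C))"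

definition sub_of_order :: "complex set \<Rightarrow> complex set set \<Rightarrow> nat \<Rightarrow> complex set set" where
  "sub_of_order L C r = (THE H. subgroup H (ell L) \<and> H \<subseteq> C \<and> card H = r)"

definition atkin_lehner :: "nat \<Rightarrow> nat \<Rightarrow> complex set \<Rightarrow> complex set" where
  "atkin_lehner N r = (\<lambda>X\<in>Y0 N. THE X'. \<exists>L C. period_lattice L \<and> cyclic_subgroup L N C \<and>
     moduli_point N L C = X \<and>
     X' = moduli_point N (quot_curve (sub_of_order L C r))
            (quot_map (sub_of_order L C r) ` (C <#>\<^bsub>ell L\<^esub> torsion L r)))"

definition atkin_lehner_group :: "nat \<Rightarrow> (complex set \<Rightarrow> complex set) monoid" where
  "atkin_lehner_group N =
     BijGroup (Y0 N) \<lparr>carrier := {atkin_lehner N r | r. r dvd N \<and> gcd r (N div r) = 1}\<rparr>"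


section \<open>The Neron--Severi lattice of a product of two elliptic curves\<close>

definition int_comb :: "(nat \<Rightarrow> int) \<Rightarrow> 'a::real_vector list \<Rightarrow> 'a" where
  "int_comb c bs = (\<Sum>i<length bs. of_int (c i) *\<^sub>R bs ! i)"

definition int_basis :: "'a::real_vector list \<Rightarrow> 'a set \<Rightarrow> bool" where
  "int_basis bs M \<longleftrightarrow> M = range (\<lambda>c. int_comb c bs) \<and>
     (\<forall>c. int_comb c bs = 0 \<longrightarrow> (\<forall>i<length bs. c i = 0))"

text \<open>The product \<open>E1 \<times> E2\<close> is the quotient of \<open>complex^2\<close> by this lattice.\<close>

definition prod_lattice :: "complex set \<Rightarrow> complex set \<Rightarrow> (complex^2) set" where
  "prod_lattice L1 L2 = {v. v $ 1 \<in> L1 \<and> v $ 2 \<in> L2}"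

definition herm :: "complex^2^2 \<Rightarrow> complex^2 \<Rightarrow> complex^2 \<Rightarrow> complex" where
  "herm h x y = (\<Sum>i\<in>UNIV. \<Sum>j\<in>UNIV. h $ i $ j * x $ i * cnj (y $ j))"

definition im_herm :: "complex^2^2 \<Rightarrow> complex^2 \<Rightarrow> complex^2 \<Rightarrow> real" where
  "im_herm h x y = Im (herm h x y)"

text \<open>
  By the theorem of Appell and Humbert, the Neron--Severi group of a complex torus is the group of
  Hermitian forms whose imaginary part (the first Chern class, as an alternating form) is integral on
  the lattice.  Hermitian forms are given by their matrices.
\<close>

definition NS :: "(complex^2) set \<Rightarrow> (complex^2^2) set" where
  "NS L = {h. (\<forall>i j. h $ i $ j = cnj (h $ j $ i)) \<and> (\<forall>x\<in>L. \<forall>y\<in>L. im_herm h x y \<in> \<int>)}"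

definition picard_number :: "(complex^2) set \<Rightarrow> nat" where
  "picard_number L = (THE n. \<exists>bs. int_basis bs (NS L) \<and> length bs = n)"

text \<open>The value of the exterior product of two alternating forms on four vectors.\<close>

definition wedge :: "('a \<Rightarrow> 'a \<Rightarrow> real) \<Rightarrow> ('a \<Rightarrow> 'a \<Rightarrow> real) \<Rightarrow> 'a \<Rightarrow> 'a \<Rightarrow> 'a \<Rightarrow> 'a \<Rightarrow> real" where
  "wedge A B v1 v2 v3 v4 =
     A v1 v2 * B v3 v4 - A v1 v3 * B v2 v4 + A v1 v4 * B v2 v3
   + A v3 v4 * B v1 v2 - A v2 v4 * B v1 v3 + A v2 v3 * B v1 v4"

text \<open>
  The intersection number is the cup product of the Chern classes evaluated on the fundamental class,
  i.e. on a lattice basis that is positive for the complex orientation.  That orientation is the one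
  given by the square of the Kaehler form of the standard Hermitian form \<open>mat 1\<close>.
\<close>

definition intersection :: "(complex^2) set \<Rightarrow> complex^2^2 \<Rightarrow> complex^2^2 \<Rightarrow> real" where
  "intersection L h h' = (THE k. \<exists>v1 v2 v3 v4. int_basis [v1, v2, v3, v4] L \<and>
     wedge (im_herm (mat 1)) (im_herm (mat 1)) v1 v2 v3 v4 > 0 \<and>
     k = wedge (im_herm h) (im_herm h') v1 v2 v3 v4)"

text \<open>The Neron--Severi lattice is isometric to \<open>U \<oplus> \<langle>-2N\<rangle>\<close>, with \<open>U\<close> the hyperbolic plane.\<close>

definition NS_isometric_U_plus :: "(complex^2) set \<Rightarrow> nat \<Rightarrow> bool" where
  "NS_isometric_U_plus L N \<longleftrightarrow> (\<exists>u v w. int_basis [u, v, w] (NS L) \<and>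
     intersection L u u = 0 \<and> intersection L v v = 0 \<and> intersection L u v = 1 \<and>
     intersection L u w = 0 \<and> intersection L v w = 0 \<and> intersection L w w = - 2 * real N)"

definition NS_number :: "(complex^2) set \<Rightarrow> nat" where
  "NS_number L = (THE N. 0 < N \<and> NS_isometric_U_plus L N)"


section \<open>Decompositions of the product of two elliptic curves\<close>

text \<open>
  Here \<open>A\<close> is the product of the curves with period lattices \<open>L1\<close>, \<open>L2\<close>.  An elliptic curve in \<open>A\<close> is
  the image of an injective holomorphic homomorphism from an elliptic curve; the latter is then
  an isomorphism onto the former.
\<close>

abbreviation surf :: "complex set \<Rightarrow> complex set \<Rightarrow> (complex set \<times> complex set) monoid" where
  "surf L1 L2 \<equiv> ell L1 \<times>\<times> ell L2"

definition embeds_onto :: "complex set \<Rightarrow> complex set \<Rightarrow> complex set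
    \<Rightarrow> (complex set \<Rightarrow> complex set \<times> complex set) \<Rightarrow> (complex set \<times> complex set) set \<Rightarrow> bool" where
  "embeds_onto L1 L2 L j F \<longleftrightarrow> period_lattice L \<and> fst \<circ> j \<in> ell_hom L L1 \<and> snd \<circ> j \<in> ell_hom L L2 \<and>
     inj_on j (carrier (ell L)) \<and> j ` carrier (ell L) = F"

text \<open>A bijective holomorphic homomorphism of complex tori is an isomorphism, so bijectivity is all
  that has to be required of the addition map.\<close>

definition decomposition :: "complex set \<Rightarrow> complex set
    \<Rightarrow> (complex set \<times> complex set) set \<times> (complex set \<times> complex set) set \<Rightarrow> bool" where
  "decomposition L1 L2 = (\<lambda>(F1, F2).
     (\<exists>L j. embeds_onto L1 L2 L j F1) \<and> (\<exists>L j. embeds_onto L1 L2 L j F2) \<and>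
     (\<lambda>(P, Q). P \<otimes>\<^bsub>surf L1 L2\<^esub> Q) \<in>
       iso ((surf L1 L2)\<lparr>carrier := F1\<rparr> \<times>\<times> (surf L1 L2)\<lparr>carrier := F2\<rparr>) (surf L1 L2))"

definition omega :: "complex set \<Rightarrow> complex set
    \<Rightarrow> (complex set \<times> complex set) set \<times> (complex set \<times> complex set) set \<Rightarrow> complex set" where
  "omega L1 L2 = (\<lambda>(F1, F2). THE X. decomposition L1 L2 (F1, F2) \<and>
     (\<exists>L L' j j' f. embeds_onto L1 L2 L j F1 \<and> embeds_onto L1 L2 L' j' F2 \<and>
        isogeny L L' f \<and> isog_degree L L' f = NS_number (prod_lattice L1 L2) \<and>
        (\<forall>f'. isogeny L L' f' \<longrightarrow> isog_degree L L' f \<le> isog_degree L L' f') \<and>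
        X = moduli_point (NS_number (prod_lattice L1 L2)) L (kernel (ell L) (ell L') f)))"

definition std_decomposition :: "complex set \<Rightarrow> complex set
    \<Rightarrow> (complex set \<times> complex set) set \<times> (complex set \<times> complex set) set" where
  "std_decomposition L1 L2 =
     (carrier (ell L1) \<times> {\<one>\<^bsub>ell L2\<^esub>}, {\<one>\<^bsub>ell L1\<^esub>} \<times> carrier (ell L2))"

definition Sig :: "nat \<Rightarrow> (nat \<times> nat) set" where
  "Sig N = {(r, s). 0 < r \<and> 0 < s \<and> gcd r s = 1 \<and> r * s = N \<and> r \<le> s}"

text \<open>
  The curves \<open>E1/G1\<close> and \<open>E1/G2\<close> regarded as a decomposition of \<open>A\<close>, where \<open>G\<close> is the kernel of
  \<open>phi : E1 \<rightarrow> E2\<close> and \<open>G1\<close>, \<open>G2\<close> are its parts belonging to \<open>r\<close> and \<open>s\<close>: the images of the two columns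
  of the matrix with rows \<open>(dual q1, b * dual q2)\<close> and \<open>(- m1, a * m2)\<close>, where \<open>phi = mi \<circ> qi\<close> is
  the factorisation through \<open>E1/Gi\<close>.
\<close>

definition sigma_decomposition :: "complex set \<Rightarrow> complex set \<Rightarrow> (complex set \<Rightarrow> complex set)
    \<Rightarrow> nat \<times> nat \<Rightarrow> int \<Rightarrow> int
    \<Rightarrow> (complex set \<times> complex set) set \<times> (complex set \<times> complex set) set" where
  "sigma_decomposition L1 L2 phi = (\<lambda>(r, s) a b.
     let G = kernel (ell L1) (ell L2) phi;
         G1 = sum_primary L1 r G; G2 = sum_primary L1 s G;
         M1 = quot_curve G1; M2 = quot_curve G2;
         d1 = dual_isogeny L1 M1 (quot_map G1); d2 = dual_isogeny L1 M2 (quot_map G2);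
         m1 = induced_map L1 L2 phi G1; m2 = induced_map L1 L2 phi G2
     in ((\<lambda>P. (d1 P, inv\<^bsub>ell L2\<^esub> m1 P)) ` carrier (ell M1),
         (\<lambda>Q. (d2 Q [^]\<^bsub>ell L1\<^esub> b, m2 Q [^]\<^bsub>ell L2\<^esub> a)) ` carrier (ell M2)))"

end

theory Submission
  imports Defs "HOL-Algebra.Multiplicative_Group"
begin

text \<open>
Everything is transported from elliptic curves to lattices in the complex plane.  A homomorphism
between the curves with period lattices \<open>L\<close>, \<open>L'\<close> is multiplication by a number \<open>c\<close> with
\<open>c L \<subseteq> L'\<close> (\<open>ell_hom_mult\<close>), and a finite subgroup of \<open>\<complex>/L\<close> corresponds to a lattice \<open>M \<supseteq> L\<close>.  Hence an
elliptic curve with a cyclic subgroup of order \<open>N\<close> is a pair \<open>L \<subseteq> M\<close>, and by elementary divisors it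
has the form \<open>L = \<int>u + \<int>v\<close>, \<open>M = \<int>u/N + \<int>v\<close> (\<open>cyclic_subgroup_basis\<close>).  Its point of the modular
curve is its class up to homothety (\<open>moduli_point_homothety_class\<close>).

In these coordinates both sides of the claim can be computed.  Let \<open>L1 = \<int>u + \<int>v\<close>, let \<open>\<phi>\<close> be
multiplication by \<open>c\<close>, and let \<open>M = c\<^sup>-\<^sup>1 L2 = \<int>u/N + \<int>v\<close> be the lattice of its kernel.  For
\<open>N = r s\<close> with coprime \<open>r\<close>, \<open>s\<close>, the involution belonging to \<open>r\<close> maps the pair \<open>L1 \<subseteq> M\<close> to
\<open>\<int>u/r + \<int>v \<subseteq> \<int>u/N + \<int>v/r\<close> (\<open>atkin_lehner_moduli_point\<close>).  On the other side, the curves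
\<open>E1/G1\<close>, \<open>E1/G2\<close> have the period lattices \<open>M1 = \<int>u/r + \<int>v\<close> and \<open>M2 = \<int>u/s + \<int>v\<close>
(\<open>sum_primary_lat\<close>).  Multiplication by \<open>r\<close> maps \<open>M1\<close> into \<open>M2\<close>, and its kernel is given by
\<open>r\<^sup>-\<^sup>1 M2 = \<int>u/N + \<int>v/r\<close>, the same pair.  So \<open>\<omega>(E1/G1, E1/G2)\<close> is the image of \<open>\<omega>(E1, E2)\<close> under
the involution of \<open>r\<close>, and with \<open>r\<close> and \<open>s\<close> interchanged \<open>\<omega>(E1/G2, E1/G1)\<close> is its image under that
of \<open>s\<close> (\<open>omega_sigma\<close>).  The divisors \<open>r\<close> with \<open>gcd r (N/r) = 1\<close> are precisely the entries of
the elements of \<open>\<Sigma>\<close>, so the two sets agree.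

What has to be shown is that multiplication by \<open>r\<close> is an isogeny of minimal degree, and the only
one up to sign of its degree.  This is where the Picard number enters: the Neron-Severi group of
\<open>A\<close> is \<open>\<int>\<^sup>2 \<oplus> Hom(E1, E2)\<close>, so that Picard number \<open>3\<close> forces \<open>Hom(E1, E2)\<close> to have rank \<open>1\<close>, and as the
kernel of \<open>\<phi>\<close> is cyclic, \<open>\<phi>\<close> generates it (\<open>picard_number_3_imp_int\<close>).  Multipliers from \<open>M1\<close> to \<open>M2\<close>
also map \<open>L1\<close> to \<open>M\<close>, hence are integers, and they are divisible by \<open>r\<close>
(\<open>lattice_mult_intermediate\<close>).  Finally, \<open>\<omega>\<close> is defined by means of arbitrary parametrisations of the
two curves in \<open>A\<close>; these are images of lines in \<open>\<complex>\<^sup>2\<close>, and a curve determines its line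
(\<open>embeds_onto_lin_curve_periods\<close>).
\<close>

(* Here $ only denotes the components of a vector. *)
no_notation fps_nth (infixl "$" 75)


section \<open>Additive subgroups of the complex plane and points of elliptic curves\<close>

abbreviation add_subgroup :: "complex set \<Rightarrow> bool" where
  "add_subgroup L \<equiv> subgroup L complex_add"

lemma complex_add_simps [simp]:
  "carrier complex_add = UNIV" "mult complex_add = (+)" "one complex_add = 0"
  by (auto simp: complex_add_def)

lemma comm_group_complex_add: "comm_group complex_add"
  by (rule comm_groupI) (auto simp: add.assoc add.commute intro: exI[of _ "- _"] add.left_inverse)

lemma inv_complex_add [simp]: "inv\<^bsub>complex_add\<^esub> z = - z"
  using comm_group_complex_add
  by (metis UNIV_I comm_group.axioms(2) complex_add_simps group.inv_equality add.left_inverse)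

lemma add_subgroup_iff: "add_subgroup L \<longleftrightarrow> 0 \<in> L \<and> (\<forall>x\<in>L. \<forall>y\<in>L. x - y \<in> L)"
proof
  assume "add_subgroup L"
  then show "0 \<in> L \<and> (\<forall>x\<in>L. \<forall>y\<in>L. x - y \<in> L)"
    using subgroup.one_closed subgroup.m_closed subgroup.m_inv_closed
    by (metis complex_add_simps(2,3) diff_conv_add_uminus inv_complex_add)
next
  assume R: "0 \<in> L \<and> (\<forall>x\<in>L. \<forall>y\<in>L. x - y \<in> L)"
  show "add_subgroup L"
  proof
    show um: "inv\<^bsub>complex_add\<^esub> x \<in> L" if "x \<in> L" for x
      using R that by (metis diff_0 inv_complex_add)
    show "x \<otimes>\<^bsub>complex_add\<^esub> y \<in> L" if "x \<in> L" "y \<in> L" for x y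
      using R that um[of y] by (metis complex_add_simps(2) diff_minus_eq_add inv_complex_add)
  qed (use R in auto)
qed

lemma add_subgroup_0: "add_subgroup L \<Longrightarrow> 0 \<in> L"
  and add_subgroup_diff: "add_subgroup L \<Longrightarrow> x \<in> L \<Longrightarrow> y \<in> L \<Longrightarrow> x - y \<in> L"
  by (auto simp: add_subgroup_iff)

lemma add_subgroup_minus: "add_subgroup L \<Longrightarrow> x \<in> L \<Longrightarrow> - x \<in> L"
  using add_subgroup_diff[of L 0 x] add_subgroup_0 by simp

lemma add_subgroup_add: "add_subgroup L \<Longrightarrow> x \<in> L \<Longrightarrow> y \<in> L \<Longrightarrow> x + y \<in> L"
  using add_subgroup_diff[of L x "-y"] add_subgroup_minus by simp

lemma add_subgroup_of_nat: "add_subgroup L \<Longrightarrow> x \<in> L \<Longrightarrow> of_nat n * x \<in> L"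
  by (induction n) (auto simp: add_subgroup_0 add_subgroup_add distrib_right)

lemma add_subgroup_of_int: "add_subgroup L \<Longrightarrow> x \<in> L \<Longrightarrow> of_int n * x \<in> L"
  by (cases n rule: int_cases2) (auto simp: add_subgroup_of_nat add_subgroup_minus)

lemma pt_eq: "pt L z = {l + z | l. l \<in> L}"
  by (auto simp: pt_def r_coset_def)

lemma mem_pt: "w \<in> pt L z \<longleftrightarrow> w - z \<in> L"
  by (auto simp: pt_eq) (metis add.commute diff_add_cancel)

lemma pt_eq_iff: "add_subgroup L \<Longrightarrow> pt L z = pt L w \<longleftrightarrow> z - w \<in> L"
proof
  assume a: "add_subgroup L" and "pt L z = pt L w"
  then have "z \<in> pt L w" using mem_pt[of z L z] add_subgroup_0 by auto
  then show "z - w \<in> L" by (simp add: mem_pt)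
next
  assume a: "add_subgroup L" and d: "z - w \<in> L"
  have "x - z \<in> L \<longleftrightarrow> x - w \<in> L" for x
    using add_subgroup_add[OF a _ d, of "x - z"] add_subgroup_diff[OF a _ d, of "x - w"] by auto
  then show "pt L z = pt L w" by (auto simp: mem_pt)
qed

lemma pt_0: "add_subgroup L \<Longrightarrow> pt L 0 = L"
  by (auto simp: mem_pt)

lemma carrier_ell: "carrier (ell L) = range (pt L)"
  by (auto simp: ell_def FactGroup_def RCOSETS_def pt_def)

lemma pt_in_carrier [simp]: "pt L z \<in> carrier (ell L)"
  by (simp add: carrier_ell)

lemma ell_pointE:
  assumes "P \<in> carrier (ell L)"
  obtains z where "P = pt L z"
  using assms by (auto simp: carrier_ell)

lemma one_ell: "one (ell L) = L"
  by (simp add: ell_def FactGroup_def)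

lemma pt_set_mult:
  assumes "add_subgroup L" "add_subgroup M" "L \<subseteq> M"
  shows "pt L z <#>\<^bsub>complex_add\<^esub> pt M w = pt M (z + w)"
proof (intro equalityI subsetI)
  fix x assume "x \<in> pt L z <#>\<^bsub>complex_add\<^esub> pt M w"
  then obtain a b where ab: "a - z \<in> L" "b - w \<in> M" "x = a + b"
    by (auto simp: set_mult_def mem_pt)
  then have "(a - z) + (b - w) \<in> M" using assms by (blast intro: add_subgroup_add)
  then show "x \<in> pt M (z + w)" using ab by (simp add: mem_pt algebra_simps)
next
  fix x assume "x \<in> pt M (z + w)"
  then have "z \<in> pt L z" "x - z \<in> pt M w" using assms(1)
    by (auto simp: mem_pt add_subgroup_0 algebra_simps)
  then show "x \<in> pt L z <#>\<^bsub>complex_add\<^esub> pt M w"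
    unfolding set_mult_def by force
qed

lemma mult_ell: "mult (ell L) = (\<lambda>P Q. P <#>\<^bsub>complex_add\<^esub> Q)"
  by (simp add: ell_def FactGroup_def)

lemma pt_mult: "add_subgroup L \<Longrightarrow> pt L z \<otimes>\<^bsub>ell L\<^esub> pt L w = pt L (z + w)"
  by (simp add: mult_ell pt_set_mult)

lemma comm_group_ell: "add_subgroup L \<Longrightarrow> comm_group (ell L)"
  unfolding ell_def
  using comm_group_complex_add comm_group.abelian_FactGroup by blast

lemma group_ell: "add_subgroup L \<Longrightarrow> group (ell L)"
  using comm_group_ell comm_group.axioms(2) by blast

lemma pt_inv: "add_subgroup L \<Longrightarrow> inv\<^bsub>ell L\<^esub> (pt L z) = pt L (- z)"
  by (rule group.inv_equality[OF group_ell]) (auto simp: pt_mult pt_0 one_ell)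

lemma pt_pow_nat: "add_subgroup L \<Longrightarrow> pt L z [^]\<^bsub>ell L\<^esub> (n::nat) = pt L (of_nat n * z)"
proof (induction n)
  case 0 then show ?case by (simp add: group.is_monoid group_ell monoid.nat_pow_0 one_ell pt_0)
next
  case (Suc n) then show ?case
    by (simp add: group.is_monoid group_ell monoid.nat_pow_Suc pt_mult algebra_simps)
qed

lemma pt_pow_int: "add_subgroup L \<Longrightarrow> pt L z [^]\<^bsub>ell L\<^esub> (n::int) = pt L (of_int n * z)"
  by (cases n rule: int_cases2)
     (auto simp: int_pow_int pt_pow_nat group.int_pow_neg[OF group_ell] pt_inv)

text \<open>
The subgroups of \<open>\<complex>/L\<close> are the sets \<open>pt L ` M\<close> for add_subgroup subgroups \<open>M \<supseteq> L\<close> of the plane; \<open>M\<close> is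
recovered as the union of the cosets.
\<close>

lemma Union_pt_image:
  assumes "add_subgroup L" "add_subgroup M" "L \<subseteq> M"
  shows "\<Union>(pt L ` M) = M"
proof -
  have "x \<in> M" if "z \<in> M" "x - z \<in> L" for x z
    using add_subgroup_add[OF assms(2), of "x - z" z] that assms by auto
  then show ?thesis using assms by (force simp: mem_pt add_subgroup_0)
qed

lemma pt_mem_image:
  assumes "add_subgroup L" "add_subgroup M" "L \<subseteq> M"
  shows "pt L z \<in> pt L ` M \<longleftrightarrow> z \<in> M"
proof
  assume "pt L z \<in> pt L ` M"
  then obtain w where "w \<in> M" "z - w \<in> L" using assms(1) by (auto simp: pt_eq_iff)
  then show "z \<in> M" using add_subgroup_add[OF assms(2), of "z - w" w] assms by auto
qed auto

lemma subgroup_pt_image: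
  assumes "add_subgroup L" "add_subgroup M"
  shows "subgroup (pt L ` M) (ell L)"
proof
  show "x \<otimes>\<^bsub>ell L\<^esub> y \<in> pt L ` M" if "x \<in> pt L ` M" "y \<in> pt L ` M" for x y
    using that assms by (auto simp: pt_mult intro!: imageI add_subgroup_add)
  show "inv\<^bsub>ell L\<^esub> x \<in> pt L ` M" if "x \<in> pt L ` M" for x
    using that assms by (auto simp: pt_inv intro!: imageI add_subgroup_minus)
  show "\<one>\<^bsub>ell L\<^esub> \<in> pt L ` M"
    using assms by (metis add_subgroup_0 image_eqI one_ell pt_0)
qed (auto simp: carrier_ell)


section \<open>Lattices with a basis\<close>

definition lat :: "complex \<Rightarrow> complex \<Rightarrow> complex set" where
  "lat u v = {of_int m * u + of_int n * v | m n :: int. True}"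

lemma latI [intro]: "z = of_int m * u + of_int n * v \<Longrightarrow> z \<in> lat u v"
  by (auto simp: lat_def)

lemma latE: "z \<in> lat u v \<Longrightarrow> (\<And>m n. z = of_int m * u + of_int n * v \<Longrightarrow> P) \<Longrightarrow> P"
  by (auto simp: lat_def)

lemma add_subgroup_lat: "add_subgroup (lat u v)"
  unfolding add_subgroup_iff
proof (intro conjI ballI)
  show "0 \<in> lat u v" by (rule latI[of _ 0 _ 0]) simp
  fix x y assume "x \<in> lat u v" "y \<in> lat u v"
  then obtain m n m' n' where "x = of_int m * u + of_int n * v" "y = of_int m' * u + of_int n' * v"
    by (auto simp: lat_def)
  then show "x - y \<in> lat u v" by (intro latI[of _ "m - m'" _ "n - n'"]) (simp add: algebra_simps)
qed

lemma lat_basis_mem [simp]: "u \<in> lat u v" "v \<in> lat u v"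
  by (rule latI[of _ 1 _ 0], simp) (rule latI[of _ 0 _ 1], simp)

lemma lat_subset_iff:
  assumes "add_subgroup M"
  shows "lat u v \<subseteq> M \<longleftrightarrow> u \<in> M \<and> v \<in> M"
proof (intro iffI conjI)
  show "lat u v \<subseteq> M \<Longrightarrow> u \<in> M" "lat u v \<subseteq> M \<Longrightarrow> v \<in> M"
    by auto
qed (auto elim!: latE intro!: add_subgroup_add add_subgroup_of_int assms)

lemma std_lattice_lat: "std_lattice t = lat 1 t"
  by (simp add: std_lattice_def lat_def)

lemma period_lattice_iff: "period_lattice L \<longleftrightarrow> (\<exists>u v. Im (v / u) \<noteq> 0 \<and> L = lat u v)"
  by (simp add: period_lattice_def lat_def)

lemma period_lattice_add_subgroup: "period_lattice L \<Longrightarrow> add_subgroup L"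
  by (auto simp: period_lattice_iff add_subgroup_lat)

lemma lat_scale: "(*) c ` lat u v = lat (c * u) (c * v)"
proof -
  have "c * (of_int m * u + of_int n * v) = of_int m * (c * u) + of_int n * (c * v)" for m n
    by (simp add: algebra_simps)
  then show ?thesis by (auto simp: lat_def image_iff) metis+
qed

lemma Im_div_nonzero_iff: "Im (v / u) \<noteq> 0 \<longleftrightarrow> Im (v * cnj u) \<noteq> 0"
  by (cases "u = 0") (auto simp: complex_div_cnj[of v u] Im_divide_of_real simp flip: of_real_power)

text \<open>
A lattice basis is a basis of the plane over the reals, so membership in a lattice can be read
off the real coordinates.
\<close>

lemma real_coords_unique:
  fixes a b a' b' :: real
  assumes "Im (v / u) \<noteq> 0" "of_real a * u + of_real b * v = of_real a' * u + of_real b' * v"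
  shows "a = a'" "b = b'"
proof -
  have u: "u \<noteq> 0" using assms(1) by auto
  have eq: "of_real (a - a') + of_real (b - b') * (v / u) = 0"
    using assms(2) u by (simp add: field_simps)
  have "Im (of_real (a - a') + of_real (b - b') * (v / u)) = (b - b') * Im (v / u)"
    by (simp del: times_divide_eq_right of_real_diff)
  then have "(b - b') * Im (v / u) = 0" unfolding eq by simp
  then show b: "b = b'" using assms(1) by simp
  then show "a = a'" using assms(2) u by simp
qed

lemma real_coords_mem_lat_iff:
  fixes a b :: real
  assumes "Im (v / u) \<noteq> 0"
  shows "of_real a * u + of_real b * v \<in> lat u v \<longleftrightarrow> a \<in> \<int> \<and> b \<in> \<int>"
proof
  assume "of_real a * u + of_real b * v \<in> lat u v"
  then obtain m n where "of_real a * u + of_real b * v = of_real (of_int m) * u + of_real (of_int n) * v"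
    by (auto simp: lat_def)
  from real_coords_unique[OF assms this] show "a \<in> \<int> \<and> b \<in> \<int>" by simp
next
  assume "a \<in> \<int> \<and> b \<in> \<int>"
  then obtain m n where "a = of_int m" "b = of_int n" by (auto elim!: Ints_cases)
  then show "of_real a * u + of_real b * v \<in> lat u v" by (intro latI[of _ m _ n]) simp
qed

lemma real_coords_exist:
  assumes "Im (v / u) \<noteq> 0"
  obtains a b :: real where "z = of_real a * u + of_real b * v"
proof -
  have u: "u \<noteq> 0" using assms(1) by auto
  define b where "b = Im (z / u) / Im (v / u)"
  define a where "a = Re (z / u) - b * Re (v / u)"
  have "z / u = of_real a + of_real b * (v / u)"
    using assms by (simp add: complex_eq_iff a_def b_def del: times_divide_eq_right)
  then have "z = of_real a * u + of_real b * v" using u by (simp add: field_simps)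
  then show ?thesis by (rule that)
qed


section \<open>Homomorphisms are multiplications\<close>

text \<open>
With \<open>V = Im (v * cnj u)\<close>, the coordinates \<open>m\<close>, \<open>n\<close> of \<open>z\<close> satisfy \<open>Im (z * cnj u) = n V\<close> and
\<open>Im (z * cnj v) = - m V\<close>.  For small \<open>z\<close> these are
smaller than \<open>V\<close> in absolute value, so the integers vanish.
\<close>

lemma period_lattice_discrete:
  assumes "period_lattice L"
  obtains d where "d > 0" "\<And>z. z \<in> L \<Longrightarrow> norm z < d \<Longrightarrow> z = 0"
proof -
  obtain u v where uv: "Im (v / u) \<noteq> 0" "L = lat u v" using assms by (auto simp: period_lattice_iff)
  define V where "V = Im (v * cnj u)"
  have V: "V \<noteq> 0" using uv(1) Im_div_nonzero_iff V_def by simp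
  then have ne: "u \<noteq> 0" "v \<noteq> 0" by (auto simp: V_def)
  define d where "d = \<bar>V\<bar> / (norm u + norm v)"
  have pos: "norm u + norm v > 0" using ne by (simp add: add_pos_pos)
  show thesis
  proof
    show "d > 0" using V pos by (simp add: d_def)
    fix z assume "z \<in> L" and small: "norm z < d"
    then obtain m n :: int where z: "z = of_int m * u + of_int n * v" using uv(2) by (auto elim: latE)
    have "\<bar>Im (z * cnj w)\<bar> < \<bar>V\<bar>" if "norm w \<le> norm u + norm v" for w
    proof -
      have "\<bar>Im (z * cnj w)\<bar> \<le> norm z * norm w" using abs_Im_le_cmod[of "z * cnj w"] by (simp add: norm_mult)
      also have "\<dots> \<le> norm z * (norm u + norm v)" using that by (simp add: mult_left_mono)
      also have "\<dots> < d * (norm u + norm v)" using small pos by (rule mult_strict_right_mono)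
      also have "\<dots> = \<bar>V\<bar>" using pos by (simp add: d_def)
      finally show ?thesis .
    qed
    from this[of u] this[of v]
    have "\<bar>Im (z * cnj u)\<bar> < \<bar>V\<bar>" "\<bar>Im (z * cnj v)\<bar> < \<bar>V\<bar>" by auto
    moreover have "Im (z * cnj u) = of_int n * V" "Im (z * cnj v) = - of_int m * V"
      by (simp_all add: z V_def algebra_simps)
    ultimately have "\<bar>of_int n\<bar> * \<bar>V\<bar> < 1 * \<bar>V\<bar>" "\<bar>of_int m\<bar> * \<bar>V\<bar> < 1 * \<bar>V\<bar>" by (auto simp: abs_mult)
    then have "\<bar>of_int n :: real\<bar> < 1" "\<bar>of_int m :: real\<bar> < 1" using V unfolding mult_less_cancel_right by auto
    then have "n = 0" "m = 0" by linarith+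
    then show "z = 0" using z by simp
  qed
qed

lemma countable_lat: "countable (lat u v)"
proof -
  have "lat u v = range (\<lambda>(m, n). of_int m * u + of_int n * v)" by (auto simp: lat_def)
  then show ?thesis by (metis countableI_type countable_image)
qed

lemma countable_period_lattice: "period_lattice L \<Longrightarrow> countable L"
  by (auto simp: period_lattice_iff countable_lat)

text \<open>
The union makes no choice of a representative: if \<open>c\<close> maps \<open>L\<close> into \<open>L'\<close>, then all points of the coset
give the same value.
\<close>

definition mult_map :: "complex \<Rightarrow> complex set \<Rightarrow> complex set \<Rightarrow> complex set" where
  "mult_map c L P = (\<Union>z\<in>P. pt L (c * z))"

definition lattice_mult :: "complex \<Rightarrow> complex set \<Rightarrow> complex set \<Rightarrow> bool" where
  "lattice_mult c L L' \<longleftrightarrow> (\<forall>z\<in>L. c * z \<in> L')"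

lemma mult_map_pt:
  assumes "add_subgroup L" "add_subgroup L'" "lattice_mult c L L'"
  shows "mult_map c L' (pt L z) = pt L' (c * z)"
proof -
  have "pt L' (c * w) = pt L' (c * z)" if "w \<in> pt L z" for w
    using that assms by (auto simp: mem_pt pt_eq_iff lattice_mult_def simp flip: right_diff_distrib)
  moreover have "z \<in> pt L z" using assms by (simp add: mem_pt add_subgroup_0)
  ultimately show ?thesis unfolding mult_map_def by blast
qed

lemma ell_hom_from_mult:
  assumes "add_subgroup L" "add_subgroup L'" "\<And>z. f (pt L z) = pt L' (c * z)"
  shows "f \<in> ell_hom L L'"
proof -
  have "f \<in> hom (ell L) (ell L')"
    using assms by (auto simp: hom_def carrier_ell pt_mult distrib_left)
  moreover have "holomorphic_map L L' f"
    unfolding holomorphic_map_def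
  proof
    fix z show "\<exists>e>0. \<exists>g. g holomorphic_on ball z e \<and> (\<forall>w\<in>ball z e. f (pt L w) = pt L' (g w))"
      using assms(3) by (intro exI[of _ 1] conjI exI[of _ "\<lambda>w. c * w"]) (auto intro!: holomorphic_intros)
  qed
  ultimately show ?thesis by (simp add: ell_hom_def)
qed

lemma mult_map_ell_hom:
  assumes "add_subgroup L" "add_subgroup L'" "lattice_mult c L L'"
  shows "mult_map c L' \<in> ell_hom L L'"
  using ell_hom_from_mult mult_map_pt assms by blast

text \<open>
Halving the argument repeatedly does not change \<open>g w / w\<close>, which therefore equals its limit at \<open>0\<close>.
\<close>

lemma locally_add_subgroup_imp_linear:
  fixes g :: "complex \<Rightarrow> complex"
  assumes e: "e > 0" and add: "\<And>w. norm w < e \<Longrightarrow> g w = 2 * g (w / 2)"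
    and der: "(g has_field_derivative c) (at 0)" and w: "norm w < e"
  shows "g w = c * w"
proof (cases "w = 0")
  case True
  then show ?thesis using add[of 0] e by simp
next
  case False
  have g0: "g 0 = 0" using add[of 0] e by simp
  have pw: "g w = 2 ^ n * g (w / 2 ^ n)" for n
  proof (induction n)
    case (Suc n)
    have "norm (w / 2 ^ n) \<le> norm w" using mult_left_mono[of 1 "2 ^ n" "norm w"] by (simp add: norm_divide norm_power divide_le_eq)
    then show ?case using Suc add[of "w / 2 ^ n"] w by (simp add: field_simps)
  qed simp
  have "(\<lambda>h. (g (0 + h) - g 0) / h) \<midarrow>0\<rightarrow> c" using der by (simp add: DERIV_def)
  then have lim: "(\<lambda>h. g h / h) \<midarrow>0\<rightarrow> c" by (simp add: g0)
  have "(\<lambda>n. w * (1/2) ^ n) \<longlonglongrightarrow> w * 0" by (intro tendsto_intros) auto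
  then have "(\<lambda>n. w / 2 ^ n) \<longlonglongrightarrow> 0" by (simp add: power_one_over)
  then have "filterlim (\<lambda>n. w / 2 ^ n) (at 0) sequentially"
    using False by (simp add: filterlim_at)
  then have "(\<lambda>n. g (w / 2 ^ n) / (w / 2 ^ n)) \<longlonglongrightarrow> c"
    by (rule filterlim_compose[OF lim])
  moreover have "(\<lambda>n. g (w / 2 ^ n) / (w / 2 ^ n)) = (\<lambda>n. g w / w)"
    using pw by (simp add: fun_eq_iff mult.commute)
  ultimately have "(\<lambda>n::nat. g w / w) \<longlonglongrightarrow> c" by (simp only:)
  then have "g w / w = c" by (simp add: LIMSEQ_const_iff)
  then show ?thesis using False by (simp add: field_simps)
qed

text \<open>
A local holomorphic lift \<open>h\<close> with \<open>h 0 = 0\<close> satisfies \<open>h w = 2 h (w/2)\<close> up to an element of \<open>L'\<close>.  Near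
\<open>0\<close> the difference is too small to be a nonzero element of the discrete \<open>L'\<close>, so \<open>h\<close> is linear there.
Every point of the curve is a multiple of one near \<open>0\<close>.
\<close>

lemma ell_hom_mult:
  assumes L: "period_lattice L" "period_lattice L'" and f: "f \<in> ell_hom L L'"
  obtains c where "lattice_mult c L L'" "\<And>z. f (pt L z) = pt L' (c * z)"
proof -
  note a = L[THEN period_lattice_add_subgroup]
  have hom: "f (pt L (z + w)) = f (pt L z) \<otimes>\<^bsub>ell L'\<^esub> f (pt L w)" for z w
    using f a by (auto simp: ell_hom_def hom_def pt_mult simp flip: pt_mult)
  have fL: "f L = L'"
    using f group_hom.hom_one[of "ell L" "ell L'" f] a
    by (auto simp: group_hom_def group_hom_axioms_def ell_hom_def group_ell one_ell)
  obtain e g where e: "e > 0" and g: "g holomorphic_on ball 0 e"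
    and fg: "\<And>w. w \<in> ball 0 e \<Longrightarrow> f (pt L w) = pt L' (g w)"
    using f unfolding ell_hom_def holomorphic_map_def by blast
  define h where "h w = g w - g 0" for w
  have g0: "g 0 \<in> L'" using fg[of 0] e fL a pt_eq_iff[of L' "g 0" 0] by (simp add: pt_0)
  have fh: "f (pt L w) = pt L' (h w)" if "norm w < e" for w
    using fg[of w] that g0 a by (simp add: pt_eq_iff h_def)
  obtain c where "(g has_field_derivative c) (at 0)"
    using g e holomorphic_on_open[of "ball 0 e" g] by force
  then have der: "(h has_field_derivative c) (at 0)"
    unfolding h_def by (auto intro!: derivative_eq_intros)
  obtain d where d: "d > 0" "\<And>z. z \<in> L' \<Longrightarrow> norm z < d \<Longrightarrow> z = 0"
    using period_lattice_discrete[OF L(2)] by blast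
  have "isCont h 0" using der by (rule DERIV_isCont)
  then obtain \<delta> where \<delta>: "\<delta> > 0" "\<And>w. norm w < \<delta> \<Longrightarrow> norm (h w) < d / 3"
    using d(1) unfolding continuous_at_eps_delta by (force simp: h_def dist_norm dest: spec[of _ "d / 3"])
  define r where "r = min e \<delta>"
  have r: "r > 0" using e \<delta> by (simp add: r_def)
  have dbl: "h w = 2 * h (w / 2)" if "norm w < r" for w
  proof -
    have n2: "norm (w / 2) < r" using that r by (simp add: norm_divide)
    have "pt L' (h w) = f (pt L (w / 2 + w / 2))" using fh[of w] that by (simp add: r_def)
    also have "\<dots> = pt L' (h (w / 2) + h (w / 2))"
      using hom[of "w / 2" "w / 2"] fh[of "w / 2"] n2 a by (simp add: pt_mult r_def)
    finally have mem: "h w - (h (w / 2) + h (w / 2)) \<in> L'" using a by (simp add: pt_eq_iff)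
    have "norm (h w - (h (w / 2) + h (w / 2))) \<le> norm (h w) + (norm (h (w / 2)) + norm (h (w / 2)))"
      by (meson add_left_mono norm_triangle_ineq norm_triangle_ineq4 order_trans)
    also have "\<dots> < d" using \<delta>(2)[of w] \<delta>(2)[of "w / 2"] that n2 by (simp add: r_def)
    finally show ?thesis using d(2)[OF mem] by simp
  qed
  have lin: "h w = c * w" if "norm w < r" for w
    using locally_add_subgroup_imp_linear[OF r dbl der that] by blast
  have all: "f (pt L z) = pt L' (c * z)" for z
  proof -
    have scale: "f (pt L (of_nat n * w)) = pt L' (of_nat n * (c * w))" if "norm w < r" for n w
    proof (induction n)
      case 0 then show ?case using fL a by (simp add: pt_0)
    next
      case (Suc n)
      have "f (pt L (of_nat (Suc n) * w)) = f (pt L (w + of_nat n * w))" by (simp add: algebra_simps)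
      also have "\<dots> = pt L' (c * w) \<otimes>\<^bsub>ell L'\<^esub> pt L' (of_nat n * (c * w))"
        using hom[of w "of_nat n * w"] fh[of w] lin[of w] that Suc by (simp add: r_def)
      finally show ?case using a by (simp add: pt_mult algebra_simps)
    qed
    obtain n where n: "norm z / r < of_nat n" "n > 0"
      using reals_Archimedean2[of "norm z / r"] r
      by (metis divide_nonneg_pos gr0I norm_ge_zero of_nat_0 not_less)
    have "norm (z / of_nat n) < r" using n r by (simp add: norm_divide field_simps)
    from scale[OF this, of n] show ?thesis using n by simp
  qed
  have "lattice_mult c L L'"
    unfolding lattice_mult_def
  proof
    fix z assume "z \<in> L"
    then have "pt L z = pt L 0" using a by (simp add: pt_eq_iff)
    then have "pt L' (c * z) = pt L' 0" using all[of z] all[of 0] by simp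
    then show "c * z \<in> L'" using a by (simp add: pt_eq_iff)
  qed
  then show thesis using all by (rule that)
qed

lemma kernel_mult:
  assumes "add_subgroup L" "add_subgroup L'" "\<And>z. f (pt L z) = pt L' (c * z)"
  shows "kernel (ell L) (ell L') f = pt L ` {z. c * z \<in> L'}"
proof -
  have "pt L' (c * z) = L' \<longleftrightarrow> c * z \<in> L'" for z
    using assms pt_eq_iff[of L' "c * z" 0] by (simp add: pt_0)
  then show ?thesis using assms(3) by (auto simp: kernel_def carrier_ell one_ell)
qed

lemma period_lattice_not_UNIV: "period_lattice L \<Longrightarrow> \<exists>z. z \<notin> L"
  using countable_period_lattice uncountable_UNIV_complex by (metis UNIV_eq_I)

lemma isogeny_mult:
  assumes L: "period_lattice L" "period_lattice L'" and f: "isogeny L L' f"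
  shows "\<exists>c. c \<noteq> 0 \<and> lattice_mult c L L' \<and> (\<forall>z. f (pt L z) = pt L' (c * z))"
proof -
  obtain c where c: "lattice_mult c L L'" "\<And>z. f (pt L z) = pt L' (c * z)"
    using ell_hom_mult[OF L] f by (auto simp: isogeny_def)
  have "c \<noteq> 0"
  proof
    assume "c = 0"
    then have "f ` carrier (ell L) \<subseteq> {pt L' 0}" using c(2) by (auto simp: carrier_ell)
    moreover obtain z where z: "z \<notin> L'" using period_lattice_not_UNIV[OF L(2)] by blast
    have "pt L' z \<in> f ` carrier (ell L)" using f by (auto simp: isogeny_def)
    ultimately have "pt L' z = pt L' 0" by auto
    then show False using z L(2) by (simp add: pt_eq_iff period_lattice_add_subgroup)
  qed
  then show ?thesis using c by blast
qed

lemma mult_map_isogeny: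
  assumes L: "add_subgroup L" "add_subgroup L'" and c: "c \<noteq> 0" "lattice_mult c L L'"
    and fin: "finite (pt L ` {z. c * z \<in> L'})"
  shows "isogeny L L' (mult_map c L')"
  unfolding isogeny_def
proof (intro conjI)
  note m = mult_map_pt[OF L c(2)]
  show "mult_map c L' \<in> ell_hom L L'" using mult_map_ell_hom L c by blast
  have "pt L' w \<in> mult_map c L' ` carrier (ell L)" for w
    using m[of "w / c"] c(1) by (metis image_eqI nonzero_mult_div_cancel_left pt_in_carrier times_divide_eq_right)
  then show "mult_map c L' ` carrier (ell L) = carrier (ell L')"
    using m by (auto simp: carrier_ell)
  show "finite (kernel (ell L) (ell L') (mult_map c L'))" using kernel_mult[OF L m] fin by simp
qed

lemma lattice_mult_lat: "add_subgroup M \<Longrightarrow> lattice_mult c (lat u v) M \<longleftrightarrow> c * u \<in> M \<and> c * v \<in> M"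
  using lat_subset_iff[of M "c * u" "c * v"] lat_scale[of c u v]
  by (auto simp: lattice_mult_def)

lemma add_subgroup_vimage: "add_subgroup M \<Longrightarrow> add_subgroup {z. c * z \<in> M}"
  by (auto simp: add_subgroup_iff right_diff_distrib)


section \<open>Cyclic subgroups\<close>

text \<open>
The inverse of an integral matrix of determinant \<open>1\<close> is integral.
\<close>

lemma lat_unimodular:
  fixes a b c d :: int
  assumes "a * d - b * c = 1"
  shows "lat (of_int a * u + of_int b * v) (of_int c * u + of_int d * v) = lat u v" (is "lat ?u ?v = _")
proof
  show "lat ?u ?v \<subseteq> lat u v" by (auto simp: lat_subset_iff add_subgroup_lat)
  have "of_int d * ?u + of_int (- b) * ?v = of_int (a * d - b * c) * u" by (simp add: algebra_simps)
  moreover have "of_int (- c) * ?u + of_int a * ?v = of_int (a * d - b * c) * v" by (simp add: algebra_simps)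
  ultimately have "u \<in> lat ?u ?v" "v \<in> lat ?u ?v" using assms
    by (metis latI mult_1 of_int_1)+
  then show "lat u v \<subseteq> lat ?u ?v" by (simp add: lat_subset_iff add_subgroup_lat)
qed

lemma lat_minus: "lat u (- v) = lat u v"
  using add_subgroup_minus[OF add_subgroup_lat, of v u v] add_subgroup_minus[OF add_subgroup_lat, of "- v" u "- v"]
  by (intro equalityI) (simp_all add: lat_subset_iff add_subgroup_lat)

lemma Im_div_minus: "Im (v / u) \<noteq> 0 \<Longrightarrow> Im (v / u) > 0 \<or> Im ((- v) / u) > 0"
  by auto

lemma Im_div_unimodular:
  fixes a b c d :: int
  assumes "a * d - b * c = 1" "Im (v / u) \<noteq> 0"
  shows "Im ((of_int c * u + of_int d * v) / (of_int a * u + of_int b * v)) \<noteq> 0"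
proof -
  have "Im ((of_int c * u + of_int d * v) * cnj (of_int a * u + of_int b * v))
      = of_int (a * d - b * c) * Im (v * cnj u)" by (simp add: algebra_simps)
  then show ?thesis using assms unfolding Im_div_nonzero_iff by simp
qed

lemma generate_pt:
  assumes "add_subgroup L"
  shows "generate (ell L) {pt L z} = range (\<lambda>k::int. pt L (of_int k * z))"
  using group.generate_pow[OF group_ell[OF assms], of "pt L z"] assms
  by (auto simp: pt_pow_int)

lemma generate_pt_lat:
  assumes "n > 0"
  shows "generate (ell (lat u v)) {pt (lat u v) (u / of_nat n)} = pt (lat u v) ` lat (u / of_nat n) v"
proof -
  have "pt (lat u v) (of_int m * (u / of_nat n) + of_int k * v) = pt (lat u v) (of_int m * (u / of_nat n))" for m k
    by (auto simp: pt_eq_iff add_subgroup_lat intro: add_subgroup_of_int)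
  then show ?thesis unfolding generate_pt[OF add_subgroup_lat]
    by (auto simp: lat_def image_iff)
qed

lemma lat_subset_lat_divide: "n > 0 \<Longrightarrow> lat u v \<subseteq> lat (u / of_nat n) v"
proof -
  assume "n > 0"
  then have "u = of_int (int n) * (u / of_nat n) + of_int 0 * v" by simp
  then have "u \<in> lat (u / of_nat n) v" by (rule latI)
  then show ?thesis by (simp add: lat_subset_iff add_subgroup_lat)
qed

lemma mult_mem_lat_iff:
  assumes "Im (v / u) \<noteq> 0" "n > 0"
  shows "of_int k * (u / of_nat n) + of_int m * v \<in> lat u v \<longleftrightarrow> int n dvd k"
proof -
  have "of_int k * (u / of_nat n) + of_int m * v = of_real (of_int k / of_nat n) * u + of_real (of_int m) * v" by simp
  moreover have "(of_int k / of_nat n :: real) \<in> \<int> \<longleftrightarrow> int n dvd k"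
    using of_int_div_of_int_in_Ints_iff[of k "int n", where 'a = real] assms(2) by simp
  ultimately show ?thesis using real_coords_mem_lat_iff[OF assms(1), of "of_int k / of_nat n" "of_int m"] by simp
qed

lemma card_pt_lat:
  assumes "Im (v / u) \<noteq> 0" "n > 0"
  shows "finite (pt (lat u v) ` lat (u / of_nat n) v)" "card (pt (lat u v) ` lat (u / of_nat n) v) = n"
proof -
  let ?p = "\<lambda>k::int. pt (lat u v) (of_int k * (u / of_nat n))"
  have eq: "?p k = ?p l \<longleftrightarrow> int n dvd k - l" for k l
    using mult_mem_lat_iff[OF assms, of "k - l" 0] by (simp add: pt_eq_iff add_subgroup_lat left_diff_distrib diff_divide_distrib)
  have "pt (lat u v) ` lat (u / of_nat n) v = range ?p"
    unfolding generate_pt_lat[OF assms(2), symmetric] generate_pt[OF add_subgroup_lat] ..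
  also have "\<dots> = ?p ` {0..<int n}"
  proof (intro equalityI subsetI)
    fix x assume "x \<in> range ?p"
    then obtain k where "x = ?p k" by auto
    also have "?p k = ?p (k mod int n)" unfolding eq by (simp add: minus_mod_eq_mult_div)
    finally show "x \<in> ?p ` {0..<int n}" using assms(2) by auto
  qed auto
  finally have im: "pt (lat u v) ` lat (u / of_nat n) v = ?p ` {0..<int n}" .
  have "inj_on ?p {0..<int n}"
  proof (rule inj_onI)
    fix k l assume "k \<in> {0..<int n}" "l \<in> {0..<int n}" "?p k = ?p l"
    moreover from this have "k mod int n = l mod int n" unfolding eq mod_eq_dvd_iff by simp
    ultimately show "k = l" by simp
  qed
  then show "card (pt (lat u v) ` lat (u / of_nat n) v) = n" unfolding im by (simp add: card_image)
  show "finite (pt (lat u v) ` lat (u / of_nat n) v)" unfolding im by simp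
qed

lemma cyclic_subgroup_lat:
  assumes "Im (v / u) \<noteq> 0" "n > 0"
  shows "cyclic_subgroup (lat u v) n (pt (lat u v) ` lat (u / of_nat n) v)"
  unfolding cyclic_subgroup_def
  using card_pt_lat[OF assms] generate_pt_lat[OF assms(2), of u v]
  by (auto intro!: bexI[of _ "pt (lat u v) (u / of_nat n)"])

text \<open>
Let \<open>z\<close> generate \<open>C\<close>, so that \<open>n z\<close> lies in \<open>L\<close>, and write \<open>n z = g w1\<close> with \<open>w1\<close> primitive in \<open>L\<close>.
As \<open>z\<close> has exact order \<open>n\<close>, \<open>g\<close> is prime to \<open>n\<close>; hence \<open>w1/n\<close> generates the same subgroup as \<open>z\<close>, and
\<open>w1\<close> can be completed to a basis by Bezout's identity.
\<close>

lemma cyclic_subgroup_basis: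
  assumes L: "period_lattice L" and C: "cyclic_subgroup L n C"
  obtains u v where "n > 0" "Im (v / u) > 0" "L = lat u v" "C = pt L ` lat (u / of_nat n) v"
proof -
  obtain u1 u2 where b: "Im (u2 / u1) \<noteq> 0" "L = lat u1 u2" using L by (auto simp: period_lattice_iff)
  note a = period_lattice_add_subgroup[OF L]
  interpret G: group "ell L" using a by (rule group_ell)
  obtain P where P: "P \<in> carrier (ell L)" "C = generate (ell L) {P}" "finite C" "card C = n"
    using C by (auto simp: cyclic_subgroup_def)
  have "P \<in> C" using P by (simp add: generate.incl)
  then have n: "n > 0" using P card_gt_0_iff by blast
  \<comment> \<open>A nonzero representative ensures \<open>g > 0\<close> below, also if \<open>P\<close> is the neutral element.\<close>
  obtain z where z: "P = pt L z" "z \<noteq> 0"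
  proof -
    obtain z where z: "P = pt L z" using P(1) by (rule ell_pointE)
    have "u1 \<noteq> 0" using b(1) by auto
    moreover have "pt L u1 = pt L 0" using a b by (simp add: pt_eq_iff)
    ultimately show thesis using z that by (cases "z = 0") auto
  qed
  have dvd: "of_nat k * z \<in> L \<longleftrightarrow> n dvd k" for k
  proof -
    have "of_nat k * z \<in> L \<longleftrightarrow> P [^]\<^bsub>ell L\<^esub> k = \<one>\<^bsub>ell L\<^esub>"
      using a pt_eq_iff[OF a, of "of_nat k * z" 0] by (simp add: z(1) pt_pow_nat one_ell pt_0)
    also have "\<dots> \<longleftrightarrow> n dvd k"
      using G.pow_eq_id[OF P(1)] G.generate_pow_card[OF P(1)] P by simp
    finally show ?thesis .
  qed
  obtain x y :: int where xy: "of_nat n * z = of_int x * u1 + of_int y * u2"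
    using dvd[of n] b(2) by (auto elim: latE)
  define g where "g = gcd x y"
  have "x \<noteq> 0 \<or> y \<noteq> 0" using xy z(2) n by auto
  then have g: "g > 0" by (simp add: g_def)
  have cop: "gcd g (int n) = 1"
  proof -
    define d where "d = nat (gcd g (int n))"
    have d: "d > 0" "int d dvd x" "int d dvd y" "int d dvd int n" using n g by (auto simp: d_def g_def intro: dvd_trans)
    then obtain x' y' n' where *: "x = int d * x'" "y = int d * y'" "n = d * n'"
      by (metis dvdE int_dvd_int_iff)
    then have "of_nat n' * z = of_int x' * u1 + of_int y' * u2" using xy d(1)
      by (auto simp: mult.assoc simp flip: distrib_left)
    then have "of_nat n' * z \<in> L" using b(2) by (auto intro: latI)
    then have "n dvd n'" by (simp add: dvd)
    then have "d = 1" using * n by (auto dest: dvd_imp_le)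
    then show ?thesis using g by (simp add: d_def)
  qed
  have "g dvd x" "g dvd y" by (simp_all add: g_def)
  then obtain x' y' where x': "x = g * x'" "y = g * y'" by (auto elim!: dvdE)
  have "g = gcd (g * x') (g * y')" unfolding x'[symmetric] by (rule g_def)
  also have "\<dots> = g * gcd x' y'" using g by (simp add: gcd_mult_left abs_mult)
  finally have "gcd x' y' = 1" using g by simp
  then obtain p q where pq: "x' * q - y' * p = 1"
  proof -
    obtain s t where "s * x' + t * y' = 1" using bezout_int[of x' y'] \<open>gcd x' y' = 1\<close> by metis
    then show thesis using that[of s "- t"] by (simp add: mult.commute)
  qed
  define w1 where "w1 = of_int x' * u1 + of_int y' * u2"
  define w2 where "w2 = of_int p * u1 + of_int q * u2"
  have L12: "L = lat w1 w2" using lat_unimodular[OF pq] b(2) by (simp add: w1_def w2_def)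
  have im: "Im (w2 / w1) \<noteq> 0" unfolding w1_def w2_def using Im_div_unimodular[OF pq b(1)] .
  have nz: "of_nat n * z = of_int g * w1" unfolding w1_def xy x' by (simp add: algebra_simps)
  then have z': "z = of_int g * (w1 / of_nat n)" using n by (simp add: field_simps)
  have "C = pt L ` lat (w1 / of_nat n) w2"
  proof (intro equalityI subsetI)
    fix Q assume "Q \<in> C"
    then obtain k where "Q = pt L (of_int k * z)" using P(2) z(1) generate_pt[OF a] by auto
    moreover have "of_int k * z \<in> lat (w1 / of_nat n) w2" by (rule latI[of _ "k * g" _ 0]) (simp add: z')
    ultimately show "Q \<in> pt L ` lat (w1 / of_nat n) w2" by blast
  next
    fix Q assume "Q \<in> pt L ` lat (w1 / of_nat n) w2"
    then obtain m l where Q: "Q = pt L (of_int m * (w1 / of_nat n) + of_int l * w2)" by (auto elim: latE)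
    obtain s t where st: "s * g + t * int n = 1" using bezout_int[of g "int n"] cop by metis
    have "of_int m * (w1 / of_nat n) = of_int (s * g + t * int n) * of_int m * (w1 / of_nat n)" unfolding st by simp
    also have "\<dots> = of_int (m * s) * z + of_int (m * t) * w1" using n by (simp add: z' field_simps)
    finally have "of_int m * (w1 / of_nat n) + of_int l * w2 - of_int (m * s) * z = of_int (m * t) * w1 + of_int l * w2"
      by simp
    then have "of_int m * (w1 / of_nat n) + of_int l * w2 - of_int (m * s) * z \<in> L" unfolding L12 by (rule latI)
    then have "Q = pt L (of_int (m * s) * z)" unfolding Q pt_eq_iff[OF a] .
    then show "Q \<in> C" unfolding P(2) z(1) generate_pt[OF a] by blast
  qed
  then show thesis using that[of w2 w1] that[of "- w2" w1] n L12 Im_div_minus[OF im] by (auto simp: lat_minus)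
qed


section \<open>Moduli points as homothety classes\<close>

text \<open>
The common homothety of two pairs of lattices is the analytic form of an isomorphism of elliptic
curves with subgroups.
\<close>

definition homothetic :: "complex set \<Rightarrow> complex set \<Rightarrow> complex set \<Rightarrow> complex set \<Rightarrow> bool" where
  "homothetic L M L' M' \<longleftrightarrow> (\<exists>c. c \<noteq> 0 \<and> (*) c ` L = L' \<and> (*) c ` M = M')"

lemma homothetic_sym: "homothetic L M L' M' \<Longrightarrow> homothetic L' M' L M"
  unfolding homothetic_def
  by (elim exE, rule_tac x="inverse c" in exI) (auto simp: image_image mult.assoc[symmetric])

lemma homothetic_trans: "homothetic L M L' M' \<Longrightarrow> homothetic L' M' L'' M'' \<Longrightarrow> homothetic L M L'' M''"
  unfolding homothetic_def by (elim exE, rule_tac x="ca * c" in exI) (auto simp: image_image mult.assoc)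

lemma pair_isomorphic_iff_homothetic:
  assumes L: "period_lattice L" "period_lattice L'" and M: "add_subgroup M" "L \<subseteq> M" "add_subgroup M'" "L' \<subseteq> M'"
  shows "pair_isomorphic L (pt L ` M) L' (pt L' ` M') \<longleftrightarrow> homothetic L M L' M'"
proof
  note a = L[THEN period_lattice_add_subgroup]
  assume "pair_isomorphic L (pt L ` M) L' (pt L' ` M')"
  then obtain f g where f: "f \<in> ell_hom L L'" and g: "g \<in> ell_hom L' L"
    and gf: "\<And>P. P \<in> carrier (ell L) \<Longrightarrow> g (f P) = P" and fC: "f ` pt L ` M = pt L' ` M'"
    by (auto simp: pair_isomorphic_def)
  obtain c where c: "lattice_mult c L L'" "\<And>z. f (pt L z) = pt L' (c * z)" using ell_hom_mult[OF L f] by blast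
  obtain d where d: "lattice_mult d L' L" "\<And>z. g (pt L' z) = pt L (d * z)" using ell_hom_mult[OF L(2,1) g] by blast
  have cd: "d * c = 1"
  proof (rule ccontr)
    assume ne: "d * c \<noteq> 1"
    obtain z where z: "z \<notin> L" using period_lattice_not_UNIV[OF L(1)] by blast
    \<comment> \<open>The inverse homomorphisms satisfy \<open>(d c - 1) w \<in> L\<close> for all \<open>w\<close>, and \<open>L\<close> is not the plane.\<close>
    define w where "w = z / (d * c - 1)"
    have "pt L (d * (c * w)) = pt L w" using gf[of "pt L w"] c d by simp
    then have "d * (c * w) - w \<in> L" using a by (simp add: pt_eq_iff)
    moreover have "d * (c * w) - w = (d * c - 1) * w" by (simp add: algebra_simps)
    ultimately show False using z ne by (simp add: w_def)
  qed
  have c0: "c \<noteq> 0" using cd by auto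
  have cL: "(*) c ` L = L'"
  proof
    show "(*) c ` L \<subseteq> L'" using c(1) by (auto simp: lattice_mult_def)
    show "L' \<subseteq> (*) c ` L"
    proof
      fix x assume "x \<in> L'"
      then have "d * x \<in> L" using d(1) by (simp add: lattice_mult_def)
      moreover have "x = c * (d * x)" using cd by (simp add: mult.assoc[symmetric] mult.commute[of c])
      ultimately show "x \<in> (*) c ` L" by blast
    qed
  qed
  have "add_subgroup ((*) c ` M)" using M(1) unfolding add_subgroup_iff
    by (auto simp: image_iff) (metis right_diff_distrib)+
  moreover have "L' \<subseteq> (*) c ` M" using cL M(2) by auto
  moreover have "pt L' ` (*) c ` M = pt L' ` M'" using fC c(2) by (simp add: image_image)
  ultimately have "(*) c ` M = M'" by (metis Union_pt_image M(3,4) a(2))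
  then show "homothetic L M L' M'" using c0 cL by (auto simp: homothetic_def)
next
  note a = L[THEN period_lattice_add_subgroup]
  assume "homothetic L M L' M'"
  then obtain c where c: "c \<noteq> 0" "(*) c ` L = L'" "(*) c ` M = M'" by (auto simp: homothetic_def)
  have m: "lattice_mult c L L'" "lattice_mult (inverse c) L' L"
    using c by (auto simp: lattice_mult_def mult.assoc[symmetric])
  note f = mult_map_pt[OF a m(1)] and g = mult_map_pt[OF a(2,1) m(2)]
  show "pair_isomorphic L (pt L ` M) L' (pt L' ` M')"
    unfolding pair_isomorphic_def
  proof (intro bexI conjI ballI)
    show "mult_map c L' \<in> ell_hom L L'" "mult_map (inverse c) L \<in> ell_hom L' L"
      using mult_map_ell_hom a m by auto
    show "mult_map (inverse c) L (mult_map c L' P) = P" if "P \<in> carrier (ell L)" for P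
      using that c(1) by (auto elim!: ell_pointE simp: f g mult.assoc[symmetric])
    show "mult_map c L' (mult_map (inverse c) L P) = P" if "P \<in> carrier (ell L')" for P
      using that c(1) by (auto elim!: ell_pointE simp: f g mult.assoc[symmetric])
    show "mult_map c L' ` pt L ` M = pt L' ` M'" using c(3) by (auto simp: image_image f)
  qed
qed

lemma homothetic_lat_scale:
  "c \<noteq> 0 \<Longrightarrow> homothetic (lat u v) (lat u' v') (lat (c * u) (c * v)) (lat (c * u') (c * v'))"
  unfolding homothetic_def by (metis lat_scale)

lemma period_lattice_lat: "Im (v / u) \<noteq> 0 \<Longrightarrow> period_lattice (lat u v)"
  by (auto simp: period_lattice_iff)

lemma Im_div_divide: "Im (v / (u / of_nat n)) = of_nat n * Im (v / u)"
proof -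
  have "v / (u / of_nat n) = of_real (of_nat n) * (v / u)" by simp
  then show ?thesis by (simp only: Im_complex_of_real Re_complex_of_real times_complex.sel mult_zero_left add_0_right)
qed

lemma cmod_power2_Im: "(cmod c)\<^sup>2 * Im z = Im ((c * z) * cnj c)"
  unfolding cmod_power2 by (simp add: power2_eq_square algebra_simps)

text \<open>
The factor is the denominator \<open>c\<close> of the Moebius transformation: \<open>c\<close> and \<open>c * mobius A t\<close> arise from
\<open>1\<close>, \<open>t\<close> by the unimodular matrix \<open>A\<close>.  Divisibility of the lower left entry by \<open>N\<close> means that \<open>A\<close> is
also integral with respect to the basis \<open>1/N\<close>, \<open>t\<close>.
\<close>

lemma mobius_homothetic:
  assumes A: "A \<in> Gamma0 N" and t: "Im t > 0" and N: "N > 0"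
  shows "Im (mobius A t) > 0"
    and "homothetic (lat 1 (mobius A t)) (lat (1 / of_nat N) (mobius A t)) (lat 1 t) (lat (1 / of_nat N) t)"
proof -
  define a b e d where "a = A $ 1 $ 1" "b = A $ 1 $ 2" "e = A $ 2 $ 1" "d = A $ 2 $ 2"
  note abed = this
  have det: "d * a - e * b = 1" and "int N dvd e" using A by (auto simp: Gamma0_def det_2 abed algebra_simps)
  then obtain e' where e': "e = int N * e'" by (auto elim: dvdE)
  define c where "c = of_int d * 1 + of_int e * t"
  have c0: "c \<noteq> 0"
  proof
    assume "c = 0"
    then have "Im c = 0" "Re c = 0" by auto
    then have "e = 0" "d = 0" using t by (auto simp: c_def)
    then show False using det by simp
  qed
  have m: "mobius A t = (of_int b * 1 + of_int a * t) / c"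
    by (simp add: mobius_def abed c_def add.commute)
  then have cm: "c * mobius A t = of_int b * 1 + of_int a * t" using c0 by simp
  have "(cmod c)\<^sup>2 * Im (mobius A t) = Im ((c * mobius A t) * cnj c)"
    by (rule cmod_power2_Im)
  also have "\<dots> = of_int (d * a - e * b) * Im t" unfolding cm by (simp add: c_def algebra_simps)
  finally have "(cmod c)\<^sup>2 * Im (mobius A t) > 0" using t det by simp
  then show "Im (mobius A t) > 0" using c0 by (simp add: zero_less_mult_iff)
  have "lat (c * 1) (c * mobius A t) = lat 1 t"
  proof -
    have "c * 1 = of_int d * 1 + of_int e * t" by (simp add: c_def)
    then show ?thesis unfolding cm by (metis lat_unimodular[OF det])
  qed
  moreover have "lat (c * (1 / of_nat N)) (c * mobius A t) = lat (1 / of_nat N) t"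
  proof -
    have 1: "c * (1 / of_nat N) = of_int d * (1 / of_nat N) + of_int e' * t" using N
      by (simp add: c_def e' field_simps)
    have 2: "c * mobius A t = of_int (b * int N) * (1 / of_nat N) + of_int a * t" using N
      unfolding cm by simp
    have "d * a - e' * (b * int N) = 1" using det by (simp add: e' algebra_simps)
    then show ?thesis unfolding 1 2 by (rule lat_unimodular)
  qed
  ultimately show "homothetic (lat 1 (mobius A t)) (lat (1 / of_nat N) (mobius A t)) (lat 1 t) (lat (1 / of_nat N) t)"
    using homothetic_lat_scale[OF c0] by metis
qed

text \<open>
Expressing \<open>c\<close>, \<open>c t\<close> by \<open>1\<close>, \<open>t'\<close> gives the integral matrix.  Its determinant is invertible because
the roles of the bases can be exchanged, and positive because \<open>t\<close> and \<open>t'\<close> are both in the upper half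
plane.
\<close>

lemma homothetic_imp_mobius:
  assumes h: "homothetic (lat 1 t) (lat (1 / of_nat N) t) (lat 1 t') (lat (1 / of_nat N) t')"
    and t: "Im t > 0" "Im t' > 0" and N: "N > 0"
  shows "\<exists>A \<in> Gamma0 N. t = mobius A t'"
proof -
  obtain c where c0: "c \<noteq> 0" and "(*) c ` lat 1 t = lat 1 t'"
    and "(*) c ` lat (1 / of_nat N) t = lat (1 / of_nat N) t'"
    using h by (auto simp: homothetic_def)
  then have c1: "lat c (c * t) = lat 1 t'" and cN: "lat (c * (1 / of_nat N)) (c * t) = lat (1 / of_nat N) t'"
    by (auto simp: lat_scale)
  obtain d e where ed: "c = of_int d * 1 + of_int e * t'" using c1 lat_basis_mem(1)[of c "c * t"] by (auto elim: latE)
  obtain b a where ba: "c * t = of_int b * 1 + of_int a * t'" using c1 lat_basis_mem(2)[of "c * t" c] by (auto elim: latE)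
  have "1 \<in> lat c (c * t)" "t' \<in> lat c (c * t)" unfolding c1 by simp_all
  then obtain p q r s where pq: "1 = of_int p * c + of_int q * (c * t)"
    and rs: "t' = of_int r * c + of_int s * (c * t)" by (blast elim: latE)
  have pos: "(cmod c)\<^sup>2 * Im t > 0" using c0 t by simp
  have "(cmod c)\<^sup>2 * Im t = Im ((c * t) * cnj c)"
    by (rule cmod_power2_Im)
  moreover have "Im ((c * t) * cnj c) = of_int (a * d - b * e) * Im t'" unfolding ba unfolding ed by (simp add: algebra_simps)
  ultimately have 1: "(cmod c)\<^sup>2 * Im t = of_int (a * d - b * e) * Im t'" by simp
  have "Im t' = Im (t' * cnj 1)" by simp
  also have "\<dots> = Im ((of_int r * c + of_int s * (c * t)) * cnj (of_int p * c + of_int q * (c * t)))"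
    using pq rs by simp
  also have "\<dots> = of_int (p * s - q * r) * Im ((c * t) * cnj c)" by (simp add: algebra_simps)
  also have "Im ((c * t) * cnj c) = of_int (a * d - b * e) * Im t'" by fact
  finally have "of_int ((p * s - q * r) * (a * d - b * e)) * Im t' = 1 * Im t'" by (simp add: mult.assoc)
  then have "of_int ((p * s - q * r) * (a * d - b * e)) = (1::real)" using t by (simp only: mult_cancel_right) auto
  then have "(p * s - q * r) * (a * d - b * e) = 1" by linarith
  moreover have "a * d - b * e > 0" using pos t unfolding 1 by (simp add: zero_less_mult_iff del: of_int_diff of_int_mult)
  ultimately have det: "a * d - b * e = 1" by (metis pos_zmult_eq_1_iff mult.commute)
  have "int N dvd e"
  proof -
    obtain k l where "c * (1 / of_nat N) = of_int k * (1 / of_nat N) + of_int l * t'"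
      using cN lat_basis_mem(1)[of "c * (1 / of_nat N)" "c * t"] by (auto elim: latE)
    then have "c = of_int k * 1 + of_int (int N * l) * t'" using N by (simp add: field_simps)
    then have "Im (of_int d * 1 + of_int e * t') = Im (of_int k * 1 + of_int (int N * l) * t')" using ed by metis
    then have "of_int (int N * l) * Im t' = of_int e * Im t'" by simp metis
    then have "of_int (int N * l) = (of_int e :: real)" using t by (metis less_irrefl mult_cancel_right)
    then have "e = int N * l" by (metis of_int_eq_iff)
    then show ?thesis by simp
  qed
  define A :: "int^2^2" where "A = vector [vector [a, b], vector [e, d]]"
  have entries: "A $ 1 $ 1 = a" "A $ 1 $ 2 = b" "A $ 2 $ 1 = e" "A $ 2 $ 2 = d" by (simp_all add: A_def)
  have "A \<in> Gamma0 N" using det \<open>int N dvd e\<close> by (simp add: Gamma0_def det_2 entries mult.commute)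
  moreover have "t = mobius A t'"
  proof -
    have "t = (c * t) / c" using c0 by simp
    then show ?thesis unfolding ba unfolding ed by (simp add: mobius_def entries add.commute)
  qed
  ultimately show ?thesis by blast
qed

lemma Gamma0_orbit:
  assumes "Im t > 0" "N > 0"
  shows "(\<lambda>A. mobius A t) ` Gamma0 N =
    {t'. Im t' > 0 \<and> homothetic (lat 1 t') (lat (1 / of_nat N) t') (lat 1 t) (lat (1 / of_nat N) t)}"
  using mobius_homothetic[OF _ assms] homothetic_imp_mobius[OF _ _ assms] by blast

definition homothety_class :: "nat \<Rightarrow> complex set \<Rightarrow> complex set \<Rightarrow> complex set" where
  "homothety_class N L M = {t. Im t > 0 \<and> homothetic (lat 1 t) (lat (1 / of_nat N) t) L M}"

lemma homothety_class_eq_iff: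
  assumes "t \<in> homothety_class N L M"
  shows "homothety_class N L M = homothety_class N L' M' \<longleftrightarrow> homothetic L M L' M'"
proof
  assume "homothety_class N L M = homothety_class N L' M'"
  then have "homothetic (lat 1 t) (lat (1 / of_nat N) t) L M" "homothetic (lat 1 t) (lat (1 / of_nat N) t) L' M'"
    using assms by (auto simp: homothety_class_def)
  then show "homothetic L M L' M'" by (metis homothetic_sym homothetic_trans)
next
  assume "homothetic L M L' M'"
  then show "homothety_class N L M = homothety_class N L' M'"
    unfolding homothety_class_def by (metis homothetic_sym homothetic_trans)
qed

lemma Y0_homothety_class:
  assumes "N > 0" shows "Y0 N = (\<lambda>t. homothety_class N (lat 1 t) (lat (1 / of_nat N) t)) ` upper_half"
  using assms by (auto simp: Y0_def upper_half_def Gamma0_orbit homothety_class_def image_iff)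

lemma std_level:
  assumes "N > 0"
  shows "generate (ell (std_lattice t)) {pt (std_lattice t) (1 / of_nat N)} = pt (lat 1 t) ` lat (1 / of_nat N) t"
  using generate_pt_lat[OF assms, of 1 t] by (simp add: std_lattice_lat)

text \<open>
Points of the modular curve are homothety classes by \<open>Gamma0_orbit\<close>, and two classes that meet are
equal.  This makes the description that defines \<open>moduli_point\<close> unique.
\<close>

lemma moduli_point_homothety_class:
  assumes N: "N > 0" and im: "Im (v / u) > 0"
  shows "homothety_class N (lat u v) (lat (u / of_nat N) v) \<in> Y0 N"
    and "v / u \<in> homothety_class N (lat u v) (lat (u / of_nat N) v)"
    and "moduli_point N (lat u v) (pt (lat u v) ` lat (u / of_nat N) v) = homothety_class N (lat u v) (lat (u / of_nat N) v)"
proof -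
  define t where "t = v / u"
  have t: "Im t > 0" using im by (simp add: t_def)
  have u0: "u \<noteq> 0" using im by auto
  have h: "homothetic (lat 1 t) (lat (1 / of_nat N) t) (lat u v) (lat (u / of_nat N) v)"
    using homothetic_lat_scale[OF u0, of 1 t "1 / of_nat N" t] u0 by (simp add: t_def)
  let ?K = "homothety_class N (lat u v) (lat (u / of_nat N) v)"
  show tK: "v / u \<in> ?K" unfolding t_def[symmetric] using t h by (simp add: homothety_class_def)
  have Kt: "?K = homothety_class N (lat 1 t) (lat (1 / of_nat N) t)"
    using homothety_class_eq_iff[OF tK] homothetic_sym[OF h] by simp
  show K: "?K \<in> Y0 N" unfolding Kt Y0_homothety_class[OF N] using t by (auto simp: upper_half_def)
  have pi: "pair_isomorphic (std_lattice s) (generate (ell (std_lattice s)) {pt (std_lattice s) (1 / of_nat N)})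
      (lat u v) (pt (lat u v) ` lat (u / of_nat N) v) \<longleftrightarrow> s \<in> ?K" if "Im s > 0" for s
    unfolding std_level[OF N] unfolding std_lattice_lat
    using pair_isomorphic_iff_homothetic[of "lat 1 s" "lat u v" "lat (1 / of_nat N) s" "lat (u / of_nat N) v"]
      that im lat_subset_lat_divide[OF N]
      period_lattice_lat[of s 1] period_lattice_lat[of v u]
    by (auto simp: homothety_class_def add_subgroup_lat)
  have pos: "Im s > 0" if "X \<in> Y0 N" "s \<in> X" for X s
    using that by (auto simp: Y0_homothety_class[OF N] homothety_class_def)
  show "moduli_point N (lat u v) (pt (lat u v) ` lat (u / of_nat N) v) = ?K"
    unfolding moduli_point_def
  proof (rule the_equality)
    show "?K \<in> Y0 N \<and> (\<exists>s\<in>?K. pair_isomorphic (std_lattice s) (generate (ell (std_lattice s)) {pt (std_lattice s) (1 / of_nat N)})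
      (lat u v) (pt (lat u v) ` lat (u / of_nat N) v))"
      using K tK pi pos by blast
    fix X assume X: "X \<in> Y0 N \<and> (\<exists>s\<in>X. pair_isomorphic (std_lattice s) (generate (ell (std_lattice s)) {pt (std_lattice s) (1 / of_nat N)})
      (lat u v) (pt (lat u v) ` lat (u / of_nat N) v))"
    then obtain s where s: "s \<in> X" "s \<in> ?K" using pi pos by blast
    obtain x where x: "X = homothety_class N (lat 1 x) (lat (1 / of_nat N) x)" using X by (auto simp: Y0_homothety_class[OF N])
    have "homothetic (lat u v) (lat (u / of_nat N) v) (lat 1 x) (lat (1 / of_nat N) x)"
      using s unfolding x homothety_class_def by (blast intro: homothetic_sym homothetic_trans)
    then show "X = ?K" unfolding x using homothety_class_eq_iff[OF tK] by metis
  qed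
qed

lemma moduli_point_eq_iff:
  assumes "N > 0" "Im (v / u) > 0" "Im (v' / u') > 0"
  shows "moduli_point N (lat u v) (pt (lat u v) ` lat (u / of_nat N) v) =
      moduli_point N (lat u' v') (pt (lat u' v') ` lat (u' / of_nat N) v') \<longleftrightarrow>
    homothetic (lat u v) (lat (u / of_nat N) v) (lat u' v') (lat (u' / of_nat N) v')"
  using moduli_point_homothety_class[OF assms(1,2)] moduli_point_homothety_class[OF assms(1,3)] homothety_class_eq_iff by simp


section \<open>Atkin--Lehner involutions\<close>

text \<open>
The two lattices of the pair \<open>(E/C_r, (C + E[r])/C_r)\<close>, where \<open>L \<subseteq> M\<close> are those of \<open>(E, C)\<close>.  This
description mentions no basis, so it is visibly compatible with homotheties.
\<close>

definition al_sub :: "nat \<Rightarrow> complex set \<Rightarrow> complex set \<Rightarrow> complex set" where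
  "al_sub r L M = {z \<in> M. of_nat r * z \<in> L}"

definition al_sup :: "nat \<Rightarrow> complex set \<Rightarrow> complex set \<Rightarrow> complex set" where
  "al_sup r L M = {z + w | z w. z \<in> M \<and> of_nat r * w \<in> L}"

lemma homothetic_al:
  assumes "homothetic L M L' M'"
  shows "homothetic (al_sub r L M) (al_sup r L M) (al_sub r L' M') (al_sup r L' M')"
proof -
  obtain c where c: "c \<noteq> 0" and L': "(*) c ` L = L'" and M': "(*) c ` M = M'"
    using assms by (auto simp: homothetic_def)
  have L: "z \<in> L' \<longleftrightarrow> z / c \<in> L" and M: "z \<in> M' \<longleftrightarrow> z / c \<in> M" for z
    using c L' M' by (auto simp: image_iff) (metis nonzero_mult_div_cancel_left times_divide_eq_right)+
  have "(*) c ` X = {z. z / c \<in> X}" for X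
    using c by (auto simp: image_iff) (metis nonzero_mult_div_cancel_left times_divide_eq_right)
  moreover have "{z. z / c \<in> al_sub r L M} = al_sub r L' M'" by (auto simp: al_sub_def L M)
  moreover have "{z. z / c \<in> al_sup r L M} = al_sup r L' M'"
  proof (intro equalityI subsetI CollectI)
    fix z assume "z \<in> {z. z / c \<in> al_sup r L M}"
    then obtain x y where "z / c = x + y" "x \<in> M" "of_nat r * y \<in> L" by (auto simp: al_sup_def)
    then have "z = c * x + c * y" "c * x \<in> M'" "of_nat r * (c * y) \<in> L'" using c by (auto simp: L M field_simps)
    then show "z \<in> al_sup r L' M'" by (auto simp: al_sup_def)
  next
    fix z assume "z \<in> al_sup r L' M'"
    then obtain x y where "z = x + y" "x \<in> M'" "of_nat r * y \<in> L'" by (auto simp: al_sup_def)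
    then have "z / c = x / c + y / c" "x / c \<in> M" "of_nat r * (y / c) \<in> L" by (auto simp: L M add_divide_distrib)
    then show "z / c \<in> al_sup r L M" unfolding al_sup_def by blast
  qed
  ultimately show ?thesis unfolding homothetic_def using c by metis
qed

lemma lat_divide_dvd:
  assumes "r dvd N" "N > 0"
  shows "lat (u / of_nat r) v \<subseteq> lat (u / of_nat N) v"
proof -
  obtain s where s: "N = r * s" using assms by auto
  then have "u / of_nat r = of_int (int s) * (u / of_nat N) + of_int 0 * v" using assms(2) by simp
  then have "u / of_nat r \<in> lat (u / of_nat N) v" by (rule latI)
  then show ?thesis by (simp add: lat_subset_iff add_subgroup_lat)
qed

lemma al_sub_lat:
  assumes "Im (v / u) \<noteq> 0" "r * s > 0"
  shows "al_sub r (lat u v) (lat (u / of_nat (r * s)) v) = lat (u / of_nat r) v"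
proof (intro equalityI subsetI)
  fix z assume z: "z \<in> al_sub r (lat u v) (lat (u / of_nat (r * s)) v)"
  then obtain k m where km: "z = of_int k * (u / of_nat (r * s)) + of_int m * v" by (auto simp: al_sub_def elim: latE)
  then have "of_nat r * z = of_int k * (u / of_nat s) + of_int (int r * m) * v" using assms(2) by (simp add: field_simps)
  then have "int s dvd k" using z assms mult_mem_lat_iff[of v u s k "int r * m"] by (simp add: al_sub_def)
  then obtain l where "k = int s * l" by (auto elim: dvdE)
  then have "z = of_int l * (u / of_nat r) + of_int m * v" using km assms(2) by simp
  then show "z \<in> lat (u / of_nat r) v" by (rule latI)
next
  fix z assume z: "z \<in> lat (u / of_nat r) v"
  then obtain l m where lm: "z = of_int l * (u / of_nat r) + of_int m * v" by (auto elim: latE)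
  then have "of_nat r * z = of_int l * u + of_int (int r * m) * v" using assms(2) by (simp add: field_simps)
  then have "of_nat r * z \<in> lat u v" by (rule latI)
  then show "z \<in> al_sub r (lat u v) (lat (u / of_nat (r * s)) v)"
    using z lat_divide_dvd[of r "r * s" u v] assms(2) by (auto simp: al_sub_def)
qed

lemma lat_multiple:
  assumes "r > 0"
  shows "of_nat r * z \<in> lat u v \<longleftrightarrow> z \<in> lat (u / of_nat r) (v / of_nat r)"
proof -
  have "lat u v = (*) (of_nat r) ` lat (u / of_nat r) (v / of_nat r)" using assms by (simp add: lat_scale)
  then show ?thesis using assms by auto
qed

lemma al_sup_lat:
  assumes "r * s > 0"
  shows "al_sup r (lat u v) (lat (u / of_nat (r * s)) v) = lat (u / of_nat (r * s)) (v / of_nat r)"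
proof (intro equalityI subsetI)
  have r: "r > 0" using assms by auto
  let ?K = "lat (u / of_nat (r * s)) (v / of_nat r)"
  have "of_int (int r) * (v / of_nat r) \<in> ?K" "of_int (int s) * (u / of_nat (r * s)) \<in> ?K"
    by (intro add_subgroup_of_int add_subgroup_lat lat_basis_mem)+
  then have "v \<in> ?K" "u / of_nat r \<in> ?K" using assms by simp_all
  then have sub: "lat (u / of_nat (r * s)) v \<subseteq> ?K" "lat (u / of_nat r) (v / of_nat r) \<subseteq> ?K"
    by (auto simp: lat_subset_iff add_subgroup_lat)
  show "z \<in> ?K" if "z \<in> al_sup r (lat u v) (lat (u / of_nat (r * s)) v)" for z
    using that sub by (auto simp: al_sup_def lat_multiple[OF r] intro!: add_subgroup_add[OF add_subgroup_lat])
  fix z assume "z \<in> ?K"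
  then obtain k m where "z = of_int k * (u / of_nat (r * s)) + of_int m * (v / of_nat r)" by (auto elim: latE)
  moreover have "of_int k * (u / of_nat (r * s)) \<in> lat (u / of_nat (r * s)) v"
    "of_int m * (v / of_nat r) \<in> lat (u / of_nat r) (v / of_nat r)"
    by (intro add_subgroup_of_int add_subgroup_lat lat_basis_mem)+
  ultimately show "z \<in> al_sup r (lat u v) (lat (u / of_nat (r * s)) v)"
    unfolding al_sup_def lat_multiple[OF r] by blast
qed

text \<open>
By Lagrange's theorem a subgroup of order \<open>r\<close> consists of \<open>r\<close>-torsion, and the \<open>r\<close>-torsion of the
cyclic group has only \<open>r\<close> elements.
\<close>

lemma sub_of_order_lat:
  assumes im: "Im (v / u) \<noteq> 0" and N: "r * s > 0"
  shows "sub_of_order (lat u v) (pt (lat u v) ` lat (u / of_nat (r * s)) v) r = pt (lat u v) ` lat (u / of_nat r) v"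
  unfolding sub_of_order_def
proof (rule the_equality)
  let ?L = "lat u v"
  let ?G = "pt (lat u v) ` lat (u / of_nat r) v"
  have r: "r > 0" using N by auto
  note cardG = card_pt_lat[OF im r]
  have "?G \<subseteq> pt ?L ` lat (u / of_nat (r * s)) v" using lat_divide_dvd[of r "r * s" u v] N by auto
  then show "subgroup ?G (ell ?L) \<and> ?G \<subseteq> pt ?L ` lat (u / of_nat (r * s)) v \<and> card ?G = r"
    using cardG subgroup_pt_image add_subgroup_lat by blast
  fix H assume H: "subgroup H (ell ?L) \<and> H \<subseteq> pt ?L ` lat (u / of_nat (r * s)) v \<and> card H = r"
  interpret G: group "ell ?L" by (rule group_ell[OF add_subgroup_lat])
  interpret H: group "(ell ?L)\<lparr>carrier := H\<rparr>" using H G.subgroup_imp_group by blast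
  have "H \<subseteq> ?G"
  proof
    fix P assume P: "P \<in> H"
    then obtain z where z: "z \<in> lat (u / of_nat (r * s)) v" "P = pt ?L z" using H by blast
    have "finite H" using H r card_ge_0_finite by blast
    then have "P [^]\<^bsub>(ell ?L)\<lparr>carrier := H\<rparr>\<^esub> r = \<one>\<^bsub>(ell ?L)\<lparr>carrier := H\<rparr>\<^esub>"
      using H.pow_order_eq_1[of P] P H by (simp add: order_def)
    then have "P [^]\<^bsub>ell ?L\<^esub> r = \<one>\<^bsub>ell ?L\<^esub>" using G.nat_pow_consistent[of P r H] by simp
    then have "of_nat r * z \<in> ?L" using pt_eq_iff[OF add_subgroup_lat, of u v "of_nat r * z" 0]
      by (simp add: z(2) pt_pow_nat add_subgroup_lat one_ell pt_0)
    then have "z \<in> lat (u / of_nat r) v" using z(1) al_sub_lat[OF im N] by (auto simp: al_sub_def)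
    then show "P \<in> ?G" using z(2) by blast
  qed
  then show "H = ?G" using H cardG by (simp add: card_subset_eq)
qed

lemma torsion_pt:
  assumes "add_subgroup L"
  shows "torsion L r = pt L ` {z. of_nat r * z \<in> L}"
proof -
  have "pt L z [^]\<^bsub>ell L\<^esub> r = \<one>\<^bsub>ell L\<^esub> \<longleftrightarrow> of_nat r * z \<in> L" for z
    using assms pt_eq_iff[OF assms, of "of_nat r * z" 0] by (simp add: pt_pow_nat one_ell pt_0)
  then show ?thesis by (auto simp: torsion_def carrier_ell)
qed

lemma quot_map_pt:
  assumes "add_subgroup L" "add_subgroup M" "L \<subseteq> M"
  shows "quot_map (pt L ` M) (pt L z) = pt M z"
  using pt_set_mult[OF assms, of z 0] assms by (simp add: quot_map_def quot_curve_def Union_pt_image pt_0)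

text \<open>
For coprime \<open>r\<close>, \<open>s\<close> the quotient of \<open>\<int>x/s + \<int>y/r\<close> by \<open>\<int>x + \<int>y\<close> is again cyclic of order \<open>r s\<close>.
The class of \<open>x/s + y/r\<close> generates it, which leads to \<open>u = r x + s y\<close>.
\<close>

lemma level_basis:
  assumes im: "Im (y / x) \<noteq> 0" and cop: "coprime r s" and pos: "r * s > 0"
  obtains u v where "Im (v / u) > 0" "lat x y = lat u v"
    "lat (x / of_nat s) (y / of_nat r) = lat (u / of_nat (r * s)) v"
proof -
  obtain d c where "d * int r + c * int s = 1" using bezout_int[of "int r" "int s"] cop by auto
  then have det: "int r * d - int s * (- c) = 1" by (simp add: mult.commute)
  define u where "u = of_int (int r) * x + of_int (int s) * y"
  define v where "v = of_int (- c) * x + of_int d * y"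
  have uN: "u / of_nat (r * s) = of_int 1 * (x / of_nat s) + of_int 1 * (y / of_nat r)"
    using pos by (simp add: u_def field_simps)
  have v': "v = of_int (- c * int s) * (x / of_nat s) + of_int (d * int r) * (y / of_nat r)"
    using pos by (simp add: v_def)
  have "1 * (d * int r) - 1 * (- c * int s) = 1" using det by (simp add: mult.commute)
  then have "lat (u / of_nat (r * s)) v = lat (x / of_nat s) (y / of_nat r)"
    unfolding uN unfolding v' by (rule lat_unimodular)
  moreover have "lat u v = lat x y" unfolding u_def v_def by (rule lat_unimodular[OF det])
  moreover have "Im (v / u) \<noteq> 0" unfolding u_def v_def by (rule Im_div_unimodular[OF det im])
  ultimately show thesis using that[of v u] that[of "- v" u] Im_div_minus[of v u] by (auto simp: lat_minus)
qed

text \<open>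
The image is defined through an arbitrary pair \<open>L\<close>, \<open>C\<close> representing the given point.  In an
adapted basis it is the pair of lattices \<open>al_sub\<close>, \<open>al_sup\<close>, and two representatives are homothetic,
so that it does not depend on the choice.
\<close>

lemma atkin_lehner_moduli_point:
  assumes im: "Im (v / u) > 0" and cop: "coprime r s" and pos: "r * s > 0"
  shows "atkin_lehner (r * s) r (moduli_point (r * s) (lat u v) (pt (lat u v) ` lat (u / of_nat (r * s)) v)) =
    moduli_point (r * s) (lat (u / of_nat r) v) (pt (lat (u / of_nat r) v) ` lat (u / of_nat (r * s)) (v / of_nat r))"
proof -
  let ?N = "r * s"
  have r: "r > 0" using pos by auto
  define X where "X = moduli_point ?N (lat u v) (pt (lat u v) ` lat (u / of_nat ?N) v)"
  define Y where "Y u v = moduli_point ?N (lat (u / of_nat r) v)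
    (pt (lat (u / of_nat r) v) ` lat (u / of_nat ?N) (v / of_nat r))" for u v
  have quot: "moduli_point ?N (quot_curve (sub_of_order L C r)) (quot_map (sub_of_order L C r) ` (C <#>\<^bsub>ell L\<^esub> torsion L r)) = Y x y"
    if xy: "Im (y / x) > 0" "L = lat x y" "C = pt L ` lat (x / of_nat ?N) y" for L C x y
  proof -
    let ?M = "lat (x / of_nat r) y"
    have H: "sub_of_order L C r = pt L ` ?M" using sub_of_order_lat[of y x r s] xy pos by simp
    have LM: "add_subgroup L" "add_subgroup ?M" "L \<subseteq> ?M" using lat_subset_lat_divide[OF r] xy by (auto simp: add_subgroup_lat)
    have "C <#>\<^bsub>ell L\<^esub> torsion L r = pt L ` al_sup r L (lat (x / of_nat ?N) y)"
    proof -
      have "C <#>\<^bsub>ell L\<^esub> torsion L r = {pt L (z + w) | z w. z \<in> lat (x / of_nat ?N) y \<and> of_nat r * w \<in> L}"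
        unfolding set_mult_def torsion_pt[OF LM(1)] xy(3) using LM(1) by (auto simp: pt_mult)
      then show ?thesis by (auto simp: al_sup_def)
    qed
    also have "\<dots> = pt L ` lat (x / of_nat ?N) (y / of_nat r)" unfolding xy(2) al_sup_lat[OF pos] ..
    finally show ?thesis unfolding H Y_def
      by (simp add: quot_curve_def Union_pt_image[OF LM] image_image quot_map_pt[OF LM])
  qed
  have YX: "Y x y = Y u v" if xy: "Im (y / x) > 0" "moduli_point ?N (lat x y) (pt (lat x y) ` lat (x / of_nat ?N) y) = X" for x y
  proof -
    have "homothetic (lat x y) (lat (x / of_nat ?N) y) (lat u v) (lat (u / of_nat ?N) v)"
      using xy(2) moduli_point_eq_iff[OF pos xy(1) im] by (simp add: X_def)
    from homothetic_al[OF this, of r]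
    have h: "homothetic (lat (x / of_nat r) y) (lat (x / of_nat ?N) (y / of_nat r))
        (lat (u / of_nat r) v) (lat (u / of_nat ?N) (v / of_nat r))"
      using al_sub_lat[of _ _ r s] al_sup_lat[OF pos] pos xy im by simp
    have "Im (y / (x / of_nat r)) \<noteq> 0" "Im (v / (u / of_nat r)) \<noteq> 0" unfolding Im_div_divide using xy(1) im r by simp_all
    from level_basis[OF this(1) cop pos] level_basis[OF this(2) cop pos]
    obtain x' y' u' v' where *: "Im (y' / x') > 0" "lat (x / of_nat r) y = lat x' y'"
      "lat (x / of_nat r / of_nat s) (y / of_nat r) = lat (x' / of_nat ?N) y'"
      "Im (v' / u') > 0" "lat (u / of_nat r) v = lat u' v'"
      "lat (u / of_nat r / of_nat s) (v / of_nat r) = lat (u' / of_nat ?N) v'" by metis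
    then show ?thesis using moduli_point_eq_iff[OF pos *(1,4)] h by (simp add: Y_def)
  qed
  have "X \<in> Y0 ?N" using moduli_point_homothety_class[OF pos im] by (simp add: X_def)
  moreover have "(THE X'. \<exists>L C. period_lattice L \<and> cyclic_subgroup L ?N C \<and> moduli_point ?N L C = X \<and>
     X' = moduli_point ?N (quot_curve (sub_of_order L C r)) (quot_map (sub_of_order L C r) ` (C <#>\<^bsub>ell L\<^esub> torsion L r))) = Y u v"
  proof (rule the_equality)
    have "period_lattice (lat u v)" "cyclic_subgroup (lat u v) ?N (pt (lat u v) ` lat (u / of_nat ?N) v)"
      using im pos cyclic_subgroup_lat[of v u ?N] period_lattice_lat[of v u] by simp_all
    then show "\<exists>L C. period_lattice L \<and> cyclic_subgroup L ?N C \<and> moduli_point ?N L C = X \<and>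
     Y u v = moduli_point ?N (quot_curve (sub_of_order L C r)) (quot_map (sub_of_order L C r) ` (C <#>\<^bsub>ell L\<^esub> torsion L r))"
      using quot[OF im refl refl] X_def by metis
    fix X' assume "\<exists>L C. period_lattice L \<and> cyclic_subgroup L ?N C \<and> moduli_point ?N L C = X \<and>
     X' = moduli_point ?N (quot_curve (sub_of_order L C r)) (quot_map (sub_of_order L C r) ` (C <#>\<^bsub>ell L\<^esub> torsion L r))"
    then obtain L C where LC: "period_lattice L" "cyclic_subgroup L ?N C" "moduli_point ?N L C = X"
     "X' = moduli_point ?N (quot_curve (sub_of_order L C r)) (quot_map (sub_of_order L C r) ` (C <#>\<^bsub>ell L\<^esub> torsion L r))"
      by blast
    obtain x y where xy: "Im (y / x) > 0" "L = lat x y" "C = pt L ` lat (x / of_nat ?N) y"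
      using cyclic_subgroup_basis[OF LC(1,2)] by metis
    then show "X' = Y u v" using quot[OF xy] YX[OF xy(1)] LC(3,4) by simp
  qed
  ultimately show ?thesis unfolding atkin_lehner_def X_def[symmetric] Y_def[symmetric] by simp
qed


section \<open>The curves of a coprime factorisation and their maps\<close>

text \<open>
If \<open>p\<close> divides \<open>r\<close>, then it is prime to \<open>s\<close>, and a \<open>p\<close>-primary element \<open>k u/N + m v\<close> must have \<open>s\<close>
dividing \<open>k\<close>.  Conversely, partial fractions write \<open>u/r\<close> as an integral combination of the \<open>u/q\<close> for
the prime powers \<open>q\<close> dividing \<open>r\<close>.
\<close>

lemma sum_primary_lat:
  assumes im: "Im (v / u) \<noteq> 0" and cop: "coprime r s" and pos: "r * s > 0"
  shows "sum_primary (lat u v) r (pt (lat u v) ` lat (u / of_nat (r * s)) v) = pt (lat u v) ` lat (u / of_nat r) v"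
proof -
  let ?L = "lat u v" and ?N = "r * s"
  let ?S = "\<Union>p\<in>{p. prime p \<and> p dvd r}. primary_component ?L p (pt ?L ` lat (u / of_nat ?N) v)"
  have r: "r > 0" and s: "s > 0" using pos by auto
  interpret G: group "ell ?L" by (rule group_ell[OF add_subgroup_lat])
  have prim: "pt ?L z \<in> primary_component ?L p (pt ?L ` lat (u / of_nat ?N) v) \<longleftrightarrow>
      z \<in> lat (u / of_nat ?N) v \<and> (\<exists>k. of_nat (p ^ k) * z \<in> ?L)" for z p
    using pt_mem_image[OF add_subgroup_lat add_subgroup_lat lat_subset_lat_divide[OF pos], of u v z]
      pt_eq_iff[OF add_subgroup_lat, of u v _ 0]
    by (simp add: primary_component_def pt_pow_nat add_subgroup_lat one_ell pt_0)
  have sub: "?S \<subseteq> pt ?L ` lat (u / of_nat r) v"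
  proof
    fix P assume "P \<in> ?S"
    then obtain p where p: "prime p" "p dvd r" "P \<in> primary_component ?L p (pt ?L ` lat (u / of_nat ?N) v)" by blast
    then obtain z where z: "P = pt ?L z" by (auto simp: primary_component_def)
    obtain j where j: "z \<in> lat (u / of_nat ?N) v" "of_nat (p ^ j) * z \<in> ?L" using p(3) unfolding z prim by blast
    then obtain k m where km: "z = of_int k * (u / of_nat ?N) + of_int m * v" by (auto elim: latE)
    then have "of_nat (p ^ j) * z = of_int (int (p ^ j) * k) * (u / of_nat ?N) + of_int (int (p ^ j) * m) * v"
      by (simp add: algebra_simps)
    then have "int ?N dvd int (p ^ j) * k" using j(2) mult_mem_lat_iff[OF im pos] by metis
    then have "int s dvd int (p ^ j) * k" by (metis dvd_mult_right of_nat_mult)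
    moreover have "coprime s p" using p(2) cop by (metis coprime_commute coprime_divisors dvd_refl)
    then have "coprime (int s) (int (p ^ j))" by simp
    ultimately have "int s dvd k" by (simp add: coprime_dvd_mult_right_iff)
    then obtain l where "k = int s * l" by (auto elim: dvdE)
    then have "z = of_int l * (u / of_nat r) + of_int m * v" using km pos by simp
    then show "P \<in> pt ?L ` lat (u / of_nat r) v" unfolding z by (blast intro: latI)
  qed
  have le: "generate (ell ?L) ?S \<subseteq> pt ?L ` lat (u / of_nat r) v"
    using G.generate_subgroup_incl[OF sub subgroup_pt_image] add_subgroup_lat by blast
  have gen: "pt ?L (u / of_nat d) \<in> generate (ell ?L) ?S" if "d dvd r" for d
    using that
  proof (induction d rule: less_induct)
    case (less d)
    have d: "d > 0" using less.prems r by (auto intro: Nat.gr0I)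
    have Scarr: "?S \<subseteq> carrier (ell ?L)" by (auto simp: primary_component_def)
    note sg = G.generate_is_subgroup[OF Scarr]
    show ?case
    proof (cases "d = 1")
      case True
      have "pt ?L u = \<one>\<^bsub>ell ?L\<^esub>" using pt_eq_iff[OF add_subgroup_lat, of u v u 0] by (simp add: one_ell pt_0 add_subgroup_lat)
      then show ?thesis using True subgroup.one_closed[OF sg] by simp
    next
      case False
      then obtain p where p: "prime p" "p dvd d" using prime_factor_nat by blast
      obtain m where m: "d = p ^ multiplicity p d * m" "\<not> p dvd m"
        using multiplicity_decompose'[of d p] d not_prime_unit p(1) by blast
      define q where "q = p ^ multiplicity p d"
      have d': "d = q * m" using m by (simp add: q_def)
      have "multiplicity p d > 0" using p d by (simp add: prime_multiplicity_gt_zero_iff)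
      then have "q > 1" using p(1) unfolding q_def by (intro one_less_power prime_gt_1_nat)
      then have "m < d" "m > 0" "q > 0" using d d' by (auto intro: Nat.gr0I)
      have "m dvd r" "q dvd r" using less.prems d' by (auto intro: dvd_mult_left dvd_mult_right)
      have IH: "pt ?L (u / of_nat m) \<in> generate (ell ?L) ?S" using less.IH[OF \<open>m < d\<close> \<open>m dvd r\<close>] .
      have "u / of_nat q \<in> lat (u / of_nat ?N) v"
        using lat_divide_dvd[of q ?N u v] \<open>q dvd r\<close> pos lat_basis_mem by auto
      moreover have "of_nat (p ^ multiplicity p d) * (u / of_nat q) \<in> ?L" using \<open>q > 0\<close> by (simp add: q_def[symmetric])
      ultimately have "pt ?L (u / of_nat q) \<in> ?S" using p less.prems prim by (auto intro: dvd_trans)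
      then have q: "pt ?L (u / of_nat q) \<in> generate (ell ?L) ?S" by (rule generate.incl)
      have "coprime q m" using m(2) p(1) by (simp add: q_def prime_imp_coprime)
      then obtain x y where xy: "x * int q + y * int m = 1" using bezout_int[of "int q" "int m"] by auto
      have "u / of_nat d = of_int (x * int q + y * int m) * (u / of_nat d)" unfolding xy by simp
      also have "\<dots> = of_int x * (u / of_nat m) + of_int y * (u / of_nat q)"
        using \<open>m > 0\<close> \<open>q > 0\<close> by (simp add: d' field_simps)
      finally have "pt ?L (u / of_nat d) = (pt ?L (u / of_nat m) [^]\<^bsub>ell ?L\<^esub> x) \<otimes>\<^bsub>ell ?L\<^esub> (pt ?L (u / of_nat q) [^]\<^bsub>ell ?L\<^esub> y)"
        by (simp add: pt_pow_int add_subgroup_lat pt_mult)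
      then show ?thesis using sg IH q by (simp add: G.subgroup_int_pow_closed subgroup.m_closed)
    qed
  qed
  have "pt ?L ` lat (u / of_nat r) v \<subseteq> generate (ell ?L) ?S"
  proof -
    have "?S \<subseteq> carrier (ell ?L)" by (auto simp: primary_component_def)
    then show ?thesis
      unfolding generate_pt_lat[OF r, symmetric] using gen[OF dvd_refl]
      by (intro G.generate_subgroup_incl G.generate_is_subgroup) blast+
  qed
  with le show ?thesis unfolding sum_primary_def by (rule equalityI)
qed

text \<open>
On the level of the plane the quotient map is the identity, so its dual is multiplication by the
degree.
\<close>

lemma dual_isogeny_quot_map:
  assumes L: "add_subgroup L" and M: "add_subgroup M" "L \<subseteq> M" and card: "card (pt L ` M) = r" and r: "\<And>z. z \<in> M \<Longrightarrow> of_nat r * z \<in> L"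
  shows "dual_isogeny L M (quot_map (pt L ` M)) = restrict (mult_map (of_nat r) L) (carrier (ell M))"
proof -
  note q = quot_map_pt[OF L M]
  have "kernel (ell L) (ell M) (quot_map (pt L ` M)) = pt L ` {z. 1 * z \<in> M}"
    by (rule kernel_mult[OF L M(1)]) (simp add: q)
  then have deg: "isog_degree L M (quot_map (pt L ` M)) = r" using card by (simp add: isog_degree_def)
  have "lattice_mult (of_nat r) M L" using r by (simp add: lattice_mult_def)
  note m = mult_map_pt[OF M(1) L this]
  show ?thesis unfolding dual_isogeny_def deg
  proof (rule the_equality)
    show "restrict (mult_map (of_nat r) L) (carrier (ell M)) \<in> ell_hom M L \<inter> extensional (carrier (ell M)) \<and>
      (\<forall>P\<in>carrier (ell L). restrict (mult_map (of_nat r) L) (carrier (ell M)) (quot_map (pt L ` M) P) = P [^]\<^bsub>ell L\<^esub> r)"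
      using ell_hom_from_mult[OF M(1) L, of "restrict (mult_map (of_nat r) L) (carrier (ell M))" "of_nat r"]
      by (auto elim!: ell_pointE simp: q m pt_pow_nat[OF L])
    fix g assume g: "g \<in> ell_hom M L \<inter> extensional (carrier (ell M)) \<and>
      (\<forall>P\<in>carrier (ell L). g (quot_map (pt L ` M) P) = P [^]\<^bsub>ell L\<^esub> r)"
    show "g = restrict (mult_map (of_nat r) L) (carrier (ell M))"
    proof (rule extensionalityI)
      fix Q assume "Q \<in> carrier (ell M)"
      then obtain z where "Q = pt M z" by (rule ell_pointE)
      then show "g Q = restrict (mult_map (of_nat r) L) (carrier (ell M)) Q"
        using g pt_in_carrier[of L z] by (metis q m pt_pow_nat[OF L] restrict_apply' pt_in_carrier)
    qed (use g in auto)
  qed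
qed

lemma induced_map_mult:
  assumes L: "add_subgroup L" and M: "add_subgroup M" "L \<subseteq> M" and L': "add_subgroup L'"
    and f: "\<And>z. f (pt L z) = pt L' (c * z)" and c: "lattice_mult c M L'"
  shows "induced_map L L' f (pt L ` M) = restrict (mult_map c L') (carrier (ell M))"
proof -
  note q = quot_map_pt[OF L M]
  have qc: "quot_curve (pt L ` M) = M" using Union_pt_image[OF L M] by (simp add: quot_curve_def)
  note m = mult_map_pt[OF M(1) L' c]
  show ?thesis unfolding induced_map_def qc
  proof (rule the_equality)
    show "restrict (mult_map c L') (carrier (ell M)) \<in> ell_hom M L' \<inter> extensional (carrier (ell M)) \<and>
      (\<forall>P\<in>carrier (ell L). restrict (mult_map c L') (carrier (ell M)) (quot_map (pt L ` M) P) = f P)"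
      using ell_hom_from_mult[OF M(1) L', of "restrict (mult_map c L') (carrier (ell M))" c]
      by (auto elim!: ell_pointE simp: q m f)
    fix g assume g: "g \<in> ell_hom M L' \<inter> extensional (carrier (ell M)) \<and>
      (\<forall>P\<in>carrier (ell L). g (quot_map (pt L ` M) P) = f P)"
    show "g = restrict (mult_map c L') (carrier (ell M))"
    proof (rule extensionalityI)
      fix Q assume "Q \<in> carrier (ell M)"
      then obtain z where "Q = pt M z" by (rule ell_pointE)
      then show "g Q = restrict (mult_map c L') (carrier (ell M)) Q"
        using g pt_in_carrier[of L z] by (metis q m f restrict_apply' pt_in_carrier)
    qed (use g in auto)
  qed
qed


section \<open>Elliptic curves in the surface as images of lines\<close>

text \<open>
The image in \<open>A\<close> of the line spanned by \<open>(p, q)\<close> in the universal cover.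
\<close>

definition lin_curve :: "complex set \<Rightarrow> complex set \<Rightarrow> complex \<Rightarrow> complex \<Rightarrow> (complex set \<times> complex set) set" where
  "lin_curve L1 L2 p q = range (\<lambda>z. (pt L1 (p * z), pt L2 (q * z)))"

text \<open>
The duals of the quotient maps are multiplications by \<open>r\<close> and \<open>s\<close>, and the maps induced by \<open>phi\<close> are
multiplications by \<open>c\<close>.
\<close>

lemma sigma_decomposition_lin_curve:
  assumes im: "Im (v / u) \<noteq> 0" and cop: "coprime r s" and pos: "r * s > 0"
    and L1: "L1 = lat u v" and L2: "add_subgroup L2"
    and phi: "\<And>z. phi (pt L1 z) = pt L2 (c * z)" and ker: "{z. c * z \<in> L2} = lat (u / of_nat (r * s)) v"
  shows "sigma_decomposition L1 L2 phi (r, s) a b =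
    (lin_curve L1 L2 (of_nat r) (- c), lin_curve L1 L2 (of_int b * of_nat s) (of_int a * c))"
proof -
  have r: "r > 0" and s: "s > 0" using pos by auto
  have a1: "add_subgroup L1" by (simp add: L1 add_subgroup_lat)
  have G: "kernel (ell L1) (ell L2) phi = pt L1 ` lat (u / of_nat (r * s)) v"
    using kernel_mult[OF a1 L2 phi] ker by simp
  have G1: "sum_primary L1 r (kernel (ell L1) (ell L2) phi) = pt L1 ` lat (u / of_nat r) v"
    unfolding G unfolding L1 by (rule sum_primary_lat[OF im cop pos])
  have "coprime s r" "s * r > 0" using cop pos by (auto simp: coprime_commute)
  then have G2: "sum_primary L1 s (kernel (ell L1) (ell L2) phi) = pt L1 ` lat (u / of_nat s) v"
    unfolding G unfolding L1 using sum_primary_lat[OF im, of s r] by (simp add: mult.commute)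
  have *: "add_subgroup (lat (u / of_nat n) v)" "L1 \<subseteq> lat (u / of_nat n) v" "quot_curve (pt L1 ` lat (u / of_nat n) v) = lat (u / of_nat n) v"
    "dual_isogeny L1 (lat (u / of_nat n) v) (quot_map (pt L1 ` lat (u / of_nat n) v)) (pt (lat (u / of_nat n) v) z) = pt L1 (of_nat n * z)"
    "induced_map L1 L2 phi (pt L1 ` lat (u / of_nat n) v) (pt (lat (u / of_nat n) v) z) = pt L2 (c * z)"
    if n: "n dvd r * s" "n > 0" for n z
  proof -
    let ?M = "lat (u / of_nat n) v"
    show M: "add_subgroup ?M" "L1 \<subseteq> ?M" using n lat_subset_lat_divide[of n u v] by (auto simp: L1 add_subgroup_lat)
    then show "quot_curve (pt L1 ` ?M) = ?M" using a1 by (simp add: quot_curve_def Union_pt_image)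
    have c: "lattice_mult c ?M L2" using lat_divide_dvd[OF n(1) pos, of u v] ker by (auto simp: lattice_mult_def)
    show "induced_map L1 L2 phi (pt L1 ` ?M) (pt ?M z) = pt L2 (c * z)"
      using induced_map_mult[OF a1 M L2 phi c] mult_map_pt[OF M(1) L2 c] by simp
    have nz: "of_nat n * z \<in> L1" if "z \<in> ?M" for z
      using that al_sub_lat[OF im, of n 1] n by (auto simp: al_sub_def L1)
    then have "lattice_mult (of_nat n) ?M L1" by (simp add: lattice_mult_def)
    then show "dual_isogeny L1 ?M (quot_map (pt L1 ` ?M)) (pt ?M z) = pt L1 (of_nat n * z)"
      using dual_isogeny_quot_map[OF a1 M _ nz] card_pt_lat[OF im n(2)] mult_map_pt[OF M(1) a1] by (simp add: L1)
  qed
  have dvd: "r dvd r * s" "s dvd r * s" by auto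
  show ?thesis
    unfolding sigma_decomposition_def Let_def prod.case G1 G2 *(3)[OF dvd(1) r] *(3)[OF dvd(2) s] carrier_ell image_image
      *(4,5)[OF dvd(1) r] *(4,5)[OF dvd(2) s]
    by (simp add: lin_curve_def pt_inv[OF L2] pt_pow_int[OF L2] pt_pow_int[OF a1] mult.assoc)
qed

text \<open>
This form needs no adapted basis, hence applies to kernels of isogenies without knowing that they
are cyclic.
\<close>

lemma moduli_point_homothetic:
  assumes N: "N > 0" and L: "period_lattice L" "period_lattice L'"
    and M: "add_subgroup M" "L \<subseteq> M" "add_subgroup M'" "L' \<subseteq> M'" and h: "homothetic L M L' M'"
  shows "moduli_point N L (pt L ` M) = moduli_point N L' (pt L' ` M')"
proof -
  let ?P = "\<lambda>t. pair_isomorphic (std_lattice t) (generate (ell (std_lattice t)) {pt (std_lattice t) (1 / of_nat N)})"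
  have eq: "?P t L (pt L ` M) \<longleftrightarrow> ?P t L' (pt L' ` M')" if "Im t > 0" for t
  proof -
    have t: "period_lattice (lat 1 t)" "lat 1 t \<subseteq> lat (1 / of_nat N) t"
      using that lat_subset_lat_divide[OF N] period_lattice_lat[of t 1] by auto
    show ?thesis
      unfolding std_level[OF N] unfolding std_lattice_lat
      using pair_isomorphic_iff_homothetic[OF t(1) L(1) add_subgroup_lat t(2) M(1,2)]
        pair_isomorphic_iff_homothetic[OF t(1) L(2) add_subgroup_lat t(2) M(3,4)] h
        homothetic_sym homothetic_trans by metis
  qed
  have "Im t > 0" if "X \<in> Y0 N" "t \<in> X" for X t
    using that by (auto simp: Y0_homothety_class[OF N] homothety_class_def)
  then have "X \<in> Y0 N \<and> (\<exists>t\<in>X. ?P t L (pt L ` M)) \<longleftrightarrow> X \<in> Y0 N \<and> (\<exists>t\<in>X. ?P t L' (pt L' ` M'))" for X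
    using eq by blast
  then show ?thesis unfolding moduli_point_def by simp
qed

lemma pt_scale: "c \<noteq> 0 \<Longrightarrow> pt ((*) c ` L) (c * z) = (*) c ` pt L z"
proof -
  have "pt ((*) c ` L) (c * z) = (\<lambda>l. c * l + c * z) ` L" by (auto simp: pt_eq)
  then show ?thesis by (auto simp: pt_eq image_iff simp flip: distrib_left)
qed

lemma card_pt_scale:
  assumes "c \<noteq> 0"
  shows "card (pt ((*) c ` L) ` (*) c ` M) = card (pt L ` M)"
proof -
  have "pt ((*) c ` L) ` (*) c ` M = (`) ((*) c) ` pt L ` M" using assms by (simp add: image_image pt_scale)
  moreover have "inj (\<lambda>z. c * z)" using assms by (auto simp: inj_def)
  then have "inj ((`) ((*) c))" by (auto simp: inj_def inj_image_eq_iff)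
  then have "inj_on ((`) ((*) c)) (pt L ` M)" by (rule inj_on_subset) simp
  ultimately show ?thesis by (simp add: card_image)
qed

definition curve_periods :: "complex set \<Rightarrow> complex set \<Rightarrow> complex \<Rightarrow> complex \<Rightarrow> complex set" where
  "curve_periods L1 L2 p q = {z. p * z \<in> L1 \<and> q * z \<in> L2}"

lemma embeds_onto_lin_curve:
  assumes L: "add_subgroup L1" "add_subgroup L2" and per: "period_lattice (curve_periods L1 L2 p q)"
  shows "embeds_onto L1 L2 (curve_periods L1 L2 p q) (\<lambda>P. (mult_map p L1 P, mult_map q L2 P)) (lin_curve L1 L2 p q)"
proof -
  let ?L = "curve_periods L1 L2 p q"
  have m: "lattice_mult p ?L L1" "lattice_mult q ?L L2" by (auto simp: lattice_mult_def curve_periods_def)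
  note a = period_lattice_add_subgroup[OF per]
  note mp = mult_map_pt[OF a L(1) m(1)] mult_map_pt[OF a L(2) m(2)]
  have "fst \<circ> (\<lambda>P. (mult_map p L1 P, mult_map q L2 P)) = mult_map p L1"
    "snd \<circ> (\<lambda>P. (mult_map p L1 P, mult_map q L2 P)) = mult_map q L2" by auto
  moreover have "inj_on (\<lambda>P. (mult_map p L1 P, mult_map q L2 P)) (carrier (ell ?L))"
  proof (rule inj_onI)
    fix P Q assume "P \<in> carrier (ell ?L)" "Q \<in> carrier (ell ?L)"
    then obtain x y where xy: "P = pt ?L x" "Q = pt ?L y" by (auto elim!: ell_pointE)
    assume "(mult_map p L1 P, mult_map q L2 P) = (mult_map p L1 Q, mult_map q L2 Q)"
    then have "p * x - p * y \<in> L1" "q * x - q * y \<in> L2" unfolding xy by (auto simp: mp pt_eq_iff L)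
    then have "x - y \<in> ?L" by (simp add: curve_periods_def right_diff_distrib)
    then show "P = Q" unfolding xy using a by (simp add: pt_eq_iff)
  qed
  moreover have "(\<lambda>P. (mult_map p L1 P, mult_map q L2 P)) ` carrier (ell ?L) = lin_curve L1 L2 p q"
    by (simp add: carrier_ell image_image mp lin_curve_def)
  ultimately show ?thesis
    using mult_map_ell_hom[OF a L(1) m(1)] mult_map_ell_hom[OF a L(2) m(2)] per by (simp add: embeds_onto_def)
qed

text \<open>
Let the embedding be given by multiplication with \<open>p'\<close>, \<open>q'\<close>.  Since every point \<open>(p' z, q' z)\<close> is
congruent to one of the form \<open>(p w, q w)\<close>, the number \<open>(p q' - q p') z\<close> lies in the countable set
\<open>p L2 + q L1\<close> for all \<open>z\<close>, so that \<open>p q' = q p'\<close>.  Thus the two lines coincide, and injectivity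
determines the periods.
\<close>

lemma embeds_onto_lin_curve_periods:
  assumes L: "period_lattice L1" "period_lattice L2" and pq: "p \<noteq> 0 \<or> q \<noteq> 0"
    and emb: "embeds_onto L1 L2 K j (lin_curve L1 L2 p q)"
  obtains c where "c \<noteq> 0" "(*) c ` K = curve_periods L1 L2 p q"
proof -
  have K: "period_lattice K" and j: "fst \<circ> j \<in> ell_hom K L1" "snd \<circ> j \<in> ell_hom K L2"
    and inj: "inj_on j (carrier (ell K))" and im: "j ` carrier (ell K) = lin_curve L1 L2 p q"
    using emb by (auto simp: embeds_onto_def)
  note a = period_lattice_add_subgroup[OF L(1)] period_lattice_add_subgroup[OF L(2)] period_lattice_add_subgroup[OF K]
  obtain p' where p': "\<And>z. fst (j (pt K z)) = pt L1 (p' * z)" using ell_hom_mult[OF K L(1) j(1)] by (metis comp_apply)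
  obtain q' where q': "\<And>z. snd (j (pt K z)) = pt L2 (q' * z)" using ell_hom_mult[OF K L(2) j(2)] by (metis comp_apply)
  have jp: "j (pt K z) = (pt L1 (p' * z), pt L2 (q' * z))" for z using p' q' by (metis prod.collapse)
  define S where "S = (\<lambda>(x, y). p * y - q * x) ` (L1 \<times> L2)"
  have S: "countable S" unfolding S_def using L by (intro countable_image countable_SIGMA countable_period_lattice) auto
  have range: "(p * q' - q * p') * z \<in> S" for z
  proof -
    have "j (pt K z) \<in> lin_curve L1 L2 p q" using im by auto
    then obtain w where "pt L1 (p' * z) = pt L1 (p * w)" "pt L2 (q' * z) = pt L2 (q * w)"
      unfolding jp lin_curve_def by auto
    then have "p' * z - p * w \<in> L1" "q' * z - q * w \<in> L2" using a by (auto simp: pt_eq_iff)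
    then have "p * (q' * z - q * w) - q * (p' * z - p * w) \<in> S" unfolding S_def by force
    then show ?thesis by (simp add: algebra_simps)
  qed
  \<comment> \<open>A nonzero multiple of \<open>z\<close> would run through the whole uncountable plane.\<close>
  have "p * q' - q * p' = 0"
  proof (rule ccontr)
    assume ne: "p * q' - q * p' \<noteq> 0"
    have "z \<in> S" for z using range[of "z / (p * q' - q * p')"] ne by simp
    then show False using S uncountable_UNIV_complex by (metis UNIV_eq_I)
  qed
  then obtain c where c: "p' = c * p" "q' = c * q"
  proof (cases "p = 0")
    case True
    then show thesis using that[of "q' / q"] pq \<open>p * q' - q * p' = 0\<close> by auto
  next
    case False
    then show thesis using that[of "p' / p"] \<open>p * q' - q * p' = 0\<close> by (auto simp: field_simps)
  qed
  have mem: "z \<in> K \<longleftrightarrow> c * z \<in> curve_periods L1 L2 p q" for z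
  proof -
    have "z \<in> K \<longleftrightarrow> pt K z = pt K 0" using a by (simp add: pt_eq_iff)
    also have "\<dots> \<longleftrightarrow> j (pt K z) = j (pt K 0)" using inj by (simp add: inj_on_eq_iff)
    also have "\<dots> \<longleftrightarrow> p' * z \<in> L1 \<and> q' * z \<in> L2" unfolding jp using a by (simp add: pt_eq_iff)
    finally show ?thesis by (simp add: curve_periods_def c mult_ac)
  qed
  have "c \<noteq> 0"
  proof
    assume "c = 0"
    then have "z \<in> K" for z using mem[of z] mem[of 0] add_subgroup_0[OF a(3)] by simp
    then show False using period_lattice_not_UNIV[OF K] by blast
  qed
  moreover have "(*) c ` K = curve_periods L1 L2 p q"
  proof (intro equalityI subsetI)
    fix z assume "z \<in> curve_periods L1 L2 p q"
    then have "z / c \<in> K" "z = c * (z / c)" using mem[of "z / c"] \<open>c \<noteq> 0\<close> by auto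
    then show "z \<in> (*) c ` K" by blast
  qed (use mem in auto)
  ultimately show thesis by (rule that)
qed

lemma cramer_unique:
  fixes p :: "'a::field"
  assumes "p * q' - q * p' \<noteq> 0" "p * x + p' * x' = p * y + p' * y'" "q * x + q' * x' = q * y + q' * y'"
  shows "x = y" "x' = y'"
proof -
  have "(p * q' - q * p') * (x - y) = q' * ((p * x + p' * x') - (p * y + p' * y')) - p' * ((q * x + q' * x') - (q * y + q' * y'))"
    by (simp add: algebra_simps)
  then show "x = y" using assms by simp
  have "(p * q' - q * p') * (x' - y') = p * ((q * x + q' * x') - (q * y + q' * y')) - q * ((p * x + p' * x') - (p * y + p' * y'))"
    by (simp add: algebra_simps)
  then show "x' = y'" using assms by simp
qed

text \<open>
Over the plane the addition map is the linear map with columns \<open>(p, q)\<close>, \<open>(p', q')\<close>.  It is bijective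
since its determinant does not vanish, and it descends to a bijection because the products of the
lattices correspond to each other, which is \<open>sol\<close>.
\<close>

lemma decomposition_lin_curves:
  assumes L: "period_lattice L1" "period_lattice L2"
    and per: "period_lattice (curve_periods L1 L2 p q)" "period_lattice (curve_periods L1 L2 p' q')"
    and det: "p * q' - q * p' \<noteq> 0"
    and sol: "\<And>x y. x \<in> L1 \<Longrightarrow> y \<in> L2 \<Longrightarrow> \<exists>z\<in>curve_periods L1 L2 p q. \<exists>z'\<in>curve_periods L1 L2 p' q'.
      p * z + p' * z' = x \<and> q * z + q' * z' = y"
  shows "decomposition L1 L2 (lin_curve L1 L2 p q, lin_curve L1 L2 p' q')"
proof -
  note a = L[THEN period_lattice_add_subgroup]
  let ?F = "lin_curve L1 L2 p q" and ?F' = "lin_curve L1 L2 p' q'"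
  have "(\<lambda>(P, Q). P \<otimes>\<^bsub>surf L1 L2\<^esub> Q) \<in> iso ((surf L1 L2)\<lparr>carrier := ?F\<rparr> \<times>\<times> (surf L1 L2)\<lparr>carrier := ?F'\<rparr>) (surf L1 L2)"
    unfolding iso_def bij_betw_def
  proof (intro CollectI conjI)
    show "(\<lambda>(P, Q). P \<otimes>\<^bsub>surf L1 L2\<^esub> Q) \<in> hom ((surf L1 L2)\<lparr>carrier := ?F\<rparr> \<times>\<times> (surf L1 L2)\<lparr>carrier := ?F'\<rparr>) (surf L1 L2)"
      by (auto simp: hom_def lin_curve_def DirProd_def pt_mult a add_ac)
    show "inj_on (\<lambda>(P, Q). P \<otimes>\<^bsub>surf L1 L2\<^esub> Q) (carrier ((surf L1 L2)\<lparr>carrier := ?F\<rparr> \<times>\<times> (surf L1 L2)\<lparr>carrier := ?F'\<rparr>))"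
    proof (rule inj_onI)
      fix X Y
      assume "X \<in> carrier ((surf L1 L2)\<lparr>carrier := ?F\<rparr> \<times>\<times> (surf L1 L2)\<lparr>carrier := ?F'\<rparr>)"
        "Y \<in> carrier ((surf L1 L2)\<lparr>carrier := ?F\<rparr> \<times>\<times> (surf L1 L2)\<lparr>carrier := ?F'\<rparr>)"
        and eq: "(\<lambda>(P, Q). P \<otimes>\<^bsub>surf L1 L2\<^esub> Q) X = (\<lambda>(P, Q). P \<otimes>\<^bsub>surf L1 L2\<^esub> Q) Y"
      then obtain z z' w w' where X: "X = ((pt L1 (p * z), pt L2 (q * z)), (pt L1 (p' * z'), pt L2 (q' * z')))"
        and Y: "Y = ((pt L1 (p * w), pt L2 (q * w)), (pt L1 (p' * w'), pt L2 (q' * w')))"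
        by (auto simp: DirProd_def lin_curve_def)
      have "(p * z + p' * z') - (p * w + p' * w') \<in> L1" "(q * z + q' * z') - (q * w + q' * w') \<in> L2"
        using eq by (auto simp: X Y DirProd_def pt_mult a pt_eq_iff)
      from sol[OF this] obtain x x' where xx: "x \<in> curve_periods L1 L2 p q" "x' \<in> curve_periods L1 L2 p' q'"
        and "p * x + p' * x' = (p * z + p' * z') - (p * w + p' * w')" "q * x + q' * x' = (q * z + q' * z') - (q * w + q' * w')"
        by blast
      then have "p * x + p' * x' = p * (z - w) + p' * (z' - w')" "q * x + q' * x' = q * (z - w) + q' * (z' - w')"
        by (simp_all add: algebra_simps)
      from cramer_unique[OF det this] have "x = z - w" "x' = z' - w'" by auto
      then show "X = Y" using xx unfolding X Y by (simp add: curve_periods_def pt_eq_iff a right_diff_distrib)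
    qed
    show "(\<lambda>(P, Q). P \<otimes>\<^bsub>surf L1 L2\<^esub> Q) ` carrier ((surf L1 L2)\<lparr>carrier := ?F\<rparr> \<times>\<times> (surf L1 L2)\<lparr>carrier := ?F'\<rparr>) = carrier (surf L1 L2)"
    proof (intro equalityI subsetI)
      fix R assume "R \<in> (\<lambda>(P, Q). P \<otimes>\<^bsub>surf L1 L2\<^esub> Q) ` carrier ((surf L1 L2)\<lparr>carrier := ?F\<rparr> \<times>\<times> (surf L1 L2)\<lparr>carrier := ?F'\<rparr>)"
      then show "R \<in> carrier (surf L1 L2)" by (auto simp: DirProd_def lin_curve_def pt_mult a)
    next
      fix R assume "R \<in> carrier (surf L1 L2)"
      then obtain x y where R: "R = (pt L1 x, pt L2 y)" by (auto simp: DirProd_def carrier_ell)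
      define z where "z = (q' * x - p' * y) / (p * q' - q * p')"
      define z' where "z' = (p * y - q * x) / (p * q' - q * p')"
      have "p * z + p' * z' = ((p * q' - q * p') * x) / (p * q' - q * p')"
        unfolding z_def z'_def times_divide_eq_right add_divide_distrib[symmetric] by (simp add: algebra_simps)
      then have 1: "p * z + p' * z' = x" using det by simp
      have "q * z + q' * z' = ((p * q' - q * p') * y) / (p * q' - q * p')"
        unfolding z_def z'_def times_divide_eq_right add_divide_distrib[symmetric] by (simp add: algebra_simps)
      then have 2: "q * z + q' * z' = y" using det by simp
      show "R \<in> (\<lambda>(P, Q). P \<otimes>\<^bsub>surf L1 L2\<^esub> Q) ` carrier ((surf L1 L2)\<lparr>carrier := ?F\<rparr> \<times>\<times> (surf L1 L2)\<lparr>carrier := ?F'\<rparr>)"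
      proof (rule image_eqI)
        show "R = (\<lambda>(P, Q). P \<otimes>\<^bsub>surf L1 L2\<^esub> Q) ((pt L1 (p * z), pt L2 (q * z)), (pt L1 (p' * z'), pt L2 (q' * z')))"
          by (simp add: DirProd_def pt_mult a R 1 2)
      qed (auto simp: DirProd_def lin_curve_def)
    qed
  qed
  then show ?thesis unfolding decomposition_def prod.case
    using embeds_onto_lin_curve[OF a per(1)] embeds_onto_lin_curve[OF a per(2)] by blast
qed


section \<open>The moduli point of a decomposition\<close>

lemma homothetic_vimage:
  fixes c c' k :: complex
  assumes "c \<noteq> 0" "c' \<noteq> 0" "(*) c ` K = L" "(*) c' ` K' = L'"
  shows "(*) c ` {z. k * z \<in> K'} = {z. (c' * k / c) * z \<in> L'}"
proof -
  have K': "x \<in> K' \<longleftrightarrow> c' * x \<in> L'" for x using assms by auto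
  show ?thesis
  proof (intro equalityI subsetI)
    fix z assume "z \<in> {z. (c' * k / c) * z \<in> L'}"
    then have "c' * (k * (z / c)) \<in> L'" by (simp add: mult_ac)
    then have "z / c \<in> {z. k * z \<in> K'}" by (simp add: K')
    moreover have "z = c * (z / c)" using assms by simp
    ultimately show "z \<in> (*) c ` {z. k * z \<in> K'}" by blast
  next
    fix z assume "z \<in> (*) c ` {z. k * z \<in> K'}"
    then obtain x where "z = c * x" "c' * (k * x) \<in> L'" by (auto simp: K')
    then show "z \<in> {z. (c' * k / c) * z \<in> L'}" using assms by (simp add: mult_ac)
  qed
qed

lemma lattice_mult_iff: "lattice_mult c L L' \<longleftrightarrow> L \<subseteq> {z. c * z \<in> L'}"
  by (auto simp: lattice_mult_def)

text \<open>
Any other choice of embeddings replaces the two lattices by homothetic ones.  By \<open>gen\<close> every isogeny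
factors through multiplication by \<open>k\<close> followed by an integer, so that its kernel contains that of
\<open>k\<close>; hence \<open>k\<close> has minimal degree, and an isogeny of the same degree has the same kernel.
\<close>

lemma omega_lin_curves:
  assumes L: "period_lattice L1" "period_lattice L2"
    and per: "period_lattice (curve_periods L1 L2 p q)" "period_lattice (curve_periods L1 L2 p' q')"
    and det: "p * q' - q * p' \<noteq> 0"
    and sol: "\<And>x y. x \<in> L1 \<Longrightarrow> y \<in> L2 \<Longrightarrow> \<exists>z\<in>curve_periods L1 L2 p q. \<exists>z'\<in>curve_periods L1 L2 p' q'.
      p * z + p' * z' = x \<and> q * z + q' * z' = y"
    and k: "k \<noteq> 0" "lattice_mult k (curve_periods L1 L2 p q) (curve_periods L1 L2 p' q')"
    and gen: "\<And>c. lattice_mult c (curve_periods L1 L2 p q) (curve_periods L1 L2 p' q') \<Longrightarrow> \<exists>m::int. c = of_int m * k"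
    and N: "N = NS_number (prod_lattice L1 L2)" "N > 0"
    and card: "card (pt (curve_periods L1 L2 p q) ` {z. k * z \<in> curve_periods L1 L2 p' q'}) = N"
  shows "omega L1 L2 (lin_curve L1 L2 p q, lin_curve L1 L2 p' q') =
    moduli_point N (curve_periods L1 L2 p q) (pt (curve_periods L1 L2 p q) ` {z. k * z \<in> curve_periods L1 L2 p' q'})"
proof -
  define \<Lambda> where "\<Lambda> = curve_periods L1 L2 p q"
  define \<Lambda>' where "\<Lambda>' = curve_periods L1 L2 p' q'"
  note fold = \<Lambda>_def[symmetric] \<Lambda>'_def[symmetric]
  note per = per[unfolded fold] and k = k[unfolded fold] and gen = gen[unfolded fold] and card = card[unfolded fold]
  note a = L[THEN period_lattice_add_subgroup] and a\<Lambda> = per[THEN period_lattice_add_subgroup]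
  have fin: "finite (pt \<Lambda> ` {z. k * z \<in> \<Lambda>'})" using card N(2) card_ge_0_finite by blast
  have sup: "{z. k * z \<in> \<Lambda>'} \<subseteq> {z. c * z \<in> \<Lambda>'}" if "lattice_mult c \<Lambda> \<Lambda>'" for c
    using gen[OF that] a\<Lambda> by (auto simp: mult.assoc add_subgroup_of_int)
  have pq: "p \<noteq> 0 \<or> q \<noteq> 0" "p' \<noteq> 0 \<or> q' \<noteq> 0" using det by auto
  have dec: "decomposition L1 L2 (lin_curve L1 L2 p q, lin_curve L1 L2 p' q')"
    by (rule decomposition_lin_curves[OF L per[unfolded \<Lambda>_def \<Lambda>'_def] det sol])
  note emb = embeds_onto_lin_curve[OF a per(1)[unfolded \<Lambda>_def]] embeds_onto_lin_curve[OF a per(2)[unfolded \<Lambda>'_def]]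
  note f = mult_map_isogeny[OF a\<Lambda> k fin] mult_map_pt[OF a\<Lambda> k(2)]
  have degf: "isog_degree \<Lambda> \<Lambda>' (mult_map k \<Lambda>') = N"
    using kernel_mult[OF a\<Lambda> f(2)] card by (simp add: isog_degree_def)
  have min: "N \<le> isog_degree \<Lambda> \<Lambda>' g" if g: "isogeny \<Lambda> \<Lambda>' g" for g
  proof -
    obtain c where c: "lattice_mult c \<Lambda> \<Lambda>'" "\<And>z. g (pt \<Lambda> z) = pt \<Lambda>' (c * z)"
      using isogeny_mult[OF per g] by metis
    have "finite (pt \<Lambda> ` {z. c * z \<in> \<Lambda>'})" using g kernel_mult[OF a\<Lambda> c(2)] by (simp add: isogeny_def)
    then show ?thesis using card_mono[OF _ image_mono[OF sup[OF c(1)], of "pt \<Lambda>"]] card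
      by (simp add: isog_degree_def kernel_mult[OF a\<Lambda> c(2)])
  qed
  show ?thesis
    unfolding omega_def prod.case N(1)[symmetric] fold
  proof (rule the_equality)
    show "decomposition L1 L2 (lin_curve L1 L2 p q, lin_curve L1 L2 p' q') \<and>
     (\<exists>L L' j j' f. embeds_onto L1 L2 L j (lin_curve L1 L2 p q) \<and> embeds_onto L1 L2 L' j' (lin_curve L1 L2 p' q') \<and>
        isogeny L L' f \<and> isog_degree L L' f = N \<and>
        (\<forall>f'. isogeny L L' f' \<longrightarrow> isog_degree L L' f \<le> isog_degree L L' f') \<and>
        moduli_point N \<Lambda> (pt \<Lambda> ` {z. k * z \<in> \<Lambda>'}) = moduli_point N L (kernel (ell L) (ell L') f))"
    proof (intro conjI exI allI impI)
      show "embeds_onto L1 L2 \<Lambda> (\<lambda>P. (mult_map p L1 P, mult_map q L2 P)) (lin_curve L1 L2 p q)"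
        "embeds_onto L1 L2 \<Lambda>' (\<lambda>P. (mult_map p' L1 P, mult_map q' L2 P)) (lin_curve L1 L2 p' q')"
        using emb unfolding fold .
      show "isogeny \<Lambda> \<Lambda>' (mult_map k \<Lambda>')" by (rule f(1))
    qed (use dec degf min kernel_mult[OF a\<Lambda> f(2)] in auto)
    fix X assume "decomposition L1 L2 (lin_curve L1 L2 p q, lin_curve L1 L2 p' q') \<and>
     (\<exists>L L' j j' f. embeds_onto L1 L2 L j (lin_curve L1 L2 p q) \<and> embeds_onto L1 L2 L' j' (lin_curve L1 L2 p' q') \<and>
        isogeny L L' f \<and> isog_degree L L' f = N \<and>
        (\<forall>f'. isogeny L L' f' \<longrightarrow> isog_degree L L' f \<le> isog_degree L L' f') \<and>
        X = moduli_point N L (kernel (ell L) (ell L') f))"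
    then obtain K K' j j' g where j: "embeds_onto L1 L2 K j (lin_curve L1 L2 p q)"
      "embeds_onto L1 L2 K' j' (lin_curve L1 L2 p' q')" and g: "isogeny K K' g" "isog_degree K K' g = N"
      and X: "X = moduli_point N K (kernel (ell K) (ell K') g)" by blast
    have perK: "period_lattice K" "period_lattice K'" using j by (auto simp: embeds_onto_def)
    note aK = perK[THEN period_lattice_add_subgroup]
    obtain c where c: "c \<noteq> 0" "(*) c ` K = \<Lambda>"
      using embeds_onto_lin_curve_periods[OF L pq(1) j(1)] unfolding \<Lambda>_def by blast
    obtain c' where c': "c' \<noteq> 0" "(*) c' ` K' = \<Lambda>'"
      using embeds_onto_lin_curve_periods[OF L pq(2) j(2)] unfolding \<Lambda>'_def by blast
    obtain l where l: "lattice_mult l K K'" "\<And>z. g (pt K z) = pt K' (l * z)"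
      using isogeny_mult[OF perK g(1)] by metis
    define M where "M = {z. l * z \<in> K'}"
    note cM = homothetic_vimage[OF c(1) c'(1) c(2) c'(2), of l, folded M_def]
    have KM: "add_subgroup M" "K \<subseteq> M" using l(1) aK by (auto simp: M_def lattice_mult_iff add_subgroup_vimage)
    have kerg: "kernel (ell K) (ell K') g = pt K ` M" using kernel_mult[OF aK l(2)] by (simp add: M_def)
    have "lattice_mult (c' * l / c) \<Lambda> \<Lambda>'" unfolding lattice_mult_iff using cM KM(2) c(2) by blast
    from sup[OF this] have sub: "{z. k * z \<in> \<Lambda>'} \<subseteq> (*) c ` M" unfolding cM .
    \<comment> \<open>Both kernels have \<open>N\<close> elements and one contains the other.\<close>
    have "card (pt \<Lambda> ` (*) c ` M) = N"
      using card_pt_scale[OF c(1), of K M] g(2) kerg c(2) by (simp add: isog_degree_def)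
    then have "pt \<Lambda> ` {z. k * z \<in> \<Lambda>'} = pt \<Lambda> ` (*) c ` M"
      using card image_mono[OF sub, of "pt \<Lambda>"] N(2) by (metis card_ge_0_finite card_subset_eq)
    then have "{z. k * z \<in> \<Lambda>'} = (*) c ` M"
    proof -
      assume eq: "pt \<Lambda> ` {z. k * z \<in> \<Lambda>'} = pt \<Lambda> ` (*) c ` M"
      have "add_subgroup ((*) c ` M)" unfolding cM by (rule add_subgroup_vimage[OF a\<Lambda>(2)])
      moreover have "\<Lambda> \<subseteq> (*) c ` M" using KM(2) c(2) by blast
      moreover have "add_subgroup {z. k * z \<in> \<Lambda>'}" by (rule add_subgroup_vimage[OF a\<Lambda>(2)])
      moreover have "\<Lambda> \<subseteq> {z. k * z \<in> \<Lambda>'}" using k(2) by (simp add: lattice_mult_iff)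
      ultimately show ?thesis using Union_pt_image[OF a\<Lambda>(1)] eq by metis
    qed
    then have "homothetic K M \<Lambda> {z. k * z \<in> \<Lambda>'}" using c unfolding homothetic_def by blast
    then show "X = moduli_point N \<Lambda> (pt \<Lambda> ` {z. k * z \<in> \<Lambda>'})" unfolding X kerg
      using k(2) a\<Lambda> by (intro moduli_point_homothetic[OF N(2) perK(1) per(1) KM]) (auto simp: lattice_mult_iff add_subgroup_vimage)
  qed
qed

lemma omega_std:
  assumes L: "period_lattice L1" "period_lattice L2"
    and k: "k \<noteq> 0" "lattice_mult k L1 L2" and gen: "\<And>c. lattice_mult c L1 L2 \<Longrightarrow> \<exists>m::int. c = of_int m * k"
    and N: "N = NS_number (prod_lattice L1 L2)" "N > 0" and card: "card (pt L1 ` {z. k * z \<in> L2}) = N"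
  shows "omega L1 L2 (std_decomposition L1 L2) = moduli_point N L1 (pt L1 ` {z. k * z \<in> L2})"
proof -
  note a = L[THEN period_lattice_add_subgroup]
  have per: "curve_periods L1 L2 1 0 = L1" "curve_periods L1 L2 0 1 = L2"
    using add_subgroup_0[OF a(1)] add_subgroup_0[OF a(2)] by (auto simp: curve_periods_def)
  have "std_decomposition L1 L2 = (lin_curve L1 L2 1 0, lin_curve L1 L2 0 1)"
    by (auto simp: std_decomposition_def lin_curve_def carrier_ell one_ell pt_0 a)
  then show ?thesis
    using omega_lin_curves[OF L, of 1 0 0 1 k N, unfolded per, OF L _ _ k gen N card] by auto
qed

text \<open>
Multipliers between the lattices in the middle also map \<open>\<int>u + \<int>v\<close> into \<open>\<int>u/N + \<int>v\<close>.  The image of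
\<open>u/r\<close> then shows divisibility by \<open>r\<close>.
\<close>

lemma lattice_mult_intermediate:
  assumes im: "Im (v / u) \<noteq> 0" and cop: "coprime r s" and pos: "r * s > 0"
    and gen: "\<And>c. lattice_mult c (lat u v) (lat (u / of_nat (r * s)) v) \<Longrightarrow> \<exists>m::int. c = of_int m"
    and c: "lattice_mult c (lat (u / of_nat r) v) (lat (u / of_nat s) v)"
  shows "\<exists>m::int. c = of_int m * of_nat r"
proof -
  have "lattice_mult c (lat u v) (lat (u / of_nat (r * s)) v)"
    using c lat_subset_lat_divide[of r u v] lat_divide_dvd[of s "r * s" u v] pos
    unfolding lattice_mult_def by (metis dvd_triv_right mult_pos_pos nat_0_less_mult_iff subsetD)
  then obtain m where m: "c = of_int m" using gen by blast
  have "c * (u / of_nat r) \<in> lat (u / of_nat s) v" using c lat_basis_mem(1) unfolding lattice_mult_def by blast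
  then obtain x y where xy: "c * (u / of_nat r) = of_int x * (u / of_nat s) + of_int y * v" by (rule latE)
  have "of_int (int s * m) * (u / of_nat r) + of_int 0 * v = of_nat s * (c * (u / of_nat r))" by (simp add: m)
  also have "\<dots> = of_int x * u + of_int (int s * y) * v" unfolding xy using pos by (simp add: field_simps)
  finally have "of_int (int s * m) * (u / of_nat r) + of_int 0 * v \<in> lat u v" by (rule latI)
  then have "int r dvd int s * m" using mult_mem_lat_iff[OF im] pos by (metis nat_0_less_mult_iff)
  then have "int r dvd m" using cop by (simp add: coprime_dvd_mult_right_iff)
  then obtain t where "m = int r * t" by (auto elim: dvdE)
  then show ?thesis using m by (intro exI[of _ t]) simp
qed

text \<open>
The inverse of the matrix with columns \<open>(r, - c)\<close>, \<open>(b s, a c)\<close> is explicit, as its determinant is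
\<open>c (a r + b s) = c\<close>.  Writing the second component of a point of \<open>L1 \<times> L2\<close> as \<open>c w\<close>, the preimage of
\<open>(x, c w)\<close> is \<open>(a x - b s w, x + r w)\<close>.  The two claims use the isogenies given by \<open>r\<close> and by \<open>s\<close>.
\<close>

lemma omega_sigma:
  assumes L: "period_lattice L1" "period_lattice L2"
    and im: "Im (v / u) \<noteq> 0" and cop: "coprime r s" and pos: "r * s > 0"
    and N: "r * s = NS_number (prod_lattice L1 L2)"
    and L1: "L1 = lat u v" and c: "c \<noteq> 0" and M: "{z. c * z \<in> L2} = lat (u / of_nat (r * s)) v"
    and gen: "\<And>c. lattice_mult c (lat u v) (lat (u / of_nat (r * s)) v) \<Longrightarrow> \<exists>m::int. c = of_int m"
    and ab: "a * int r + b * int s = 1"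
  shows "omega L1 L2 (lin_curve L1 L2 (of_nat r) (- c), lin_curve L1 L2 (of_int b * of_nat s) (of_int a * c)) =
      moduli_point (r * s) (lat (u / of_nat r) v) (pt (lat (u / of_nat r) v) ` lat (u / of_nat (r * s)) (v / of_nat r))" (is ?thesis1)
    and "omega L1 L2 (lin_curve L1 L2 (of_int b * of_nat s) (of_int a * c), lin_curve L1 L2 (of_nat r) (- c)) =
      moduli_point (r * s) (lat (u / of_nat s) v) (pt (lat (u / of_nat s) v) ` lat (u / of_nat (r * s)) (v / of_nat s))" (is ?thesis2)
proof -
  note a = L[THEN period_lattice_add_subgroup]
  have r: "r > 0" and s: "s > 0" using pos by auto
  let ?A = "of_nat r :: complex" and ?B = "of_int b * of_nat s :: complex" and ?C = "of_int a * c"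
  let ?M = "lat (u / of_nat (r * s)) v"
  have cM: "c * z \<in> L2 \<longleftrightarrow> z \<in> ?M" for z using M by blast
  have L1M: "z \<in> L1 \<Longrightarrow> z \<in> ?M" for z using lat_subset_lat_divide[OF pos] L1 by auto
  have NM: "of_nat (r * s) * z \<in> L1" if "z \<in> ?M" for z
    using that al_sub_lat[OF im, of "r * s" 1] pos by (auto simp: al_sub_def L1)
  have ab': "of_int a * of_nat r + of_int b * of_nat s = (1::complex)"
    using arg_cong[OF ab, of "of_int :: int \<Rightarrow> complex"] by simp
  have Mr: "lat (u / of_nat r) v = {z \<in> ?M. of_nat r * z \<in> L1}"
    using al_sub_lat[OF im pos] by (simp add: al_sub_def L1)
  have Ms: "lat (u / of_nat s) v = {z \<in> ?M. of_nat s * z \<in> L1}"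
    using al_sub_lat[OF im, of s r] pos by (simp add: al_sub_def L1 mult.commute)
  have per1: "curve_periods L1 L2 ?A (- c) = lat (u / of_nat r) v"
  proof -
    have "- c * z \<in> L2 \<longleftrightarrow> z \<in> ?M" for z using cM[of "- z"] add_subgroup_minus[OF add_subgroup_lat] by force
    then show ?thesis unfolding Mr curve_periods_def by auto
  qed
  have per2: "curve_periods L1 L2 ?B ?C = lat (u / of_nat s) v"
  proof (intro equalityI subsetI)
    fix z assume "z \<in> lat (u / of_nat s) v"
    then have "z \<in> ?M" "of_nat s * z \<in> L1" by (auto simp: Ms)
    then have "of_int b * (of_nat s * z) \<in> L1" "of_int a * z \<in> ?M" by (auto intro: add_subgroup_of_int a add_subgroup_lat)
    then show "z \<in> curve_periods L1 L2 ?B ?C" using cM[of "of_int a * z"] by (simp add: curve_periods_def mult_ac)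
  next
    fix z assume "z \<in> curve_periods L1 L2 ?B ?C"
    then have z: "?B * z \<in> L1" "of_int a * z \<in> ?M" using cM[of "of_int a * z"] by (auto simp: curve_periods_def mult_ac)
    have "of_int a * of_nat r * z + ?B * z = (of_int a * of_nat r + ?B) * z" by (rule distrib_right[symmetric])
    then have 1: "z = of_nat r * (of_int a * z) + ?B * z" unfolding ab' by (simp add: mult_ac)
    then have "z \<in> ?M" using z by (metis add_subgroup_add add_subgroup_lat add_subgroup_of_nat L1M)
    have "of_nat s * z = of_nat s * (of_nat r * (of_int a * z) + ?B * z)" using 1 by simp
    also have "\<dots> = of_nat (r * s) * (of_int a * z) + of_nat s * (?B * z)" by (simp add: algebra_simps)
    finally have "of_nat s * z \<in> L1" using NM[OF z(2)] z(1) by (metis a(1) add_subgroup_add add_subgroup_of_nat)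
    then show "z \<in> lat (u / of_nat s) v" using \<open>z \<in> ?M\<close> by (simp add: Ms)
  qed
  have perl: "period_lattice (lat (u / of_nat n) v)" if "n > 0" for n
    using that im by (intro period_lattice_lat) (simp only: Im_div_divide, simp)
  have sol: "\<exists>z\<in>lat (u / of_nat r) v. \<exists>z'\<in>lat (u / of_nat s) v. ?A * z + ?B * z' = x \<and> - c * z + ?C * z' = y"
    if xy: "x \<in> L1" "y \<in> L2" for x y
  proof -
    define w where "w = y / c"
    have w: "w \<in> ?M" "y = c * w" using xy(2) cM[of w] c by (auto simp: w_def)
    have w': "of_nat (r * s) * w \<in> L1" using NM[OF w(1)] .
    define z where "z = of_int a * x - ?B * w"
    define z' where "z' = x + of_nat r * w"
    have "z \<in> ?M" unfolding z_def mult.assoc using L1M[OF xy(1)] w(1)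
      by (intro add_subgroup_diff add_subgroup_of_int add_subgroup_of_nat add_subgroup_lat)
    moreover have "of_nat r * z = of_nat r * (of_int a * x) - of_int b * (of_nat (r * s) * w)"
      by (simp add: z_def algebra_simps)
    then have "of_nat r * z \<in> L1" using add_subgroup_diff[OF a(1) add_subgroup_of_nat[OF a(1) add_subgroup_of_int[OF a(1) xy(1)]] add_subgroup_of_int[OF a(1) w']]
      by metis
    ultimately have 1: "z \<in> lat (u / of_nat r) v" by (simp add: Mr)
    have "z' \<in> ?M" unfolding z'_def using L1M[OF xy(1)] w(1)
      by (intro add_subgroup_add add_subgroup_of_int add_subgroup_of_nat add_subgroup_lat)
    moreover have "of_nat s * z' = of_nat s * x + of_nat (r * s) * w" by (simp add: z'_def algebra_simps)
    then have "of_nat s * z' \<in> L1" using add_subgroup_add[OF a(1) add_subgroup_of_nat[OF a(1) xy(1)] w'] by metis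
    ultimately have 2: "z' \<in> lat (u / of_nat s) v" by (simp add: Ms)
    have "?A * z + ?B * z' = (of_int a * of_nat r + ?B) * x" by (simp add: z_def z'_def algebra_simps)
    moreover have "- c * z + ?C * z' = c * ((of_int a * of_nat r + ?B) * w)" by (simp add: z_def z'_def algebra_simps)
    ultimately show ?thesis using 1 2 unfolding ab' w(2) by auto
  qed
  have det: "?A * ?C - (- c) * ?B \<noteq> 0"
  proof -
    have "?A * ?C - (- c) * ?B = c * (of_int a * of_nat r + ?B)" by (simp add: algebra_simps)
    then show ?thesis unfolding ab' using c by simp
  qed
  have main: "{z. of_nat m * z \<in> lat (u / of_nat n) v} = lat (u / of_nat (r * s)) (v / of_nat m)"
    "card (pt (lat (u / of_nat m) v) ` lat (u / of_nat (r * s)) (v / of_nat m)) = r * s"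
    "lattice_mult (of_nat m) (lat (u / of_nat m) v) (lat (u / of_nat n) v)" if mn: "coprime m n" "m * n = r * s" for m n
  proof -
    have m: "m > 0" "n > 0" "m * n > 0" using mn pos by (metis nat_0_less_mult_iff)+
    have "of_nat m * z \<in> lat (u / of_nat n) v \<longleftrightarrow> z \<in> lat (u / of_nat n / of_nat m) (v / of_nat m)" for z
      by (rule lat_multiple[OF m(1)])
    then show "{z. of_nat m * z \<in> lat (u / of_nat n) v} = lat (u / of_nat (r * s)) (v / of_nat m)"
      unfolding mn(2)[symmetric] by (simp add: mult.commute)
    have "Im (v / (u / of_nat m)) \<noteq> 0" using im m unfolding Im_div_divide by simp
    from level_basis[OF this mn(1) m(3)] obtain u' v' where "Im (v' / u') > 0" "lat (u / of_nat m) v = lat u' v'"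
      "lat (u / of_nat m / of_nat n) (v / of_nat m) = lat (u' / of_nat (m * n)) v'" by metis
    then show "card (pt (lat (u / of_nat m) v) ` lat (u / of_nat (r * s)) (v / of_nat m)) = r * s"
      using card_pt_lat[of v' u' "m * n"] m(3) unfolding mn(2)[symmetric] by simp
    have "of_nat m * (u / of_nat m) \<in> lat (u / of_nat n) v" "of_nat m * v \<in> lat (u / of_nat n) v"
      using lat_subset_lat_divide[OF m(2), of u v] m by (auto simp: add_subgroup_of_nat add_subgroup_lat)
    then show "lattice_mult (of_nat m) (lat (u / of_nat m) v) (lat (u / of_nat n) v)"
      by (simp add: lattice_mult_lat add_subgroup_lat)
  qed
  have rs: "coprime r s" "r * s = r * s" and sr: "coprime s r" "s * r = r * s" using cop by (auto simp: coprime_commute mult.commute)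
  have r0: "(of_nat r :: complex) \<noteq> 0" and s0: "(of_nat s :: complex) \<noteq> 0" using r s by auto
  show ?thesis1
    using omega_lin_curves[OF L, of ?A "- c" ?B ?C "of_nat r" "r * s", unfolded per1 per2 main(1)[OF rs],
        OF perl[OF r] perl[OF s] det sol r0 main(3)[OF rs] lattice_mult_intermediate[OF im cop pos gen] N pos main(2)[OF rs]]
    by blast
  have "?B * (- c) - ?C * ?A = - (?A * ?C - (- c) * ?B)" by (simp add: algebra_simps)
  then have det': "?B * (- c) - ?C * ?A \<noteq> 0" using det by (simp only: neg_equal_0_iff_equal not_False_eq_True)
  have sol': "\<exists>z\<in>lat (u / of_nat s) v. \<exists>z'\<in>lat (u / of_nat r) v. ?B * z + ?A * z' = x \<and> ?C * z + - c * z' = y"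
    if "x \<in> L1" "y \<in> L2" for x y using sol[OF that] by (metis add.commute)
  have pos': "s * r > 0" using pos by (simp add: mult.commute)
  show ?thesis2
    using omega_lin_curves[OF L, of ?B ?C ?A "- c" "of_nat s" "r * s", unfolded per1 per2 main(1)[OF sr],
        OF perl[OF s] perl[OF r] det' sol' s0 main(3)[OF sr] lattice_mult_intermediate[OF im sr(1) pos'] N pos main(2)[OF sr]] gen
    unfolding sr(2) by blast
qed


section \<open>The Neron--Severi group and multipliers\<close>

lemma int_comb_diff: "int_comb c bs - int_comb d bs = int_comb (\<lambda>i. c i - d i) bs"
  by (simp add: int_comb_def sum_subtractf scaleR_left_diff_distrib)

lemma int_comb_cong: "(\<And>i. i < length bs \<Longrightarrow> c i = d i) \<Longrightarrow> int_comb c bs = int_comb d bs"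
  by (simp add: int_comb_def)

lemma int_comb_scale: "int_comb (\<lambda>i. k * c i) bs = of_int k *\<^sub>R int_comb c bs"
  by (simp add: int_comb_def scaleR_sum_right)

text \<open>
Modulo \<open>2\<close>: the sums of the \<open>2 ^ length bs'\<close> subsets of \<open>bs'\<close> are pairwise incongruent modulo \<open>2 M\<close>, and
the parities of the coordinates with respect to \<open>bs\<close> distinguish at most \<open>2 ^ length bs\<close> classes.
\<close>

lemma int_basis_length_le:
  assumes b: "int_basis bs M" and b': "int_basis bs' M"
  shows "length bs' \<le> length bs"
proof -
  define ind :: "nat set \<Rightarrow> nat \<Rightarrow> int" where "ind S i = (if i \<in> S then 1 else 0)" for S i
  have "\<exists>c. int_comb (ind S) bs' = int_comb c bs" for S
  proof -
    have "int_comb (ind S) bs' \<in> M" using b' unfolding int_basis_def by blast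
    then show ?thesis using b unfolding int_basis_def by blast
  qed
  then obtain c where c: "\<And>S. int_comb (ind S) bs' = int_comb (c S) bs" by metis
  \<comment> \<open>The parity vector of the coordinates of the subset sum.\<close>
  define F where "F S = {i. i < length bs \<and> odd (c S i)}" for S
  have "inj_on F (Pow {..<length bs'})"
  proof (rule inj_onI)
    fix S T assume ST: "S \<in> Pow {..<length bs'}" "T \<in> Pow {..<length bs'}" and FF: "F S = F T"
    define e where "e i = (c S i - c T i) div 2" for i
    have e: "c S i - c T i = 2 * e i" if "i < length bs" for i
    proof -
      have "even (c S i) \<longleftrightarrow> even (c T i)" using FF that by (auto simp: F_def)
      then show ?thesis by (simp add: e_def)
    qed
    have "int_comb e bs \<in> M" using b unfolding int_basis_def by blast
    then obtain e' where e': "int_comb e bs = int_comb e' bs'" using b' unfolding int_basis_def by blast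
    have "int_comb (\<lambda>i. ind S i - ind T i) bs' = int_comb (\<lambda>i. c S i - c T i) bs"
      by (simp add: int_comb_diff[symmetric] c)
    also have "\<dots> = int_comb (\<lambda>i. 2 * e i) bs" using e by (rule int_comb_cong)
    also have "\<dots> = int_comb (\<lambda>i. 2 * e' i) bs'" unfolding int_comb_scale e' ..
    finally have "int_comb (\<lambda>i. ind S i - ind T i - 2 * e' i) bs' = 0" by (simp add: int_comb_diff[symmetric])
    then have z: "ind S i - ind T i - 2 * e' i = 0" if "i < length bs'" for i
      using b' that unfolding int_basis_def by blast
    have "i \<in> S \<longleftrightarrow> i \<in> T" if "i < length bs'" for i
    proof -
      have "even (ind S i - ind T i)" using z[OF that] by presburger
      then show ?thesis by (auto simp: ind_def split: if_splits)
    qed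
    then show "S = T" using ST by blast
  qed
  moreover have "F ` Pow {..<length bs'} \<subseteq> Pow {..<length bs}" by (auto simp: F_def)
  ultimately have "card (Pow {..<length bs'}) \<le> card (Pow {..<length bs})" by (intro card_inj_on_le) auto
  then show ?thesis by (simp add: card_Pow)
qed

lemma picard_number_eq:
  assumes "int_basis bs (NS L)"
  shows "picard_number L = length bs"
  unfolding picard_number_def using assms int_basis_length_le by (intro the_equality) (auto intro: le_antisym)

text \<open>
Divided by its value on the basis, the alternating form \<open>Im (x * cnj y)\<close> becomes unimodular on the
lattice.
\<close>

lemma lattice_dual:
  assumes im: "Im (v / u) \<noteq> 0"
  shows "(\<forall>y\<in>lat u v. Im (w * cnj y) \<in> \<int>) \<longleftrightarrow> of_real (Im (v * cnj u)) * w \<in> lat u v"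
proof -
  define V where "V = Im (v * cnj u)"
  obtain p q where w: "w = of_real p * u + of_real q * v" using real_coords_exist[OF im] .
  have wu: "Im (w * cnj u) = q * V" and wv: "Im (w * cnj v) = - (p * V)" by (simp_all add: w V_def algebra_simps)
  have "(\<forall>y\<in>lat u v. Im (w * cnj y) \<in> \<int>) \<longleftrightarrow> Im (w * cnj u) \<in> \<int> \<and> Im (w * cnj v) \<in> \<int>"
  proof (intro iffI ballI)
    fix y assume *: "Im (w * cnj u) \<in> \<int> \<and> Im (w * cnj v) \<in> \<int>" and "y \<in> lat u v"
    then obtain m n where "y = of_int m * u + of_int n * v" by (auto elim: latE)
    then have "Im (w * cnj y) = of_int m * Im (w * cnj u) + of_int n * Im (w * cnj v)" by (simp add: algebra_simps)
    then show "Im (w * cnj y) \<in> \<int>" using * by (metis Ints_add Ints_mult Ints_of_int)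
  qed (use lat_basis_mem in blast)
  also have "\<dots> \<longleftrightarrow> p * V \<in> \<int> \<and> q * V \<in> \<int>" unfolding wu wv by (auto simp: minus_in_Ints_iff)
  also have "\<dots> \<longleftrightarrow> of_real (p * V) * u + of_real (q * V) * v \<in> lat u v" unfolding real_coords_mem_lat_iff[OF im] ..
  also have "of_real (p * V) * u + of_real (q * V) * v = of_real V * w" by (simp add: w algebra_simps)
  finally show ?thesis unfolding V_def .
qed

lemma real_lattice_mult:
  assumes im: "Im (v / u) \<noteq> 0"
  shows "lattice_mult (of_real t) (lat u v) (lat u v) \<longleftrightarrow> t \<in> \<int>"
  using real_coords_mem_lat_iff[OF im, of t 0] real_coords_mem_lat_iff[OF im, of 0 t]
  by (simp add: lattice_mult_lat add_subgroup_lat)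

lemma im_herm_expand:
  "im_herm h x y = Im (h $ 1 $ 1 * x $ 1 * cnj (y $ 1)) + Im (h $ 1 $ 2 * x $ 1 * cnj (y $ 2))
     + Im (h $ 2 $ 1 * x $ 2 * cnj (y $ 1)) + Im (h $ 2 $ 2 * x $ 2 * cnj (y $ 2))"
  unfolding im_herm_def herm_def sum_2 by (simp only: plus_complex.sel add.assoc)

text \<open>
The Neron--Severi group of a product: two integers for the diagonal entries, and a homomorphism
between the factors for the entry off the diagonal.  The duality \<open>lattice_dual\<close> turns the integrality
of each entry into a condition on multipliers.
\<close>

lemma NS_prod_iff:
  assumes im: "Im (v1 / u1) \<noteq> 0" "Im (v2 / u2) \<noteq> 0"
  defines "V1 \<equiv> Im (v1 * cnj u1)" and "V2 \<equiv> Im (v2 * cnj u2)"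
  shows "h \<in> NS (prod_lattice (lat u1 v1) (lat u2 v2)) \<longleftrightarrow>
    (\<exists>s t w. h $ 1 $ 1 = of_real s \<and> h $ 2 $ 2 = of_real t \<and> h $ 1 $ 2 = w \<and> h $ 2 $ 1 = cnj w \<and>
      V1 * s \<in> \<int> \<and> V2 * t \<in> \<int> \<and> lattice_mult (of_real V2 * w) (lat u1 v1) (lat u2 v2))"
proof -
  let ?L1 = "lat u1 v1" and ?L2 = "lat u2 v2"
  have herm: "(\<forall>i j. h $ i $ j = cnj (h $ j $ i)) \<longleftrightarrow>
    (\<exists>s t w. h $ 1 $ 1 = of_real s \<and> h $ 2 $ 2 = of_real t \<and> h $ 1 $ 2 = w \<and> h $ 2 $ 1 = cnj w)"
    by (auto simp: forall_2 complex_eq_iff)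
  have cond: "(\<forall>x\<in>prod_lattice ?L1 ?L2. \<forall>y\<in>prod_lattice ?L1 ?L2. im_herm h x y \<in> \<int>) \<longleftrightarrow>
      V1 * s \<in> \<int> \<and> V2 * t \<in> \<int> \<and> lattice_mult (of_real V2 * w) ?L1 ?L2"
    if h: "h $ 1 $ 1 = of_real s" "h $ 2 $ 2 = of_real t" "h $ 1 $ 2 = w" "h $ 2 $ 1 = cnj w" for s t w
  proof -
    have flip: "Im (cnj w * x * cnj y) = - Im (w * y * cnj x)" for x y by (simp add: algebra_simps)
    have ex: "im_herm h x y = Im (of_real s * x $ 1 * cnj (y $ 1)) + Im (w * x $ 1 * cnj (y $ 2))
     - Im (w * y $ 1 * cnj (x $ 2)) + Im (of_real t * x $ 2 * cnj (y $ 2))" for x y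
      unfolding im_herm_expand h flip by simp
    have "(\<forall>x\<in>prod_lattice ?L1 ?L2. \<forall>y\<in>prod_lattice ?L1 ?L2. im_herm h x y \<in> \<int>) \<longleftrightarrow>
      (\<forall>x\<in>?L1. \<forall>y\<in>?L1. Im (of_real s * x * cnj y) \<in> \<int>) \<and> (\<forall>x\<in>?L2. \<forall>y\<in>?L2. Im (of_real t * x * cnj y) \<in> \<int>) \<and>
      (\<forall>x\<in>?L1. \<forall>y\<in>?L2. Im (w * x * cnj y) \<in> \<int>)" (is "?P \<longleftrightarrow> ?Q1 \<and> ?Q2 \<and> ?Q3")
    proof
      assume P: ?P
      have 0: "0 \<in> ?L1" "0 \<in> ?L2" by (simp_all add: add_subgroup_0 add_subgroup_lat)
      have P': "im_herm h (vector [a, b]) (vector [c, d]) \<in> \<int>" if "a \<in> ?L1" "b \<in> ?L2" "c \<in> ?L1" "d \<in> ?L2" for a b c d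
        using P that by (simp add: prod_lattice_def)
      have ?Q1 using P'[OF _ 0(2) _ 0(2)] by (simp add: ex del: times_complex.sel)
      moreover have ?Q2 using P'[OF 0(1) _ 0(1)] by (simp add: ex del: times_complex.sel)
      moreover have ?Q3 using P'[OF _ 0(2) 0(1)] by (simp add: ex del: times_complex.sel)
      ultimately show "?Q1 \<and> ?Q2 \<and> ?Q3" by blast
    next
      assume "?Q1 \<and> ?Q2 \<and> ?Q3"
      then show ?P unfolding ex by (auto simp: prod_lattice_def simp del: times_complex.sel intro!: Ints_add Ints_diff)
    qed
    also have "?Q1 \<longleftrightarrow> lattice_mult (of_real (V1 * s)) ?L1 ?L1"
      using lattice_dual[OF im(1), of "of_real s * _"] by (simp add: lattice_mult_def V1_def mult.assoc)
    also have "?Q2 \<longleftrightarrow> lattice_mult (of_real (V2 * t)) ?L2 ?L2"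
      using lattice_dual[OF im(2), of "of_real t * _"] by (simp add: lattice_mult_def V2_def mult.assoc)
    also have "?Q3 \<longleftrightarrow> lattice_mult (of_real V2 * w) ?L1 ?L2"
      using lattice_dual[OF im(2), of "w * _"] by (simp add: lattice_mult_def V2_def mult.assoc)
    finally show ?thesis unfolding real_lattice_mult[OF im(1)] real_lattice_mult[OF im(2)] .
  qed
  show ?thesis unfolding NS_def mem_Collect_eq herm using cond by blast
qed

definition herm_mat :: "real \<Rightarrow> complex \<Rightarrow> real \<Rightarrow> complex^2^2" where
  "herm_mat s w t = vector [vector [of_real s, w], vector [cnj w, of_real t]]"

lemma herm_mat_nth [simp]:
  "herm_mat s w t $ 1 $ 1 = of_real s" "herm_mat s w t $ 1 $ 2 = w"
  "herm_mat s w t $ 2 $ 1 = cnj w" "herm_mat s w t $ 2 $ 2 = of_real t"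
  by (simp_all add: herm_mat_def)

text \<open>
The case of two independent homomorphisms \<open>g1\<close>, \<open>g2\<close>, to be excluded by Picard number \<open>3\<close>.
\<close>

lemma picard_number_eq_4:
  assumes im: "Im (v1 / u1) \<noteq> 0" "Im (v2 / u2) \<noteq> 0" and g: "Im (g2 / g1) \<noteq> 0"
    and hom: "{c. lattice_mult c (lat u1 v1) (lat u2 v2)} = lat g1 g2"
  shows "picard_number (prod_lattice (lat u1 v1) (lat u2 v2)) = 4"
proof -
  define V1 V2 where "V1 = Im (v1 * cnj u1)" and "V2 = Im (v2 * cnj u2)"
  have V: "V1 \<noteq> 0" "V2 \<noteq> 0" using im Im_div_nonzero_iff by (auto simp: V1_def V2_def)
  let ?bs = "[herm_mat (1 / V1) 0 0, herm_mat 0 0 (1 / V2), herm_mat 0 (g1 / of_real V2) 0, herm_mat 0 (g2 / of_real V2) 0]"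
  have comb: "int_comb c ?bs =
    herm_mat (of_int (c 0) / V1) ((of_int (c 2) * g1 + of_int (c 3) * g2) / of_real V2) (of_int (c 1) / V2)" for c
    by (simp add: int_comb_def vec_eq_iff forall_2 eval_nat_numeral lessThan_Suc add_divide_distrib scaleR_conv_of_real[where 'a = complex])
  have "int_basis ?bs (NS (prod_lattice (lat u1 v1) (lat u2 v2)))"
    unfolding int_basis_def
  proof (intro conjI allI impI equalityI subsetI)
    fix h assume "h \<in> NS (prod_lattice (lat u1 v1) (lat u2 v2))"
    then obtain s t w where h: "h $ 1 $ 1 = of_real s" "h $ 2 $ 2 = of_real t" "h $ 1 $ 2 = w" "h $ 2 $ 1 = cnj w"
      and st: "V1 * s \<in> \<int>" "V2 * t \<in> \<int>" and w: "lattice_mult (of_real V2 * w) (lat u1 v1) (lat u2 v2)"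
      unfolding NS_prod_iff[OF im] V1_def V2_def by blast
    obtain m n where mn: "V1 * s = of_int m" "V2 * t = of_int n" using st by (auto elim!: Ints_cases)
    have "of_real V2 * w \<in> lat g1 g2" using w hom by blast
    then obtain k l where kl: "of_real V2 * w = of_int k * g1 + of_int l * g2" by (rule latE)
    have "h = int_comb (nth [m, n, k, l]) ?bs"
      unfolding comb using h V mn[symmetric] kl[symmetric]
      by (simp add: vec_eq_iff forall_2 numeral_2_eq_2 numeral_3_eq_3)
    then show "h \<in> range (\<lambda>c. int_comb c ?bs)" by blast
  next
    fix h assume "h \<in> range (\<lambda>c. int_comb c ?bs)"
    then obtain c where c: "h = int_comb c ?bs" by blast
    have "of_int (c 2) * g1 + of_int (c 3) * g2 \<in> {c. lattice_mult c (lat u1 v1) (lat u2 v2)}" unfolding hom by blast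
    then show "h \<in> NS (prod_lattice (lat u1 v1) (lat u2 v2))"
      unfolding NS_prod_iff[OF im] c comb V1_def[symmetric] V2_def[symmetric] using V
      by (intro exI[of _ "of_int (c 0) / V1"] exI[of _ "of_int (c 1) / V2"]) simp
  next
    fix c i assume c: "int_comb c ?bs = 0" and i: "i < length ?bs"
    have e: "herm_mat (of_int (c 0) / V1) ((of_int (c 2) * g1 + of_int (c 3) * g2) / of_real V2) (of_int (c 1) / V2) $ a $ b = 0" for a b
      using c unfolding comb by simp
    have "c 0 = 0" "c 1 = 0" using e[of 1 1] e[of 2 2] V by simp_all
    moreover have "of_real (of_int (c 2)) * g1 + of_real (of_int (c 3)) * g2 = of_real 0 * g1 + of_real 0 * g2" using e[of 1 2] V by simp
    from real_coords_unique[OF g this] have "c 2 = 0" "c 3 = 0" by simp_all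
    ultimately show "c i = 0" using i by (auto simp: less_Suc_eq eval_nat_numeral)
  qed
  from picard_number_eq[OF this] show ?thesis by simp
qed

text \<open>
Only \<open>u\<close> is divided: in the larger lattice the coefficients of \<open>v\<close> are still integers.
\<close>

lemma lattice_mult_real_imp_int:
  assumes im: "Im (v / u) \<noteq> 0" and t: "lattice_mult (of_real t) (lat u v) (lat (u / of_nat n) v)" and n: "n > 0"
  shows "t \<in> \<int>"
proof -
  have "of_real t * v \<in> lat (u / of_nat n) v" using t by (simp add: lattice_mult_lat add_subgroup_lat)
  then have "of_real 0 * (u / of_nat n) + of_real t * v \<in> lat (u / of_nat n) v" by simp
  then show ?thesis using real_coords_mem_lat_iff[of v "u / of_nat n" 0 t] im n unfolding Im_div_divide by simp
qed

lemma lattice_mult_diff: "add_subgroup M \<Longrightarrow> lattice_mult c L M \<Longrightarrow> lattice_mult d L M \<Longrightarrow> lattice_mult (c - d) L M"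
  by (simp add: lattice_mult_def left_diff_distrib add_subgroup_diff)

text \<open>
Sending a multiplier \<open>c\<close> to the coefficient of \<open>v\<close> in \<open>c u\<close> is a homomorphism to the integers, whose
kernel consists of real multipliers, hence of integers.  If there are multipliers that are not real,
then one of them, \<open>g\<close>, has the least positive value \<open>d\<close>, and together with \<open>1\<close> it generates all
multipliers.
\<close>

lemma lattice_mult_dichotomy:
  assumes im: "Im (v / u) \<noteq> 0" and n: "n > 0"
  defines "H \<equiv> {c. lattice_mult c (lat u v) (lat (u / of_nat n) v)}"
  shows "H \<subseteq> range of_int \<or> (\<exists>g. Im g \<noteq> 0 \<and> H = lat 1 g)"
proof (cases "H \<subseteq> \<real>")
  case True
  have "c \<in> range of_int" if "c \<in> H" for c
  proof -
    have "c \<in> \<real>" using True that by blast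
    then obtain t where t: "c = of_real t" by (rule Reals_cases)
    then have "t \<in> \<int>" using that lattice_mult_real_imp_int[OF im _ n] by (auto simp: H_def)
    then show ?thesis unfolding t by (auto elim: Ints_cases)
  qed
  then show ?thesis by blast
next
  case False
  let ?M = "lat (u / of_nat n) v"
  have im': "Im (v / (u / of_nat n)) \<noteq> 0" using im n unfolding Im_div_divide by simp
  have u0: "u \<noteq> 0" using im by auto
  have H0: "add_subgroup H" unfolding add_subgroup_iff H_def
    by (auto intro: lattice_mult_diff add_subgroup_lat) (simp add: lattice_mult_def add_subgroup_0 add_subgroup_lat)
  define coord where "coord c d \<longleftrightarrow> (\<exists>x::int. c * u = of_int x * (u / of_nat n) + of_int d * v)" for c d
  have ex: "\<exists>d. coord c d" if "c \<in> H" for c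
  proof -
    have "c * u \<in> ?M" using that lat_basis_mem(1)[of u v] unfolding H_def lattice_mult_def by blast
    then show ?thesis by (rule latE) (auto simp: coord_def)
  qed
  have real: "c \<in> \<real>" if c0: "coord c 0" for c
  proof -
    obtain x :: int where "c * u = of_int x * (u / of_nat n) + of_int 0 * v" using c0 unfolding coord_def by blast
    then have "c = of_real (of_int x / of_nat n)" using u0 n by (simp add: field_simps)
    then show ?thesis by simp
  qed
  have cdiff: "coord (c - of_int k * c') (d - k * d')" if cd: "coord c d" "coord c' d'" for c c' d d' k
  proof -
    obtain x x' :: int where x: "c * u = of_int x * (u / of_nat n) + of_int d * v"
      and x': "c' * u = of_int x' * (u / of_nat n) + of_int d' * v"
      using cd unfolding coord_def by blast
    have "(c - of_int k * c') * u = c * u - of_int k * (c' * u)" by (simp add: algebra_simps)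
    also have "\<dots> = of_int (x - k * x') * (u / of_nat n) + of_int (d - k * d') * v"
      unfolding x x' by (simp add: left_diff_distrib distrib_left diff_divide_distrib)
    finally have "(c - of_int k * c') * u = of_int (x - k * x') * (u / of_nat n) + of_int (d - k * d') * v" .
    then show ?thesis unfolding coord_def by blast
  qed
  have "\<exists>d::nat. d > 0 \<and> (\<exists>c\<in>H. coord c (int d))"
  proof -
    obtain c where c: "c \<in> H" "c \<notin> \<real>" using False by blast
    obtain d where d: "coord c d" using ex[OF c(1)] by blast
    have "d \<noteq> 0" using real d c(2) by blast
    have "coord 0 0" by (auto simp: coord_def intro!: exI[of _ 0])
    from cdiff[OF this d, of 1] have "coord (- c) (- d)" by simp
    moreover have "- c \<in> H" using c(1) H0 add_subgroup_minus by blast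
    ultimately show ?thesis using d c(1) \<open>d \<noteq> 0\<close>
      by (intro exI[of _ "nat \<bar>d\<bar>"]) (cases "d > 0", auto)
  qed
  then obtain d :: nat where d: "d > 0" "\<exists>c\<in>H. coord c (int d)"
    and min: "\<And>e. e < d \<Longrightarrow> \<not> (e > 0 \<and> (\<exists>c\<in>H. coord c (int e)))"
    using exists_least_iff[of "\<lambda>d::nat. d > 0 \<and> (\<exists>c\<in>H. coord c (int d))"] by blast
  obtain g where g: "g \<in> H" "coord g (int d)" using d by blast
  have g_im: "Im g \<noteq> 0"
  proof
    assume "Im g = 0"
    then have gr: "g = of_real (Re g)" by (simp add: complex_eq_iff)
    obtain x where "g * u = of_int x * (u / of_nat n) + of_int (int d) * v" using g(2) by (auto simp: coord_def)
    then have "of_real (Re g * of_nat n) * (u / of_nat n) + of_real 0 * v = of_real (of_int x) * (u / of_nat n) + of_real (of_nat d) * v"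
      using n gr by (simp add: mult.commute)
    from real_coords_unique(2)[OF im' this] show False using d by simp
  qed
  have one: "1 \<in> H" using lat_subset_lat_divide[OF n] by (auto simp: H_def lattice_mult_def)
  have "H = lat 1 g"
  proof
    show "lat 1 g \<subseteq> H" using lat_subset_iff[OF H0] one g(1) by simp
    show "H \<subseteq> lat 1 g"
    proof
      fix c assume c: "c \<in> H"
      obtain e where e: "coord c e" using ex[OF c] by blast
      define c' where "c' = c - of_int (e div int d) * g"
      have c': "c' \<in> H" using c g(1) H0 by (simp add: c'_def add_subgroup_diff add_subgroup_of_int)
      have "coord c' (e mod int d)" using cdiff[OF e g(2), of "e div int d"] by (simp add: c'_def minus_div_mult_eq_mod)
      moreover have "e mod int d = 0"
      proof (rule ccontr)
        assume "e mod int d \<noteq> 0"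
        moreover have "0 \<le> e mod int d" "e mod int d < int d" using d(1) by auto
        ultimately have "nat (e mod int d) < d" "nat (e mod int d) > 0" "int (nat (e mod int d)) = e mod int d" by auto
        then show False using min c' \<open>coord c' (e mod int d)\<close> by metis
      qed
      ultimately have "c' \<in> \<real>" using real by simp
      then obtain t where t: "c' = of_real t" by (auto elim: Reals_cases)
      then have "t \<in> \<int>" using c' lattice_mult_real_imp_int[OF im _ n] by (auto simp: H_def)
      then obtain m where "t = of_int m" by (auto elim: Ints_cases)
      then have "c = of_int m * 1 + of_int (e div int d) * g" using t by (simp add: c'_def algebra_simps)
      then show "c \<in> lat 1 g" by (rule latI)
    qed
  qed
  then show ?thesis using g_im by blast
qed

text \<open>
Multiplication by \<open>k\<close> identifies the multipliers into \<open>\<int>u/n + \<int>v\<close> with those into \<open>L2\<close>.  If there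
were others than integers, they would form a lattice and the Picard number would be \<open>4\<close>.
\<close>

lemma picard_number_3_imp_int:
  assumes im: "Im (v / u) \<noteq> 0" and n: "n > 0" and k: "k \<noteq> 0"
    and M: "{z. k * z \<in> L2} = lat (u / of_nat n) v"
    and pic: "picard_number (prod_lattice (lat u v) L2) = 3"
    and c: "lattice_mult c (lat u v) (lat (u / of_nat n) v)"
  shows "\<exists>m::int. c = of_int m"
proof -
  have kL2: "z \<in> L2 \<longleftrightarrow> z / k \<in> lat (u / of_nat n) v" for z
    using k by (simp add: M[symmetric])
  have L2: "L2 = lat (k * (u / of_nat n)) (k * v)"
  proof -
    have "L2 = (*) k ` lat (u / of_nat n) v"
    proof (intro equalityI subsetI)
      fix z assume "z \<in> L2"
      then have "z / k \<in> lat (u / of_nat n) v" "z = k * (z / k)" using kL2 k by auto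
      then show "z \<in> (*) k ` lat (u / of_nat n) v" by blast
    qed (use M in auto)
    then show ?thesis by (simp only: lat_scale)
  qed
  have "k * v / (k * (u / of_nat n)) = v / (u / of_nat n)" using k by (rule mult_divide_mult_cancel_left)
  then have im': "Im (k * v / (k * (u / of_nat n))) \<noteq> 0" using im n by (simp only: Im_div_divide) simp
  have False if g: "Im g \<noteq> 0" "{c. lattice_mult c (lat u v) (lat (u / of_nat n) v)} = lat 1 g" for g
  proof -
    have "lattice_mult c (lat u v) L2 \<longleftrightarrow> lattice_mult (c / k) (lat u v) (lat (u / of_nat n) v)" for c
      by (simp add: lattice_mult_def kL2)
    then have "{c. lattice_mult c (lat u v) L2} = {c. c / k \<in> lat 1 g}" using g(2) by blast
    also have "\<dots> = (*) k ` lat 1 g"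
    proof (intro equalityI subsetI)
      fix z assume "z \<in> {c. c / k \<in> lat 1 g}"
      then have "z / k \<in> lat 1 g" "z = k * (z / k)" using k by auto
      then show "z \<in> (*) k ` lat 1 g" by blast
    qed (use k in auto)
    also have "\<dots> = lat k (k * g)" by (simp add: lat_scale)
    finally have "picard_number (prod_lattice (lat u v) L2) = 4"
      unfolding L2 using picard_number_eq_4[OF im im', of "k * g" k] g(1) k by simp
    then show False using pic by simp
  qed
  then show ?thesis using lattice_mult_dichotomy[OF im n] c by blast
qed


section \<open>The orbit of the moduli point\<close>

theorem proposition4p7:
  fixes L1 L2 :: "complex set"
    and phi :: "complex set \<Rightarrow> complex set"
    and a b :: "nat \<times> nat \<Rightarrow> int"
    and N :: nat
  assumes "period_lattice L1" and "period_lattice L2"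
    and "picard_number (prod_lattice L1 L2) = 3"
    and "\<not> ell_isomorphic L1 L2"
    and "N = NS_number (prod_lattice L1 L2)"
    and "isogeny L1 L2 phi" and "isog_degree L1 L2 phi = N"
    and "cyclic_subgroup L1 N (kernel (ell L1) (ell L2) phi)"
    and "\<forall>\<sigma>\<in>Sig N. a \<sigma> * int (fst \<sigma>) + b \<sigma> * int (snd \<sigma>) = 1"
  shows "orbit (atkin_lehner_group N) (\<lambda>w. w) (omega L1 L2 (std_decomposition L1 L2)) =
    (\<Union>\<sigma>\<in>Sig N.
       {omega L1 L2 (sigma_decomposition L1 L2 phi \<sigma> (a \<sigma>) (b \<sigma>)),
        omega L1 L2 (prod.swap (sigma_decomposition L1 L2 phi \<sigma> (a \<sigma>) (b \<sigma>)))})"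
proof -
  note L = assms(1,2) and ab = assms(9)
  note add = L[THEN period_lattice_add_subgroup]
  obtain c where c: "c \<noteq> 0" "lattice_mult c L1 L2" "\<And>z. phi (pt L1 z) = pt L2 (c * z)"
    using isogeny_mult[OF L assms(6)] by metis
  define M where "M = {z. c * z \<in> L2}"
  have ker: "kernel (ell L1) (ell L2) phi = pt L1 ` M"
    using kernel_mult[OF add c(3)] by (simp add: M_def)
  obtain u v where N: "N > 0" and im: "Im (v / u) > 0" and L1: "L1 = lat u v"
    and C: "pt L1 ` M = pt L1 ` lat (u / of_nat N) v"
    using cyclic_subgroup_basis[OF L(1) assms(8)] unfolding ker by metis
  have im0: "Im (v / u) \<noteq> 0" using im by simp
  have sub: "L1 \<subseteq> lat (u / of_nat N) v" using lat_subset_lat_divide[OF N] L1 by simp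
  have "add_subgroup M" "L1 \<subseteq> M" using c(2) add by (auto simp: M_def add_subgroup_vimage lattice_mult_iff)
  then have M: "M = lat (u / of_nat N) v"
    using Union_pt_image[OF add(1)] sub add_subgroup_lat C by metis
  have Meq: "{z. c * z \<in> L2} = lat (u / of_nat N) v" using M by (simp add: M_def)
  have int: "\<exists>m::int. d = of_int m" if "lattice_mult d (lat u v) (lat (u / of_nat N) v)" for d
    using picard_number_3_imp_int[OF im0 N c(1) Meq _ that] assms(3) L1 by simp
  have gen: "\<exists>m::int. d = of_int m * c" if "lattice_mult d L1 L2" for d
  proof -
    have "c * (d / c * z) = d * z" for z using c(1) by simp
    then have "lattice_mult (d / c) (lat u v) (lat (u / of_nat N) v)"
      using that L1 unfolding lattice_mult_def Meq[symmetric] by simp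
    then obtain m :: int where "d / c = of_int m" using int by blast
    then show ?thesis using c(1) by (intro exI[of _ m]) (simp add: field_simps)
  qed
  \<comment> \<open>The common value: the image of the base point under the involution belonging to \<open>r\<close>.\<close>
  define P where "P r = moduli_point N (lat (u / of_nat r) v)
    (pt (lat (u / of_nat r) v) ` lat (u / of_nat N) (v / of_nat r))" for r
  have std: "omega L1 L2 (std_decomposition L1 L2) = moduli_point N L1 (pt L1 ` lat (u / of_nat N) v)"
    using omega_std[OF L c(1,2) gen assms(5) N] card_pt_lat[OF im0 N] unfolding Meq L1 by blast
  have al: "atkin_lehner N r (omega L1 L2 (std_decomposition L1 L2)) = P r" if "r dvd N" "gcd r (N div r) = 1" for r
  proof -
    define s where "s = N div r"
    have N': "N = r * s" and cop: "coprime r s" using that by (auto simp: s_def coprime_iff_gcd_eq_1)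
    show ?thesis
      unfolding std P_def unfolding L1 N' by (rule atkin_lehner_moduli_point[OF im cop N[unfolded N']])
  qed
  have sigma: "omega L1 L2 (sigma_decomposition L1 L2 phi \<sigma> (a \<sigma>) (b \<sigma>)) = P (fst \<sigma>)"
    "omega L1 L2 (prod.swap (sigma_decomposition L1 L2 phi \<sigma> (a \<sigma>) (b \<sigma>))) = P (snd \<sigma>)" if "\<sigma> \<in> Sig N" for \<sigma>
  proof -
    obtain r s where rs: "\<sigma> = (r, s)" by (cases \<sigma>)
    have N': "N = r * s" and cop: "coprime r s" using that by (auto simp: rs Sig_def coprime_iff_gcd_eq_1)
    have ab': "a \<sigma> * int r + b \<sigma> * int s = 1" using ab that by (auto simp: rs)
    have sd: "sigma_decomposition L1 L2 phi \<sigma> (a \<sigma>) (b \<sigma>) =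
      (lin_curve L1 L2 (of_nat r) (- c), lin_curve L1 L2 (of_int (b \<sigma>) * of_nat s) (of_int (a \<sigma>) * c))"
      unfolding rs using sigma_decomposition_lin_curve[OF im0 cop N[unfolded N'] L1 add(2) c(3) Meq[unfolded N']] .
    note om = omega_sigma[OF L im0 cop N[unfolded N'] assms(5)[unfolded N'] L1 c(1) Meq[unfolded N'] int[unfolded N'] ab']
    show "omega L1 L2 (sigma_decomposition L1 L2 phi \<sigma> (a \<sigma>) (b \<sigma>)) = P (fst \<sigma>)"
      "omega L1 L2 (prod.swap (sigma_decomposition L1 L2 phi \<sigma> (a \<sigma>) (b \<sigma>))) = P (snd \<sigma>)"
      unfolding sd P_def N' using om by (simp_all add: rs)
  qed
  have "orbit (atkin_lehner_group N) (\<lambda>w. w) (omega L1 L2 (std_decomposition L1 L2))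
      = P ` {r. r dvd N \<and> gcd r (N div r) = 1}"
    using al by (auto simp: orbit_def atkin_lehner_group_def)
  also have "{r. r dvd N \<and> gcd r (N div r) = 1} = (\<Union>\<sigma>\<in>Sig N. {fst \<sigma>, snd \<sigma>})"
  proof (intro equalityI subsetI)
    fix r assume "r \<in> {r. r dvd N \<and> gcd r (N div r) = 1}"
    then obtain s where s: "N = r * s" "gcd r s = 1" using N by (auto elim!: dvdE)
    then have "(if r \<le> s then (r, s) else (s, r)) \<in> Sig N" using N by (auto simp: Sig_def gcd.commute mult.commute)
    then show "r \<in> (\<Union>\<sigma>\<in>Sig N. {fst \<sigma>, snd \<sigma>})" by (rule UN_I) auto
  next
    fix r assume "r \<in> (\<Union>\<sigma>\<in>Sig N. {fst \<sigma>, snd \<sigma>})"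
    then show "r \<in> {r. r dvd N \<and> gcd r (N div r) = 1}" by (auto simp: Sig_def gcd.commute)
  qed
  also have "P ` (\<Union>\<sigma>\<in>Sig N. {fst \<sigma>, snd \<sigma>}) = (\<Union>\<sigma>\<in>Sig N. {P (fst \<sigma>), P (snd \<sigma>)})" by auto
  also have "\<dots> = (\<Union>\<sigma>\<in>Sig N.
       {omega L1 L2 (sigma_decomposition L1 L2 phi \<sigma> (a \<sigma>) (b \<sigma>)),
        omega L1 L2 (prod.swap (sigma_decomposition L1 L2 phi \<sigma> (a \<sigma>) (b \<sigma>)))})"
    using sigma by simp
  finally show ?thesis .
qed

end
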